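(* Let $T>0$ and let $\eta$ be a modulus of continuity on $[0,T]$ such that: (1) $\eta\in C^2(0,T)$ and the function $x\mapsto(\eta^2)'(x)$ is positive and non-increasing on $(0,T)$; (2) $\eta$ grows near zero faster than any power function, i.e. for every $a>0$, $x^a/\eta(x)\to0$ as $x\downarrow0$; (3) $\eta$ satisfies Fernique's condition $\int_{a}^{\infty}\eta(u^{-1})(\log u)^{-1/2}\frac{du}{u}<\infty$ for some $a>1$ (with $a\ge1/T$). Let $\tau(x)=\sqrt{(\eta^2)'(x)}$, $x\in(0,T)$, let $B$ be a standard Brownian motion, and let $$\widehat{B}_t^{(\eta)}=\int_0^t\tau(t-s)\,dB_s,\quad t\in[0,T].$$ Then $\widehat{B}^{(\eta)}$ is a continuous super rough Volterra Gaussian process.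
   Context: A modulus of continuity on $[0,T]$ is a bounded function $\eta:[0,T]\to[0,\infty)$ with $\eta(0)=0$ and $\lim_{u\to0}\eta(u)=0$. A Gaussian process on $[0,T]$ is Volterra if it has the form $\int_0^tK(t,s)dB_s$ with $K$ admissible of Volterra type: $K$ is Borel measurable and square-integrable on $[0,T]^2$; for every $t\in(0,T]$ the slice $K(t,\cdot)$ is in $L^2[0,T]$ and not a.e. zero; $K(t,s)=0$ for $s>t$. Here $K(t,s)=\tau(t-s)$ for $s<t$ (values on Lebesgue-null sets of $s$ are immaterial). Continuous means that the process has a continuous version (which is used). For $r\in(0,1)$, $C^r$ is the class of continuous functions $f$ on $[0,T]$ with $\sup_{0\le s<t\le T}\frac{|f(t)-f(s)|}{(t-s)^r}<\infty$. A Gaussian process is super rough if $\mathbb{P}$-almost all its sample paths do not belong to any of the classes $C^r$, $0<r<1$. *)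

theory Defs
  imports "HOL-Probability.Probability"
begin

section \<open>Deterministic notions\<close>

definition modulus_of_continuity :: "real \<Rightarrow> (real \<Rightarrow> real) \<Rightarrow> bool" where
  "modulus_of_continuity T \<eta> \<longleftrightarrow>
     (\<forall>u\<in>{0..T}. 0 \<le> \<eta> u) \<and> bounded (\<eta> ` {0..T}) \<and> \<eta> 0 = 0 \<and>
     (\<eta> \<longlongrightarrow> 0) (at 0 within {0..T})"

text \<open>Twice continuously differentiable on an open set.\<close>
definition C2_on :: "real set \<Rightarrow> (real \<Rightarrow> real) \<Rightarrow> bool" where
  "C2_on S f \<longleftrightarrow>
     f differentiable_on S \<and> deriv f differentiable_on S \<and> continuous_on S (deriv (deriv f))"

definition fernique_condition :: "real \<Rightarrow> (real \<Rightarrow> real) \<Rightarrow> bool" where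
  "fernique_condition T \<eta> \<longleftrightarrow>
     (\<exists>a>1. a \<ge> 1 / T \<and>
        set_integrable lborel {a..} (\<lambda>u. \<eta> (inverse u) * ln u powr (- 1 / 2) / u))"

definition holder_class :: "real \<Rightarrow> real \<Rightarrow> (real \<Rightarrow> real) set" where
  "holder_class T r =
     {f. continuous_on {0..T} f \<and>
         bdd_above {\<bar>f t - f s\<bar> / (t - s) powr r | s t. 0 \<le> s \<and> s < t \<and> t \<le> T}}"

definition square_integrable_upto :: "real \<Rightarrow> (real \<Rightarrow> real) \<Rightarrow> bool" where
  "square_integrable_upto T f \<longleftrightarrow>
     set_borel_measurable lborel {0..T} f \<and> set_integrable lborel {0..T} (\<lambda>s. (f s)\<^sup>2)"

definition admissible_volterra_kernel :: "real \<Rightarrow> (real \<Rightarrow> real \<Rightarrow> real) \<Rightarrow> bool" where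
  "admissible_volterra_kernel T K \<longleftrightarrow>
     set_borel_measurable lborel ({0..T} \<times> {0..T}) (\<lambda>(t, s). K t s) \<and>
     set_integrable lborel ({0..T} \<times> {0..T}) (\<lambda>(t, s). (K t s)\<^sup>2) \<and>
     (\<forall>t\<in>{0<..T}. square_integrable_upto T (K t) \<and>
                  \<not> (AE s in lborel. s \<in> {0..T} \<longrightarrow> K t s = 0)) \<and>
     (\<forall>t\<in>{0..T}. \<forall>s\<in>{0..T}. t < s \<longrightarrow> K t s = 0)"

section \<open>Brownian motion and the Wiener integral\<close>

text \<open>A finite increasing grid \<open>p 0 < ... < p n\<close> of times in \<open>[0, T]\<close>.\<close>
definition time_grid :: "real \<Rightarrow> nat \<Rightarrow> (nat \<Rightarrow> real) \<Rightarrow> bool" where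
  "time_grid T n p \<longleftrightarrow> 0 \<le> p 0 \<and> p n \<le> T \<and> (\<forall>i<n. p i < p (Suc i))"

definition standard_brownian_motion ::
    "'a measure \<Rightarrow> real \<Rightarrow> (real \<Rightarrow> 'a \<Rightarrow> real) \<Rightarrow> bool" where
  "standard_brownian_motion M T B \<longleftrightarrow>
     prob_space M \<and>
     (\<forall>t\<in>{0..T}. B t \<in> borel_measurable M) \<and>
     (AE \<omega> in M. B 0 \<omega> = 0) \<and>
     (\<forall>n p. time_grid T n p \<longrightarrow>
        prob_space.indep_vars M (\<lambda>_. borel) (\<lambda>i \<omega>. B (p (Suc i)) \<omega> - B (p i) \<omega>) {..<n}) \<and>
     (\<forall>s t. 0 \<le> s \<and> s < t \<and> t \<le> T \<longrightarrow>
        distributed M lborel (\<lambda>\<omega>. B t \<omega> - B s \<omega>)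
          (\<lambda>x. ennreal (normal_density 0 (sqrt (t - s)) x))) \<and>
     (AE \<omega> in M. continuous_on {0..T} (\<lambda>t. B t \<omega>))"

definition step_fun :: "nat \<Rightarrow> (nat \<Rightarrow> real) \<Rightarrow> (nat \<Rightarrow> real) \<Rightarrow> real \<Rightarrow> real" where
  "step_fun n p c s = (\<Sum>i<n. c i * indicator {p i<..p (Suc i)} s)"

definition step_integral ::
    "(real \<Rightarrow> 'a \<Rightarrow> real) \<Rightarrow> nat \<Rightarrow> (nat \<Rightarrow> real) \<Rightarrow> (nat \<Rightarrow> real) \<Rightarrow> 'a \<Rightarrow> real" where
  "step_integral B n p c \<omega> = (\<Sum>i<n. c i * (B (p (Suc i)) \<omega> - B (p i) \<omega>))"

text \<open>
  \<open>X\<close> is a representative of the integral of \<open>f\<close> over \<open>[0, t]\<close> against \<open>B\<close>: the mean-square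
  limit of the elementary integrals of step functions converging to \<open>f\<close> in \<open>L\<^sup>2[0, t]\<close>.
  The nonnegative integral is used so that a non-integrable square does not count as \<open>0\<close>.
\<close>
definition has_wiener_integral ::
    "'a measure \<Rightarrow> (real \<Rightarrow> 'a \<Rightarrow> real) \<Rightarrow> real \<Rightarrow> (real \<Rightarrow> real) \<Rightarrow> ('a \<Rightarrow> real) \<Rightarrow> bool" where
  "has_wiener_integral M B t f X \<longleftrightarrow>
     square_integrable_upto t f \<and> X \<in> borel_measurable M \<and>
     (\<exists>N p c.
        (\<forall>k::nat. time_grid t (N k) (p k)) \<and>
        (\<lambda>k. \<integral>\<^sup>+s\<in>{0..t}. ennreal ((f s - step_fun (N k) (p k) (c k) s)\<^sup>2) \<partial>lborel)
          \<longlonglongrightarrow> 0 \<and>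
        (\<lambda>k. \<integral>\<^sup>+\<omega>. ennreal ((X \<omega> - step_integral B (N k) (p k) (c k) \<omega>)\<^sup>2) \<partial>M)
          \<longlonglongrightarrow> 0)"

text \<open>The integral is determined only up to almost sure equality; a representative is chosen.\<close>
definition wiener_integral ::
    "'a measure \<Rightarrow> (real \<Rightarrow> 'a \<Rightarrow> real) \<Rightarrow> real \<Rightarrow> (real \<Rightarrow> real) \<Rightarrow> 'a \<Rightarrow> real" where
  "wiener_integral M B t f = (SOME X. has_wiener_integral M B t f X)"

section \<open>Gaussian processes\<close>

text \<open>Degenerate (almost surely constant) variables count as Gaussian.\<close>
definition gaussian_rv :: "'a measure \<Rightarrow> ('a \<Rightarrow> real) \<Rightarrow> bool" where
  "gaussian_rv M X \<longleftrightarrow> X \<in> borel_measurable M \<and>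
     (\<exists>\<mu>. (AE \<omega> in M. X \<omega> = \<mu>) \<or>
          (\<exists>\<sigma>>0. distributed M lborel X (\<lambda>x. ennreal (normal_density \<mu> \<sigma> x))))"

definition gaussian_process :: "'a measure \<Rightarrow> real \<Rightarrow> (real \<Rightarrow> 'a \<Rightarrow> real) \<Rightarrow> bool" where
  "gaussian_process M T X \<longleftrightarrow>
     (\<forall>J c. finite J \<and> J \<subseteq> {0..T} \<longrightarrow> gaussian_rv M (\<lambda>\<omega>. \<Sum>t\<in>J. c t * X t \<omega>))"

definition volterra_gaussian_process ::
    "'a measure \<Rightarrow> real \<Rightarrow> (real \<Rightarrow> 'a \<Rightarrow> real) \<Rightarrow> (real \<Rightarrow> real \<Rightarrow> real) \<Rightarrow>
     (real \<Rightarrow> 'a \<Rightarrow> real) \<Rightarrow> bool" where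
  "volterra_gaussian_process M T B K X \<longleftrightarrow>
     gaussian_process M T X \<and> admissible_volterra_kernel T K \<and>
     (\<forall>t\<in>{0..T}. has_wiener_integral M B t (K t) (X t))"

definition continuous_version ::
    "'a measure \<Rightarrow> real \<Rightarrow> (real \<Rightarrow> 'a \<Rightarrow> real) \<Rightarrow> (real \<Rightarrow> 'a \<Rightarrow> real) \<Rightarrow> bool" where
  "continuous_version M T X Y \<longleftrightarrow>
     (\<forall>t\<in>{0..T}. Y t \<in> borel_measurable M \<and> (AE \<omega> in M. Y t \<omega> = X t \<omega>)) \<and>
     (\<forall>\<omega>\<in>space M. continuous_on {0..T} (\<lambda>t. Y t \<omega>))"

text \<open>A property of the sample paths, to be applied to a continuous version.\<close>
definition super_rough :: "'a measure \<Rightarrow> real \<Rightarrow> (real \<Rightarrow> 'a \<Rightarrow> real) \<Rightarrow> bool" where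
  "super_rough M T Y \<longleftrightarrow>
     (AE \<omega> in M. \<forall>r\<in>{0<..<1}. (\<lambda>t. Y t \<omega>) \<notin> holder_class T r)"

section \<open>The process associated with a modulus of continuity\<close>

text \<open>
  Only the values on \<open>(0, T)\<close> are meaningful; the points \<open>0\<close> and \<open>T\<close> affect the integrands
  below on Lebesgue null sets only.
\<close>
definition tau :: "(real \<Rightarrow> real) \<Rightarrow> real \<Rightarrow> real" where
  "tau \<eta> x = sqrt (deriv (\<lambda>y. (\<eta> y)\<^sup>2) x)"

definition conv_kernel :: "(real \<Rightarrow> real) \<Rightarrow> real \<Rightarrow> real \<Rightarrow> real" where
  "conv_kernel \<tau> t s = (if s < t then \<tau> (t - s) else 0)"

definition B_hat ::
    "'a measure \<Rightarrow> (real \<Rightarrow> 'a \<Rightarrow> real) \<Rightarrow> (real \<Rightarrow> real) \<Rightarrow> real \<Rightarrow> 'a \<Rightarrow> real" where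
  "B_hat M B \<eta> t = wiener_integral M B t (\<lambda>s. tau \<eta> (t - s))"

end

theory Submission
  imports Defs
begin

text \<open>
  Integration against \<open>B\<close> is an isometry from \<open>L\<^sup>2\<close> to centered Gaussian variables, so
  \<open>X t = B_hat M B \<eta> t\<close> is Gaussian with variance \<open>G t\<close>, where \<open>G x\<close> is the integral of
  \<open>\<tau>\<^sup>2 = (\<eta>\<^sup>2)'\<close> over \<open>(0, x)\<close> and equals \<open>(\<eta> x)\<^sup>2\<close> for \<open>x < T\<close>. Since \<open>\<tau>\<close> is non-increasing,
  \<open>(a - b)\<^sup>2 \<le> a\<^sup>2 - b\<^sup>2\<close> for \<open>a \<ge> b \<ge> 0\<close> gives \<open>E (X t - X s)\<^sup>2 \<le> 2 G (t - s)\<close>.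

  Continuity is Fernique's chaining along the grids of mesh \<open>T / 2 ^ 2 ^ p\<close>: the Gaussian tail at
  level \<open>4 * sqrt (2 ^ p)\<close> beats the number of grid points, and Fernique's integral is comparable to
  the sum of \<open>sqrt (2 ^ p) * \<eta> (T / 2 ^ 2 ^ p)\<close>. By Borel--Cantelli almost every path is uniformly
  continuous on the union of the grids and extends to \<open>[0, T]\<close>.

  Roughness already shows at time \<open>0\<close>: if \<open>\<bar>Y t - Y 0\<bar> \<le> C * t powr a\<close> for all \<open>t\<close>, then a standard
  normal variable is bounded by \<open>C * t powr a / \<eta> t\<close>, which tends to \<open>0\<close>.
\<close>

section \<open>Step functions and time grids\<close>

text \<open>\<open>B_hat\<close> is obtained by \<open>SOME\<close>, so nothing at all is known
  about it until a Wiener integral of the kernel is shown to exist. The obstacle is that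
  \<open>tau \<eta>\<close> may blow up at \<open>0\<close>, hence the integrand at the right end of
  \<open>[0, t]\<close>. Monotonicity removes it: sums that sample at left endpoints stay below the
  integrand, which then dominates the error by itself. Laws are carried by characteristic functions,
  because these pass to mean-square limits and do not single out degenerate variables. Nothing is
  assumed about \<eta> near \<open>T\<close> beyond boundedness, and \<open>tau \<eta>\<close> is
  meaningless at \<open>0\<close> and \<open>T\<close>. Variances are therefore integrals of a
  truncated kernel, monotone on the whole line, and are compared with \<eta> only at times strictly
  inside \<open>(0, T)\<close>. This is also why every mesh has to be smaller than \<open>T\<close>.
  Super roughness asks for one null set serving every exponent and every constant; since a bound
  with a larger exponent implies one with a smaller exponent on a bounded interval, countably many
  pairs suffice.\<close>

text \<open>
  At \<open>\<phi> = (\<lambda>t. B t \<omega>)\<close> this is \<^const>\<open>step_integral\<close>, at \<open>\<phi> = indicator {s..}\<close> it is \<^const>\<open>step_fun\<close>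
  at \<open>s\<close>. An identity between step forms that holds for all \<open>\<phi>\<close> therefore transfers to both.
\<close>
definition step_form :: "nat \<Rightarrow> (nat \<Rightarrow> real) \<Rightarrow> (nat \<Rightarrow> real) \<Rightarrow> (real \<Rightarrow> real) \<Rightarrow> real" where
  "step_form n p c \<phi> = (\<Sum>i<n. c i * (\<phi> (p (Suc i)) - \<phi> (p i)))"

lemma step_integral_eq_step_form: "step_integral B n p c \<omega> = step_form n p c (\<lambda>t. B t \<omega>)"
  by (simp add: step_integral_def step_form_def)

lemma time_grid_strict_mono:
  assumes "time_grid T n p" "i < j" "j \<le> n"
  shows "p i < p j"
  using assms(2,3)
proof (induction j)
  case (Suc j)
  have "p j < p (Suc j)" using assms(1) Suc.prems by (auto simp: time_grid_def)
  then show ?case using Suc by (cases "i = j") auto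
qed simp

lemma time_grid_mono:
  assumes "time_grid T n p" "i \<le> j" "j \<le> n"
  shows "p i \<le> p j"
  using time_grid_strict_mono[OF assms(1), of i j] assms by (cases "i = j") auto

lemma time_grid_bounds:
  assumes "time_grid T n p" "i \<le> n"
  shows "0 \<le> p i" "p i \<le> T"
  using time_grid_mono[OF assms(1), of 0 i] time_grid_mono[OF assms(1), of i n] assms
  by (auto simp: time_grid_def)

lemma time_grid_mono_horizon: "time_grid t n p \<Longrightarrow> t \<le> T \<Longrightarrow> time_grid T n p"
  by (auto simp: time_grid_def)

lemma step_fun_eq_step_form:
  assumes "time_grid T n p"
  shows "step_fun n p c s = step_form n p c (indicator {s..})"
  unfolding step_fun_def step_form_def
proof (rule sum.cong[OF refl])
  fix i assume "i \<in> {..<n}"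
  then have "p i < p (Suc i)" using assms by (auto simp: time_grid_def)
  then show "c i * indicator {p i<..p (Suc i)} s
      = c i * (indicator {s..} (p (Suc i)) - indicator {s..} (p i))"
    by (auto simp: indicator_def)
qed

text \<open>
  A form depending on finitely many values of \<open>\<phi>\<close>, with weights summing to zero. These are exactly the
  step forms, and they need no common refinement of grids when they are added.
\<close>
definition null_point_form :: "real \<Rightarrow> ((real \<Rightarrow> real) \<Rightarrow> real) \<Rightarrow> bool" where
  "null_point_form T L \<longleftrightarrow> (\<exists>P w. finite P \<and> P \<noteq> {} \<and> P \<subseteq> {0..T} \<and> sum w P = 0 \<and>
     (\<forall>\<phi>. L \<phi> = (\<Sum>x\<in>P. w x * \<phi> x)))"

lemma null_point_form_add:
  assumes "null_point_form T L" "null_point_form T L'"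
  shows "null_point_form T (\<lambda>\<phi>. a * L \<phi> + b * L' \<phi>)"
proof -
  obtain P w where P: "finite P" "P \<noteq> {}" "P \<subseteq> {0..T}" "sum w P = 0"
    "\<And>\<phi>. L \<phi> = (\<Sum>x\<in>P. w x * \<phi> x)" using assms(1) unfolding null_point_form_def by blast
  obtain Q v where Q: "finite Q" "Q \<noteq> {}" "Q \<subseteq> {0..T}" "sum v Q = 0"
    "\<And>\<phi>. L' \<phi> = (\<Sum>x\<in>Q. v x * \<phi> x)" using assms(2) unfolding null_point_form_def by blast
  let ?w = "\<lambda>x. a * (if x \<in> P then w x else 0) + b * (if x \<in> Q then v x else 0)"
  have *: "(\<Sum>x\<in>P \<union> Q. (if x \<in> P then w x else 0) * \<phi> x) = (\<Sum>x\<in>P. w x * \<phi> x)" for \<phi> :: "real \<Rightarrow> real"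
    by (rule sum.mono_neutral_cong_right) (use P(1) Q(1) in auto)
  have **: "(\<Sum>x\<in>P \<union> Q. (if x \<in> Q then v x else 0) * \<phi> x) = (\<Sum>x\<in>Q. v x * \<phi> x)" for \<phi> :: "real \<Rightarrow> real"
    by (rule sum.mono_neutral_cong_right) (use P(1) Q(1) in auto)
  have eq: "a * L \<phi> + b * L' \<phi> = (\<Sum>x\<in>P \<union> Q. ?w x * \<phi> x)" for \<phi>
  proof -
    have "(\<Sum>x\<in>P \<union> Q. ?w x * \<phi> x) = a * (\<Sum>x\<in>P \<union> Q. (if x \<in> P then w x else 0) * \<phi> x)
      + b * (\<Sum>x\<in>P \<union> Q. (if x \<in> Q then v x else 0) * \<phi> x)"
      by (simp add: distrib_right sum.distrib sum_distrib_left mult.assoc)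
    then show ?thesis unfolding * ** P(5) Q(5) by simp
  qed
  \<comment> \<open>The total weight is the value of the form at the constant function 1, and both
    given forms vanish there.\<close>
  have "sum ?w (P \<union> Q) = 0"
    using eq[of "\<lambda>_. 1"] P(4) Q(4) unfolding P(5) Q(5) by simp
  moreover have "finite (P \<union> Q)" "P \<union> Q \<noteq> {}" "P \<union> Q \<subseteq> {0..T}"
    using P(1-3) Q(1-3) by auto
  ultimately show ?thesis
    unfolding null_point_form_def using eq by blast
qed

lemma null_point_form_zero: "0 \<le> T \<Longrightarrow> null_point_form T (\<lambda>_. 0)"
  unfolding null_point_form_def by (intro exI[of _ "{0}"] exI[of _ "\<lambda>_. 0"]) auto

lemma null_point_form_sum:
  assumes "finite J" "\<And>j. j \<in> J \<Longrightarrow> null_point_form T (L j)" "0 \<le> T"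
  shows "null_point_form T (\<lambda>\<phi>. \<Sum>j\<in>J. a j * L j \<phi>)"
  using assms(1,2)
proof (induction J)
  case (insert j J)
  show ?case
    using null_point_form_add[of T "L j" "\<lambda>\<phi>. \<Sum>j\<in>J. a j * L j \<phi>" "a j" 1] insert by simp
qed (simp add: null_point_form_zero assms(3))

lemma null_point_form_step_form:
  assumes "time_grid T n p"
  shows "null_point_form T (step_form n p c)"
proof -
  have T: "0 \<le> T" using time_grid_bounds[OF assms, of 0] by simp
  have "null_point_form T (\<lambda>\<phi>. \<phi> (p (Suc i)) - \<phi> (p i))" if "i < n" for i
  proof -
    have "p i < p (Suc i)" using assms that by (auto simp: time_grid_def)
    moreover have "p i \<in> {0..T}" "p (Suc i) \<in> {0..T}"
      using time_grid_bounds[OF assms, of i] time_grid_bounds[OF assms, of "Suc i"] that by auto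
    ultimately show ?thesis
      unfolding null_point_form_def
      by (intro exI[of _ "{p i, p (Suc i)}"] exI[of _ "\<lambda>x. if x = p i then -1 else 1"]) auto
  qed
  then have "null_point_form T (\<lambda>\<phi>. \<Sum>i\<in>{..<n}. c i * (\<phi> (p (Suc i)) - \<phi> (p i)))"
    using T by (intro null_point_form_sum) auto
  then show ?thesis by (simp add: step_form_def[abs_def])
qed

text \<open>Summation by parts. For weights of total zero the boundary term drops, and what remains
  is a step form whose coefficients are minus the partial sums of the weights.\<close>

lemma abel_summation_step_form:
  "(\<Sum>j\<le>n. w j * \<phi> (p j)) = step_form n p (\<lambda>i. - (\<Sum>j\<le>i. w j)) \<phi> + (\<Sum>j\<le>n. w j) * \<phi> (p n)"
  by (induction n) (simp_all add: step_form_def algebra_simps)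

lemma null_point_form_imp_step_form:
  assumes "null_point_form T L"
  shows "\<exists>n p c. time_grid T n p \<and> (\<forall>\<phi>. L \<phi> = step_form n p c \<phi>)"
proof -
  obtain P w where P: "finite P" "P \<noteq> {}" "P \<subseteq> {0..T}" "sum w P = 0"
    "\<And>\<phi>. L \<phi> = (\<Sum>x\<in>P. w x * \<phi> x)" using assms(1) unfolding null_point_form_def by blast
  define xs where "xs = sorted_list_of_set P"
  define p where "p i = xs ! i" for i
  \<comment> \<open>A grid with \<open>n\<close> cells has the \<open>n + 1\<close> points
    \<open>p 0, ..., p n\<close>.\<close>
  define n where "n = length xs - 1"
  have len: "length xs = card P" "card P > 0" unfolding xs_def using P by (auto simp: card_gt_0_iff)
  have set: "set xs = P" "distinct xs" "sorted xs" unfolding xs_def using P by auto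
  have n: "i < length xs \<longleftrightarrow> i \<le> n" for i using len unfolding n_def by linarith
  have bij: "bij_betw p {..n} P"
    unfolding p_def using bij_betw_nth[OF set(2), of "{..n}" P] n set by (auto simp: set_eq_iff)
  have in_T: "p i \<in> {0..T}" if "i \<le> n" for i
    using bij that P(3) by (auto simp: bij_betw_def)
  have "p i < p (Suc i)" if "i < n" for i
    using set that n unfolding p_def
    by (meson Suc_leI sorted_wrt_nth_less lessI strict_sorted_iff)
  then have "time_grid T n p"
    using in_T[of 0] in_T[of n] by (auto simp: time_grid_def)
  moreover have "(\<Sum>x\<in>P. w x * \<phi> x) = step_form n p (\<lambda>i. - (\<Sum>j\<le>i. w (p j))) \<phi>" for \<phi>
  proof -
    have "(\<Sum>j\<le>n. w (p j)) = 0" using sum.reindex_bij_betw[OF bij, of w] P by simp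
    then show ?thesis
      using sum.reindex_bij_betw[OF bij, of "\<lambda>x. w x * \<phi> x"]
        abel_summation_step_form[of "\<lambda>j. w (p j)" \<phi> p n] by simp
  qed
  ultimately show ?thesis using P(5) by metis
qed

text \<open>The same grid and coefficients must work for the step functions and for their integrals;
  this is why the identity is stated for all \<phi> at once.\<close>

lemma step_form_linear_combination:
  assumes "finite J" "\<And>j. j \<in> J \<Longrightarrow> time_grid T (n j) (p j)" "0 \<le> T"
  shows "\<exists>m q d. time_grid T m q \<and>
    (\<forall>\<phi>. step_form m q d \<phi> = (\<Sum>j\<in>J. a j * step_form (n j) (p j) (c j) \<phi>))"
proof -
  have "null_point_form T (\<lambda>\<phi>. \<Sum>j\<in>J. a j * step_form (n j) (p j) (c j) \<phi>)"
    using assms by (intro null_point_form_sum null_point_form_step_form) auto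
  from null_point_form_imp_step_form[OF this] show ?thesis by metis
qed

section \<open>Pointwise values and square integrals of step functions\<close>

lemma step_fun_eq:
  assumes "time_grid T n p" and i: "i < n" "s \<in> {p i<..p (Suc i)}"
  shows "step_fun n p c s = c i"
proof -
  have u: "j = i" if "j < n" "s \<in> {p j<..p (Suc j)}" for j
  proof (rule ccontr)
    assume "j \<noteq> i"
    then consider "Suc j \<le> i" | "Suc i \<le> j" by linarith
    then show False
      using that i time_grid_mono[OF assms(1), of "Suc j" i] time_grid_mono[OF assms(1), of "Suc i" j]
      by cases auto
  qed
  have "step_fun n p c s = (\<Sum>j<n. if j = i then c i else 0)"
    unfolding step_fun_def
  proof (intro sum.cong refl)
    fix j assume "j \<in> {..<n}"
    then show "c j * indicator {p j<..p (Suc j)} s = (if j = i then c i else 0)"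
      using u[of j] i(2) by (cases "j = i") (auto simp: indicator_def)
  qed
  then show ?thesis using i by simp
qed

text \<open>The cells of a grid are disjoint, so no cross terms appear; this is what makes the
  square integral of a step function match a sum of variances of independent increments.\<close>

lemma step_fun_square:
  assumes "time_grid T n p"
  shows "(step_fun n p c s)\<^sup>2 = (\<Sum>i<n. (c i)\<^sup>2 * indicator {p i<..p (Suc i)} s)"
proof (cases "\<exists>i<n. s \<in> {p i<..p (Suc i)}")
  case True
  then obtain i where i: "i < n" "s \<in> {p i<..p (Suc i)}" by blast
  show ?thesis
    using step_fun_eq[OF assms i, of c] step_fun_eq[OF assms i, of "\<lambda>i. (c i)\<^sup>2"]
    by (simp add: step_fun_def)
next
  case False
  then have "indicator {p i<..p (Suc i)} s = (0::real)" if "i < n" for i using that by auto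
  then show ?thesis by (simp add: step_fun_def)
qed

lemma borel_measurable_step_fun [measurable]: "step_fun n p c \<in> borel_measurable borel"
  unfolding step_fun_def[abs_def] by measurable

lemma step_fun_outside:
  assumes "time_grid t n p" "s \<notin> {0..t}"
  shows "step_fun n p c s = 0"
  unfolding step_fun_def
proof (rule sum.neutral, rule ballI)
  fix i assume "i \<in> {..<n}"
  then show "c i * indicator {p i<..p (Suc i)} s = 0"
    using time_grid_bounds[OF assms(1), of i] time_grid_bounds[OF assms(1), of "Suc i"] assms(2)
    by (auto simp: indicator_def)
qed

lemma has_bochner_integral_step_fun_square:
  assumes "time_grid T n p"
  shows "has_bochner_integral lborel (\<lambda>s. (step_fun n p c s)\<^sup>2) (\<Sum>i<n. (c i)\<^sup>2 * (p (Suc i) - p i))"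
  unfolding step_fun_square[OF assms]
proof (intro has_bochner_integral_sum)
  fix i assume "i \<in> {..<n}"
  then have "p i < p (Suc i)" using assms by (auto simp: time_grid_def)
  then show "has_bochner_integral lborel (\<lambda>s. (c i)\<^sup>2 * indicator {p i<..p (Suc i)} s)
     ((c i)\<^sup>2 * (p (Suc i) - p i))"
    using has_bochner_integral_real_indicator[of "{p i<..p (Suc i)}" lborel]
    by (intro has_bochner_integral_mult_right) auto
qed

section \<open>Centered Gaussian variables\<close>

lemma norm_iexp_diff_le: "norm (iexp a - iexp b) \<le> \<bar>a - b\<bar>"
proof -
  have "iexp a - iexp b = iexp b * (iexp (a - b) - 1)"
    by (simp add: algebra_simps exp_diff)
  then have "norm (iexp a - iexp b) = norm (iexp (a - b) - 1)"
    by (simp add: norm_mult)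
  also have "\<dots> \<le> \<bar>a - b\<bar>" using iexp_approx1[of "a - b" 0] by simp
  finally show ?thesis .
qed

lemma integrable_power2_diff:
  fixes f g :: "'a \<Rightarrow> real"
  assumes "integrable M (\<lambda>x. (f x)\<^sup>2)" "integrable M (\<lambda>x. (g x)\<^sup>2)"
    and [measurable]: "f \<in> borel_measurable M" "g \<in> borel_measurable M"
  shows "integrable M (\<lambda>x. (f x - g x)\<^sup>2)"
proof (rule Bochner_Integration.integrable_bound)
  show "integrable M (\<lambda>x. 2 * (f x)\<^sup>2 + 2 * (g x)\<^sup>2)" using assms by simp
  have "(a - b)\<^sup>2 \<le> 2 * a\<^sup>2 + 2 * b\<^sup>2" for a b :: real
    using zero_le_power2[of "a + b"] by (simp add: power2_eq_square algebra_simps)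
  then show "AE x in M. norm ((f x - g x)\<^sup>2) \<le> norm (2 * (f x)\<^sup>2 + 2 * (g x)\<^sup>2)"
    by (intro AE_I2) (metis abs_of_nonneg real_norm_def zero_le_power2 order_trans abs_ge_self)
qed simp

text \<open>Young's inequality with a free weight \<open>e\<close> splits the cross term
  \<open>2 * x * (x - y)\<close>. A weight tending to zero slowly then gives convergence of second
  moments.\<close>

lemma abs_power2_diff_le:
  fixes x y e :: real
  assumes "0 < e"
  shows "\<bar>y\<^sup>2 - x\<^sup>2\<bar> \<le> e * x\<^sup>2 + (x - y)\<^sup>2 + (x - y)\<^sup>2 / e"
proof -
  have "0 \<le> (e * \<bar>x\<bar> - \<bar>x - y\<bar>)\<^sup>2 / e" using assms by simp
  also have "\<dots> = e * x\<^sup>2 + (x - y)\<^sup>2 / e - 2 * (\<bar>x\<bar> * \<bar>x - y\<bar>)"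
    using assms by (simp add: power2_eq_square field_simps)
  finally have "2 * \<bar>x * (x - y)\<bar> \<le> e * x\<^sup>2 + (x - y)\<^sup>2 / e" by (simp add: abs_mult)
  moreover have "y\<^sup>2 - x\<^sup>2 = (x - y)\<^sup>2 - 2 * (x * (x - y))" by (simp add: power2_eq_square algebra_simps)
  moreover have "0 \<le> (x - y)\<^sup>2" by simp
  ultimately show ?thesis by linarith
qed

lemma tendsto_integral_power2:
  fixes f :: "'a \<Rightarrow> real" and g :: "nat \<Rightarrow> 'a \<Rightarrow> real"
  assumes f: "integrable M (\<lambda>x. (f x)\<^sup>2)" and g: "\<And>k. integrable M (\<lambda>x. (g k x)\<^sup>2)"
    and [measurable]: "f \<in> borel_measurable M" "\<And>k. g k \<in> borel_measurable M"
    and lim: "(\<lambda>k. \<integral>\<^sup>+x. ennreal ((f x - g k x)\<^sup>2) \<partial>M) \<longlonglongrightarrow> 0"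
  shows "(\<lambda>k. \<integral>x. (g k x)\<^sup>2 \<partial>M) \<longlonglongrightarrow> (\<integral>x. (f x)\<^sup>2 \<partial>M)"
proof -
  define d where "d k = (\<integral>x. (f x - g k x)\<^sup>2 \<partial>M)" for k
  have int: "integrable M (\<lambda>x. (f x - g k x)\<^sup>2)" for k by (intro integrable_power2_diff f g) auto
  have "(\<lambda>k. ennreal (d k)) \<longlonglongrightarrow> ennreal 0"
    using lim by (simp add: d_def nn_integral_eq_integral[OF int])
  then have d: "d \<longlonglongrightarrow> 0" by (subst (asm) tendsto_ennreal_iff) (auto simp: d_def)
  have d0: "0 \<le> d k" for k by (simp add: d_def)
  \<comment> \<open>The square root balances the two errors, since \<open>d k / e k\<close> is then
    at most \<open>sqrt (d k)\<close>; the second summand keeps \<open>e k\<close> positive when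
    \<open>d k = 0\<close>.\<close>
  define e where "e k = sqrt (d k) + 1 / real (Suc k)" for k
  have e0: "0 < e k" for k unfolding e_def using d0 by (intro add_nonneg_pos) auto
  have e: "e \<longlonglongrightarrow> 0"
    unfolding e_def using tendsto_add[OF tendsto_real_sqrt[OF d] LIMSEQ_inverse_real_of_nat]
    by (simp add: inverse_eq_divide)
  let ?F = "\<integral>x. (f x)\<^sup>2 \<partial>M"
  have bd: "norm ((\<integral>x. (g k x)\<^sup>2 \<partial>M) - ?F) \<le> e k * ?F + d k + sqrt (d k)" for k
  proof -
    have "norm ((\<integral>x. (g k x)\<^sup>2 \<partial>M) - ?F) = norm (\<integral>x. (g k x)\<^sup>2 - (f x)\<^sup>2 \<partial>M)" using f g by simp
    also have "\<dots> \<le> (\<integral>x. \<bar>(g k x)\<^sup>2 - (f x)\<^sup>2\<bar> \<partial>M)" unfolding real_norm_def by (rule integral_abs_bound)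
    also have "\<dots> \<le> (\<integral>x. e k * (f x)\<^sup>2 + (f x - g k x)\<^sup>2 + (f x - g k x)\<^sup>2 / e k \<partial>M)"
      using f g int[of k] by (intro integral_mono abs_power2_diff_le e0) auto
    also have "\<dots> = e k * ?F + d k + d k / e k"
      using f int[of k] by (simp add: d_def)
    also have "d k / e k \<le> sqrt (d k)"
    proof -
      have "d k = sqrt (d k) * sqrt (d k)" using d0[of k] by simp
      also have "\<dots> \<le> sqrt (d k) * e k" using d0[of k] by (intro mult_left_mono) (auto simp: e_def)
      finally show ?thesis using e0[of k] by (simp add: field_simps)
    qed
    finally show ?thesis by simp
  qed
  have "(\<lambda>k. e k * ?F + d k + sqrt (d k)) \<longlonglongrightarrow> 0 * ?F + 0 + sqrt 0"
    by (intro tendsto_intros e d)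
  then have "(\<lambda>k. (\<integral>x. (g k x)\<^sup>2 \<partial>M) - ?F) \<longlonglongrightarrow> 0"
    by (intro Lim_null_comparison[OF always_eventually[OF allI[OF bd]]]) simp
  then show ?thesis by (simp add: LIM_zero_iff)
qed

section \<open>Gaussian laws through their characteristic functions\<close>

text \<open>A density would exclude \<open>v = 0\<close>, which does occur at time 0, and is awkward
  under limits. The characteristic function treats all variances alike, multiplies over independent
  sums and still determines the law.\<close>

definition centered_gaussian :: "'a measure \<Rightarrow> real \<Rightarrow> ('a \<Rightarrow> real) \<Rightarrow> bool" where
  "centered_gaussian M v Z \<longleftrightarrow> 0 \<le> v \<and> Z \<in> borel_measurable M \<and>
     (\<forall>u. char (distr M borel Z) u = complex_of_real (exp (- (v * u\<^sup>2 / 2))))"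

context prob_space
begin

lemma char_distr_eq:
  fixes Z :: "'a \<Rightarrow> real"
  assumes [measurable]: "Z \<in> borel_measurable M"
  shows "char (distr M borel Z) u = (CLINT \<omega>|M. iexp (u * Z \<omega>))"
  by (simp add: char_def integral_distr)

lemma centered_gaussian_normal:
  assumes "distributed M lborel Z (\<lambda>x. ennreal (normal_density 0 \<sigma> x))" "0 < \<sigma>"
  shows "centered_gaussian M (\<sigma>\<^sup>2) Z"
proof -
  have Z[measurable]: "Z \<in> borel_measurable M" using distributed_measurable[OF assms(1)] by simp
  let ?W = "\<lambda>x. Z x / \<sigma>"
  have "distributed M lborel ?W (\<lambda>x. ennreal (std_normal_density x))"
    using assms normal_standard_normal_convert[of \<sigma> Z 0] by simp
  then have "distr M lborel ?W = std_normal_distribution" by (rule distributed_distr_eq_density)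
  then have W: "distr M borel ?W = std_normal_distribution"
    by (simp cong: distr_cong)
  have "char (distr M borel Z) u = complex_of_real (exp (- (\<sigma>\<^sup>2 * u\<^sup>2 / 2)))" for u
  proof -
    have "char (distr M borel Z) u = char (distr M borel ?W) (u * \<sigma>)"
      using assms(2) by (simp add: char_distr_eq)
    then show ?thesis unfolding W char_std_normal_distribution by (simp add: power_mult_distrib mult.commute)
  qed
  then show ?thesis by (auto simp: centered_gaussian_def)
qed

lemma real_distribution_distr_borel:
  "Z \<in> borel_measurable M \<Longrightarrow> real_distribution (distr M borel Z)"
  by (simp add: real_distribution_def real_distribution_axioms_def prob_space_distr)

lemma centered_gaussian_distributed:
  assumes "centered_gaussian M v Z" "0 < v"
  shows "distributed M lborel Z (\<lambda>x. ennreal (normal_density 0 (sqrt v) x))"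
proof -
  let ?N = "density lborel (\<lambda>x. ennreal (normal_density 0 (sqrt v) x))"
  interpret N: prob_space ?N using assms by (intro prob_space_normal_density) simp
  have Z[measurable]: "Z \<in> borel_measurable M" using assms by (simp add: centered_gaussian_def)
  \<comment> \<open>On the probability space \<open>?N\<close> the identity has law
    \<open>?N\<close>, so \<open>centered_gaussian_normal\<close> computes the characteristic
    function of the normal law itself; uniqueness then identifies the law of
    \<open>Z\<close>.\<close>
  have "distributed ?N lborel (\<lambda>x. x) (\<lambda>x. ennreal (normal_density 0 (sqrt v) x))"
    by (auto simp: distributed_def intro!: distr_id2)
  then have "centered_gaussian ?N ((sqrt v)\<^sup>2) (\<lambda>x. x)"
    using assms by (intro N.centered_gaussian_normal) auto
  moreover have "distr ?N borel (\<lambda>x. x) = ?N" by (rule distr_id2) simp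
  ultimately have "char (distr M borel Z) = char ?N"
    using assms by (auto simp: centered_gaussian_def fun_eq_iff)
  moreover have "real_distribution ?N"
    using N.real_distribution_distr_borel[of "\<lambda>x. x"] \<open>distr ?N borel (\<lambda>x. x) = ?N\<close> by simp
  ultimately have "distr M borel Z = ?N"
    by (intro Levy_uniqueness real_distribution_distr_borel Z)
  then have "distr M lborel Z = ?N" by (simp cong: distr_cong)
  then show ?thesis by (simp add: distributed_def)
qed

lemma centered_gaussian_AE_zero:
  assumes "centered_gaussian M 0 Z"
  shows "AE \<omega> in M. Z \<omega> = 0"
proof -
  have Z[measurable]: "Z \<in> borel_measurable M" using assms by (simp add: centered_gaussian_def)
  let ?R = "return borel (0::real)"
  have R: "real_distribution ?R"
    by (simp add: real_distribution_def real_distribution_axioms_def prob_space_return)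
  have "char (distr M borel Z) = char ?R"
    using assms by (simp add: centered_gaussian_def fun_eq_iff char_def integral_return)
  then have "distr M borel Z = ?R"
    by (intro Levy_uniqueness real_distribution_distr_borel Z R)
  then have "AE x in distr M borel Z. x = 0"
    by (simp only:) (simp add: AE_return)
  then show ?thesis by (subst (asm) AE_distr_iff) auto
qed

lemma centered_gaussian_nn_integral_power2:
  assumes "centered_gaussian M v Z"
  shows "(\<integral>\<^sup>+\<omega>. ennreal ((Z \<omega>)\<^sup>2) \<partial>M) = ennreal v"
proof (cases "v = 0")
  case True
  then have "AE \<omega> in M. Z \<omega> = 0" using assms centered_gaussian_AE_zero by simp
  then have "(\<integral>\<^sup>+\<omega>. ennreal ((Z \<omega>)\<^sup>2) \<partial>M) = (\<integral>\<^sup>+\<omega>. 0 \<partial>M)"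
    by (intro nn_integral_cong_AE) auto
  then show ?thesis using True by simp
next
  case False
  then have v: "0 < v" using assms by (simp add: centered_gaussian_def)
  have "(\<integral>\<^sup>+\<omega>. ennreal ((Z \<omega>)\<^sup>2) \<partial>M)
      = (\<integral>\<^sup>+x. ennreal (normal_density 0 (sqrt v) x) * ennreal (x\<^sup>2) \<partial>lborel)"
    by (subst distributed_nn_integral[OF centered_gaussian_distributed[OF assms v]]) auto
  also have "\<dots> = (\<integral>\<^sup>+x. ennreal (normal_density 0 (sqrt v) x * (x - 0)^(2 * 1)) \<partial>lborel)"
    by (intro nn_integral_cong) (simp add: ennreal_mult)
  also have "\<dots> = ennreal v"
  proof -
    have "has_bochner_integral lborel (\<lambda>x. normal_density 0 (sqrt v) x * (x - 0)^(2 * 1)) v"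
    proof -
      have eq: "fact (2 * 1) / ((2 / (sqrt v)\<^sup>2) ^ 1 * fact 1) = v" using v by (simp add: fact_2)
      show ?thesis using normal_moment_even[of "sqrt v" 0 1] v unfolding eq by simp
    qed
    then have "integrable lborel (\<lambda>x. normal_density 0 (sqrt v) x * (x - 0)^(2 * 1))"
      and I: "(LBINT x. normal_density 0 (sqrt v) x * (x - 0)^(2 * 1)) = v"
      unfolding has_bochner_integral_iff by blast+
    from nn_integral_eq_integral[OF this(1)] show ?thesis unfolding I by simp
  qed
  finally show ?thesis .
qed

text \<open>Markov's inequality for \<open>exp (Z\<^sup>2 / (4 * v))\<close>, whose mean is
  \<open>sqrt 2\<close>; this costs the factor 4 in place of 2 in the exponent. Asking only for
  \<open>v \<le> s\<^sup>2\<close> allows an upper bound of the variance to be used as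
  scale.\<close>

lemma centered_gaussian_tail:
  assumes Z: "centered_gaussian M v Z" and "v \<le> s\<^sup>2" "0 < s" "0 < x"
  shows "prob {\<omega> \<in> space M. x * s \<le> \<bar>Z \<omega>\<bar>} \<le> 2 * exp (- x\<^sup>2 / 4)"
proof -
  have [measurable]: "Z \<in> borel_measurable M" using Z by (simp add: centered_gaussian_def)
  show ?thesis
  proof (cases "v = 0")
    case True
    then have "AE \<omega> in M. Z \<omega> = 0" using Z centered_gaussian_AE_zero by simp
    moreover have "0 < x * s" using assms(3,4) by simp
    ultimately have "AE \<omega> in M. \<omega> \<notin> {\<omega> \<in> space M. x * s \<le> \<bar>Z \<omega>\<bar>}"
      by (auto elim!: eventually_mono)
    then have "prob {\<omega> \<in> space M. x * s \<le> \<bar>Z \<omega>\<bar>} = 0" by (subst prob_eq_0) auto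
    then show ?thesis by simp
  next
    case False
    then have v: "0 < v" using Z by (simp add: centered_gaussian_def)
    let ?A = "{y. x * s \<le> \<bar>y\<bar>}"
    \<comment> \<open>The exponential weight doubles the variance, so the weighted density is a
      multiple of another normal density and integrates to \<open>sqrt 2\<close>.\<close>
    have dens: "normal_density 0 (sqrt v) y * exp (y\<^sup>2 / (4 * v)) = sqrt 2 * normal_density 0 (sqrt (2 * v)) y" for y
    proof -
      have E: "exp (- (y\<^sup>2 / (2 * v))) * exp (y\<^sup>2 / (4 * v)) = exp (- (y\<^sup>2 / (4 * v)))"
        using v by (simp add: exp_add[symmetric] field_simps)
      have S: "sqrt 2 / sqrt (2 * pi * (2 * v)) = 1 / sqrt (2 * pi * v)"
        using v by (simp add: real_sqrt_mult field_simps)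
      have "normal_density 0 (sqrt v) y * exp (y\<^sup>2 / (4 * v))
          = 1 / sqrt (2 * pi * v) * (exp (- (y\<^sup>2 / (2 * v))) * exp (y\<^sup>2 / (4 * v)))"
        using v by (simp add: normal_density_def)
      also have "\<dots> = sqrt 2 / sqrt (2 * pi * (2 * v)) * exp (- (y\<^sup>2 / (4 * v)))"
        unfolding E S ..
      also have "\<dots> = sqrt 2 * normal_density 0 (sqrt (2 * v)) y"
        using v by (simp add: normal_density_def)
      finally show ?thesis .
    qed
    have ind: "indicator ?A y \<le> exp (- x\<^sup>2 / 4) * exp (y\<^sup>2 / (4 * v))" for y :: real
    proof (cases "y \<in> ?A")
      case True
      then have "(x * s)\<^sup>2 \<le> \<bar>y\<bar>\<^sup>2" using assms by (intro power_mono) auto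
      moreover have "x\<^sup>2 * v \<le> x\<^sup>2 * s\<^sup>2" using assms by (intro mult_left_mono) auto
      ultimately have "x\<^sup>2 * v \<le> y\<^sup>2" by (simp add: power_mult_distrib)
      then have "x\<^sup>2 / 4 \<le> y\<^sup>2 / (4 * v)" using v by (simp add: field_simps)
      then have "0 \<le> - x\<^sup>2 / 4 + y\<^sup>2 / (4 * v)" by simp
      then have "1 \<le> exp (- x\<^sup>2 / 4 + y\<^sup>2 / (4 * v))" by simp
      then show ?thesis using True unfolding exp_add by (metis indicator_eq_1_iff)
    qed auto
    have "emeasure M (Z -` ?A \<inter> space M) = (\<integral>\<^sup>+y. ennreal (normal_density 0 (sqrt v) y) * indicator ?A y \<partial>lborel)"
      by (rule distributed_emeasure[OF centered_gaussian_distributed[OF Z v]]) simp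
    also have "\<dots> = (\<integral>\<^sup>+y. ennreal (normal_density 0 (sqrt v) y * indicator ?A y) \<partial>lborel)"
      by (intro nn_integral_cong) (auto simp: indicator_def)
    also have "\<dots> \<le> (\<integral>\<^sup>+y. ennreal (exp (- x\<^sup>2 / 4) * sqrt 2 * normal_density 0 (sqrt (2 * v)) y) \<partial>lborel)"
    proof (intro nn_integral_mono ennreal_leI)
      fix y
      have "normal_density 0 (sqrt v) y * indicator ?A y
          \<le> normal_density 0 (sqrt v) y * (exp (- x\<^sup>2 / 4) * exp (y\<^sup>2 / (4 * v)))"
        by (intro mult_left_mono ind) simp
      also have "\<dots> = exp (- x\<^sup>2 / 4) * (normal_density 0 (sqrt v) y * exp (y\<^sup>2 / (4 * v)))" by simp
      also have "\<dots> = exp (- x\<^sup>2 / 4) * sqrt 2 * normal_density 0 (sqrt (2 * v)) y" by (simp add: dens)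
      finally show "normal_density 0 (sqrt v) y * indicator ?A y \<le> \<dots>" .
    qed
    also have "\<dots> = ennreal (exp (- x\<^sup>2 / 4) * sqrt 2)"
      using v by (subst nn_integral_eq_integral) auto
    also have "\<dots> \<le> ennreal (2 * exp (- x\<^sup>2 / 4))"
      using real_sqrt_le_mono[of 2 4] by (intro ennreal_leI) simp
    finally have "emeasure M (Z -` ?A \<inter> space M) \<le> ennreal (2 * exp (- x\<^sup>2 / 4))" .
    moreover have "Z -` ?A \<inter> space M = {\<omega> \<in> space M. x * s \<le> \<bar>Z \<omega>\<bar>}" by auto
    ultimately show ?thesis by (simp add: emeasure_eq_measure)
  qed
qed

text \<open>The density is at most \<open>1 / (2 * sqrt v)\<close>, because
  \<open>sqrt (2 * pi)\<close> is at least 2, and the interval has length \<open>2 * e\<close>. This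
  anti-concentration is the whole probabilistic content of roughness.\<close>

lemma centered_gaussian_small_ball:
  assumes Z: "centered_gaussian M v Z" and "0 < v" "0 \<le> e"
  shows "prob {\<omega> \<in> space M. \<bar>Z \<omega>\<bar> \<le> e} \<le> e / sqrt v"
proof -
  have [measurable]: "Z \<in> borel_measurable M" using Z by (simp add: centered_gaussian_def)
  have "2 \<le> sqrt (2 * pi)" using pi_ge_two by (intro real_le_rsqrt) simp
  have le: "normal_density 0 (sqrt v) y \<le> 1 / (2 * sqrt v)" for y
  proof -
    have "2 * sqrt v \<le> sqrt (2 * pi) * sqrt v" using \<open>2 \<le> sqrt (2 * pi)\<close> assms by (intro mult_right_mono) auto
    then have "1 / sqrt (2 * pi * (sqrt v)\<^sup>2) \<le> 1 / (2 * sqrt v)"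
      using assms by (intro divide_left_mono) (auto simp: real_sqrt_mult)
    moreover have "exp (- (y - 0)\<^sup>2 / (2 * (sqrt v)\<^sup>2)) \<le> 1" using assms by simp
    ultimately have "normal_density 0 (sqrt v) y \<le> 1 / (2 * sqrt v) * 1"
      unfolding normal_density_def using assms by (intro mult_mono) simp_all
    then show ?thesis by simp
  qed
  have "emeasure M (Z -` {-e..e} \<inter> space M) = (\<integral>\<^sup>+y. ennreal (normal_density 0 (sqrt v) y) * indicator {-e..e} y \<partial>lborel)"
    by (rule distributed_emeasure[OF centered_gaussian_distributed[OF Z assms(2)]]) simp
  also have "\<dots> \<le> (\<integral>\<^sup>+y. ennreal (1 / (2 * sqrt v)) * indicator {-e..e} y \<partial>lborel)"
    by (intro nn_integral_mono mult_right_mono ennreal_leI le) auto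
  also have "\<dots> = ennreal (1 / (2 * sqrt v)) * ennreal (2 * e)"
    using assms by (subst nn_integral_cmult_indicator) auto
  also have "\<dots> = ennreal (e / sqrt v)" using assms by (simp add: ennreal_mult[symmetric])
  finally have "emeasure M (Z -` {-e..e} \<inter> space M) \<le> ennreal (e / sqrt v)" .
  moreover have "Z -` {-e..e} \<inter> space M = {\<omega> \<in> space M. \<bar>Z \<omega>\<bar> \<le> e}" by auto
  ultimately show ?thesis using assms by (simp add: emeasure_eq_measure)
qed

text \<open>Mean-square convergence makes the characteristic functions converge pointwise, since
  \<open>iexp\<close> is 1-Lipschitz; the limit is then read off from the limit of the
  variances.\<close>

lemma centered_gaussian_L2_limit:
  assumes cg: "\<And>k. centered_gaussian M (v k) (Z k)" and v: "v \<longlonglongrightarrow> w"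
    and [measurable]: "X \<in> borel_measurable M"
    and lim: "(\<lambda>k. \<integral>\<^sup>+\<omega>. ennreal ((X \<omega> - Z k \<omega>)\<^sup>2) \<partial>M) \<longlonglongrightarrow> 0"
  shows "centered_gaussian M w X"
proof -
  have [measurable]: "Z k \<in> borel_measurable M" for k using cg by (simp add: centered_gaussian_def)
  have "0 \<le> w" using cg by (intro LIMSEQ_le_const[OF v]) (auto simp: centered_gaussian_def)
  moreover have "char (distr M borel X) u = complex_of_real (exp (- (w * u\<^sup>2 / 2)))" for u
  proof -
    let ?D = "\<lambda>k \<omega>. norm (iexp (u * X \<omega>) - iexp (u * Z k \<omega>))"
    let ?n = "\<lambda>k. norm (char (distr M borel X) u - char (distr M borel (Z k)) u)"
    have iX: "integrable M (\<lambda>\<omega>. iexp (u * X \<omega>))" and iZ: "integrable M (\<lambda>\<omega>. iexp (u * Z k \<omega>))" for k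
      by (auto intro!: integrable_iexp)
    have bd: "ennreal ((?n k)\<^sup>2) \<le> ennreal (u\<^sup>2) * (\<integral>\<^sup>+\<omega>. ennreal ((X \<omega> - Z k \<omega>)\<^sup>2) \<partial>M)" for k
    proof -
      have "ennreal (?n k) = ennreal (norm (\<integral>\<omega>. iexp (u * X \<omega>) - iexp (u * Z k \<omega>) \<partial>M))"
        using iX iZ by (simp add: char_distr_eq)
      also have "\<dots> \<le> (\<integral>\<^sup>+\<omega>. ennreal (?D k \<omega>) \<partial>M)"
        by (intro integral_norm_bound_ennreal Bochner_Integration.integrable_diff iX iZ)
      finally have "(ennreal (?n k))\<^sup>2 \<le> (\<integral>\<^sup>+\<omega>. ennreal (?D k \<omega>) * 1 \<partial>M)\<^sup>2"
        by (simp add: power_mono)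
      \<comment> \<open>Cauchy-Schwarz against the constant 1 bounds a mean by a root mean square,
        as the total mass is 1.\<close>
      also have "\<dots> \<le> (\<integral>\<^sup>+\<omega>. (ennreal (?D k \<omega>))\<^sup>2 \<partial>M) * (\<integral>\<^sup>+\<omega>. 1\<^sup>2 \<partial>M)"
        by (rule Cauchy_Schwarz_nn_integral) auto
      also have "\<dots> = (\<integral>\<^sup>+\<omega>. ennreal ((?D k \<omega>)\<^sup>2) \<partial>M)"
        by (simp add: emeasure_space_1 ennreal_power)
      also have "\<dots> \<le> (\<integral>\<^sup>+\<omega>. ennreal (u\<^sup>2) * ennreal ((X \<omega> - Z k \<omega>)\<^sup>2) \<partial>M)"
      proof (intro nn_integral_mono)
        fix \<omega>
        have "(?D k \<omega>)\<^sup>2 \<le> \<bar>u * X \<omega> - u * Z k \<omega>\<bar>\<^sup>2" by (intro power_mono norm_iexp_diff_le) auto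
        also have "\<dots> = u\<^sup>2 * (X \<omega> - Z k \<omega>)\<^sup>2" by (simp add: power_mult_distrib right_diff_distrib[symmetric])
        finally show "ennreal ((?D k \<omega>)\<^sup>2) \<le> ennreal (u\<^sup>2) * ennreal ((X \<omega> - Z k \<omega>)\<^sup>2)"
          by (simp add: ennreal_mult[symmetric] ennreal_leI)
      qed
      also have "\<dots> = ennreal (u\<^sup>2) * (\<integral>\<^sup>+\<omega>. ennreal ((X \<omega> - Z k \<omega>)\<^sup>2) \<partial>M)" by (rule nn_integral_cmult) simp
      finally show ?thesis by (simp add: ennreal_power)
    qed
    have lim': "(\<lambda>k. ennreal (u\<^sup>2) * (\<integral>\<^sup>+\<omega>. ennreal ((X \<omega> - Z k \<omega>)\<^sup>2) \<partial>M)) \<longlonglongrightarrow> 0"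
      using ennreal_tendsto_cmult[OF _ lim, of "ennreal (u\<^sup>2)"] by simp
    have "(\<lambda>k. ennreal ((?n k)\<^sup>2)) \<longlonglongrightarrow> 0"
      by (rule tendsto_sandwich[OF always_eventually always_eventually tendsto_const lim'])
        (intro allI zero_le bd)+
    then have "(\<lambda>k. (?n k)\<^sup>2) \<longlonglongrightarrow> 0"
      by (subst (asm) ennreal_0[symmetric], subst (asm) tendsto_ennreal_iff) auto
    then have "(\<lambda>k. sqrt ((?n k)\<^sup>2)) \<longlonglongrightarrow> sqrt 0" by (intro tendsto_real_sqrt)
    then have "(\<lambda>k. char (distr M borel X) u - char (distr M borel (Z k)) u) \<longlonglongrightarrow> 0"
      by (simp add: tendsto_norm_zero_iff)
    then have "(\<lambda>k. char (distr M borel X) u - (char (distr M borel X) u - char (distr M borel (Z k)) u))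
        \<longlonglongrightarrow> char (distr M borel X) u - 0"
      by (intro tendsto_diff tendsto_const)
    then have "(\<lambda>k. char (distr M borel (Z k)) u) \<longlonglongrightarrow> char (distr M borel X) u" by simp
    moreover have "(\<lambda>k. char (distr M borel (Z k)) u) \<longlonglongrightarrow> complex_of_real (exp (- (w * u\<^sup>2 / 2)))"
    proof -
      have "(\<lambda>k. complex_of_real (exp (- (v k * u\<^sup>2 / 2)))) \<longlonglongrightarrow> complex_of_real (exp (- (w * u\<^sup>2 / 2)))"
        by (intro tendsto_intros v) simp
      then show ?thesis using cg by (simp add: centered_gaussian_def)
    qed
    ultimately show ?thesis by (rule LIMSEQ_unique)
  qed
  ultimately show ?thesis by (simp add: centered_gaussian_def)
qed

lemma centered_gaussian_imp_gaussian_rv: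
  assumes "centered_gaussian M v Z"
  shows "gaussian_rv M Z"
proof (cases "v = 0")
  case True
  then show ?thesis
    using assms centered_gaussian_AE_zero unfolding gaussian_rv_def
    by (intro conjI exI[of _ 0] disjI1) (auto simp: centered_gaussian_def)
next
  case False
  then have "0 < v" using assms by (simp add: centered_gaussian_def)
  then show ?thesis
    using assms centered_gaussian_distributed[OF assms] unfolding gaussian_rv_def
    by (intro conjI exI[of _ 0] disjI2 exI[of _ "sqrt v"]) (auto simp: centered_gaussian_def)
qed

end

section \<open>Wiener integrals\<close>

lemma (in prob_space) centered_gaussian_cmult:
  assumes "centered_gaussian M v Z"
  shows "centered_gaussian M (c\<^sup>2 * v) (\<lambda>\<omega>. c * Z \<omega>)"
proof -
  have [measurable]: "Z \<in> borel_measurable M" using assms by (simp add: centered_gaussian_def)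
  have "char (distr M borel (\<lambda>\<omega>. c * Z \<omega>)) u = char (distr M borel Z) (u * c)" for u
    by (simp add: char_distr_eq mult.assoc)
  then show ?thesis
    using assms by (simp add: centered_gaussian_def power_mult_distrib mult_ac)
qed

lemma (in prob_space) centered_gaussian_indep_sum:
  assumes "indep_vars (\<lambda>_. borel) Z J" "finite J" "\<And>j. j \<in> J \<Longrightarrow> centered_gaussian M (v j) (Z j)"
  shows "centered_gaussian M (\<Sum>j\<in>J. v j) (\<lambda>\<omega>. \<Sum>j\<in>J. Z j \<omega>)"
proof -
  have "char (distr M borel (\<lambda>\<omega>. \<Sum>j\<in>J. Z j \<omega>)) u
      = complex_of_real (exp (- ((\<Sum>j\<in>J. v j) * u\<^sup>2 / 2)))" for u
  proof -
    have "char (distr M borel (\<lambda>\<omega>. \<Sum>j\<in>J. Z j \<omega>)) u = (\<Prod>j\<in>J. complex_of_real (exp (- (v j * u\<^sup>2 / 2))))"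
      using assms by (simp add: char_distr_sum centered_gaussian_def)
    also have "\<dots> = complex_of_real (exp (\<Sum>j\<in>J. - (v j * u\<^sup>2 / 2)))"
      using assms(2) by (simp add: exp_sum)
    also have "(\<Sum>j\<in>J. - (v j * u\<^sup>2 / 2)) = - ((\<Sum>j\<in>J. v j) * u\<^sup>2 / 2)"
      by (simp add: sum_negf sum_distrib_right sum_divide_distrib)
    finally show ?thesis .
  qed
  then show ?thesis
    using assms by (auto simp: centered_gaussian_def intro!: sum_nonneg borel_measurable_sum)
qed

text \<open>
  The integrals live on all of the real line, with the interval \<open>[0, t]\<close> absorbed into \<open>f\<close>, so that
  Wiener integrals over different intervals can be combined linearly.
\<close>
definition wiener_limit ::
    "'a measure \<Rightarrow> (real \<Rightarrow> 'a \<Rightarrow> real) \<Rightarrow> real \<Rightarrow> (real \<Rightarrow> real) \<Rightarrow> ('a \<Rightarrow> real) \<Rightarrow> bool" where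
  "wiener_limit M B T f Z \<longleftrightarrow>
     f \<in> borel_measurable borel \<and> integrable lborel (\<lambda>s. (f s)\<^sup>2) \<and> Z \<in> borel_measurable M \<and>
     (\<exists>N p c. (\<forall>k::nat. time_grid T (N k) (p k)) \<and>
        (\<lambda>k. \<integral>\<^sup>+s. ennreal ((f s - step_fun (N k) (p k) (c k) s)\<^sup>2) \<partial>lborel) \<longlonglongrightarrow> 0 \<and>
        (\<lambda>k. \<integral>\<^sup>+\<omega>. ennreal ((Z \<omega> - step_integral B (N k) (p k) (c k) \<omega>)\<^sup>2) \<partial>M) \<longlonglongrightarrow> 0)"

lemma has_wiener_integral_imp_wiener_limit:
  assumes "has_wiener_integral M B t f X" "t \<le> T"
  shows "wiener_limit M B T (\<lambda>s. indicator {0..t} s * f s) X"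
proof -
  obtain N p c where *: "\<And>k::nat. time_grid t (N k) (p k)"
    "(\<lambda>k. \<integral>\<^sup>+s\<in>{0..t}. ennreal ((f s - step_fun (N k) (p k) (c k) s)\<^sup>2) \<partial>lborel) \<longlonglongrightarrow> 0"
    "(\<lambda>k. \<integral>\<^sup>+\<omega>. ennreal ((X \<omega> - step_integral B (N k) (p k) (c k) \<omega>)\<^sup>2) \<partial>M) \<longlonglongrightarrow> 0"
    using assms(1) unfolding has_wiener_integral_def by blast
  have sq: "set_borel_measurable lborel {0..t} f" "set_integrable lborel {0..t} (\<lambda>s. (f s)\<^sup>2)"
    "X \<in> borel_measurable M"
    using assms(1) by (auto simp: has_wiener_integral_def square_integrable_upto_def)
  \<comment> \<open>Step functions on grids in \<open>[0, t]\<close> vanish outside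
    \<open>[0, t]\<close>, so extending \<open>f\<close> by zero does not change the error.\<close>
  have "(\<integral>\<^sup>+s\<in>{0..t}. ennreal ((f s - step_fun (N k) (p k) (c k) s)\<^sup>2) \<partial>lborel)
      = (\<integral>\<^sup>+s. ennreal ((indicator {0..t} s * f s - step_fun (N k) (p k) (c k) s)\<^sup>2) \<partial>lborel)" for k
    using step_fun_outside[OF *(1)] by (intro nn_integral_cong) (auto simp: indicator_def)
  then have "(\<lambda>k. \<integral>\<^sup>+s. ennreal ((indicator {0..t} s * f s - step_fun (N k) (p k) (c k) s)\<^sup>2) \<partial>lborel) \<longlonglongrightarrow> 0"
    using *(2) by simp
  moreover have "(\<lambda>s. (indicator {0..t} s * f s)\<^sup>2) = (\<lambda>s. indicator {0..t} s * (f s)\<^sup>2)"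
    by (auto simp: indicator_def)
  moreover have "\<forall>k. time_grid T (N k) (p k)"
    using time_grid_mono_horizon[OF *(1) assms(2)] by blast
  ultimately show ?thesis
    unfolding wiener_limit_def using sq *(3)
    by (simp add: set_borel_measurable_def set_integrable_def) blast
qed

section \<open>Linear combinations and completeness in mean square\<close>

lemma nn_integral_power2_lincomb_tendsto:
  fixes h :: "'j \<Rightarrow> nat \<Rightarrow> 'b \<Rightarrow> real"
  assumes "finite J" and [measurable]: "\<And>j k. j \<in> J \<Longrightarrow> h j k \<in> borel_measurable N"
    and lim: "\<And>j. j \<in> J \<Longrightarrow> (\<lambda>k. \<integral>\<^sup>+x. ennreal ((h j k x)\<^sup>2) \<partial>N) \<longlonglongrightarrow> 0"
  shows "(\<lambda>k. \<integral>\<^sup>+x. ennreal ((\<Sum>j\<in>J. a j * h j k x)\<^sup>2) \<partial>N) \<longlonglongrightarrow> 0"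
proof -
  have bd: "(\<integral>\<^sup>+x. ennreal ((\<Sum>j\<in>J. a j * h j k x)\<^sup>2) \<partial>N)
      \<le> (\<Sum>j\<in>J. ennreal (real (card J) * (a j)\<^sup>2) * (\<integral>\<^sup>+x. ennreal ((h j k x)\<^sup>2) \<partial>N))" for k
  proof -
    have "(\<integral>\<^sup>+x. ennreal ((\<Sum>j\<in>J. a j * h j k x)\<^sup>2) \<partial>N)
        \<le> (\<integral>\<^sup>+x. (\<Sum>j\<in>J. ennreal (real (card J) * (a j)\<^sup>2) * ennreal ((h j k x)\<^sup>2)) \<partial>N)"
    proof (intro nn_integral_mono)
      fix x
      \<comment> \<open>Cauchy-Schwarz for finite sums, whence the factor \<open>card J\<close>; it
        does not depend on \<open>k\<close>.\<close>
      have "(\<Sum>j\<in>J. a j * h j k x)\<^sup>2 \<le> (\<Sum>j\<in>J. (a j * h j k x)\<^sup>2) * real (card J)"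
        using sum_squared_le_sum_of_squares[of "\<lambda>j. a j * h j k x" J] by simp
      also have "\<dots> = (\<Sum>j\<in>J. real (card J) * (a j)\<^sup>2 * (h j k x)\<^sup>2)"
        by (simp add: sum_distrib_left power_mult_distrib mult_ac)
      finally have "ennreal ((\<Sum>j\<in>J. a j * h j k x)\<^sup>2) \<le> ennreal (\<Sum>j\<in>J. real (card J) * (a j)\<^sup>2 * (h j k x)\<^sup>2)"
        by (rule ennreal_leI)
      then show "ennreal ((\<Sum>j\<in>J. a j * h j k x)\<^sup>2)
          \<le> (\<Sum>j\<in>J. ennreal (real (card J) * (a j)\<^sup>2) * ennreal ((h j k x)\<^sup>2))"
        by (simp add: ennreal_mult[symmetric] sum_ennreal)
    qed
    also have "\<dots> = (\<Sum>j\<in>J. ennreal (real (card J) * (a j)\<^sup>2) * (\<integral>\<^sup>+x. ennreal ((h j k x)\<^sup>2) \<partial>N))"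
      by (subst nn_integral_sum) (auto intro!: sum.cong nn_integral_cmult)
    finally show ?thesis .
  qed
  have "(\<lambda>k. ennreal (real (card J) * (a j)\<^sup>2) * (\<integral>\<^sup>+x. ennreal ((h j k x)\<^sup>2) \<partial>N)) \<longlonglongrightarrow> 0"
    if "j \<in> J" for j
    using ennreal_tendsto_cmult[OF _ lim[OF that], of "ennreal (real (card J) * (a j)\<^sup>2)"] by simp
  then have "(\<lambda>k. \<Sum>j\<in>J. ennreal (real (card J) * (a j)\<^sup>2) * (\<integral>\<^sup>+x. ennreal ((h j k x)\<^sup>2) \<partial>N))
      \<longlonglongrightarrow> (\<Sum>j\<in>J. 0)"
    by (intro tendsto_sum) auto
  then have lim': "(\<lambda>k. \<Sum>j\<in>J. ennreal (real (card J) * (a j)\<^sup>2) * (\<integral>\<^sup>+x. ennreal ((h j k x)\<^sup>2) \<partial>N))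
      \<longlonglongrightarrow> 0" by simp
  show ?thesis
    by (rule tendsto_sandwich[OF always_eventually always_eventually tendsto_const lim'])
      (intro allI zero_le bd)+
qed

lemma integrable_power2_sum:
  fixes f :: "'j \<Rightarrow> 'b \<Rightarrow> real"
  assumes "finite J" "\<And>j. j \<in> J \<Longrightarrow> f j \<in> borel_measurable N"
    "\<And>j. j \<in> J \<Longrightarrow> integrable N (\<lambda>x. (f j x)\<^sup>2)"
  shows "integrable N (\<lambda>x. (\<Sum>j\<in>J. a j * f j x)\<^sup>2)"
proof (rule Bochner_Integration.integrable_bound)
  show "integrable N (\<lambda>x. (\<Sum>j\<in>J. (a j)\<^sup>2 * (f j x)\<^sup>2) * real (card J))"
    using assms by auto
  show "(\<lambda>x. (\<Sum>j\<in>J. a j * f j x)\<^sup>2) \<in> borel_measurable N"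
    using assms by measurable
  show "AE x in N. norm ((\<Sum>j\<in>J. a j * f j x)\<^sup>2) \<le> norm ((\<Sum>j\<in>J. (a j)\<^sup>2 * (f j x)\<^sup>2) * real (card J))"
  proof (intro AE_I2)
    fix x
    have "(\<Sum>j\<in>J. a j * f j x)\<^sup>2 \<le> (\<Sum>j\<in>J. (a j)\<^sup>2 * (f j x)\<^sup>2) * real (card J)"
      using sum_squared_le_sum_of_squares[of "\<lambda>j. a j * f j x" J] by (simp add: power_mult_distrib)
    then show "norm ((\<Sum>j\<in>J. a j * f j x)\<^sup>2) \<le> norm ((\<Sum>j\<in>J. (a j)\<^sup>2 * (f j x)\<^sup>2) * real (card J))"
      by simp
  qed
qed

text \<open>The prescribed rate makes successive differences summable in mean, so the sequence
  itself converges almost surely and no subsequence has to be extracted. Fatou's lemma then turns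
  the almost sure limit into a mean-square one.\<close>

lemma (in prob_space) L2_complete:
  fixes S :: "nat \<Rightarrow> 'a \<Rightarrow> real"
  assumes S[measurable]: "\<And>k. S k \<in> borel_measurable M"
    and cauchy: "\<And>k l. k \<le> l \<Longrightarrow> (\<integral>\<^sup>+\<omega>. ennreal ((S l \<omega> - S k \<omega>)\<^sup>2) \<partial>M) \<le> ennreal (4 / 4 ^ k)"
  shows "\<exists>X\<in>borel_measurable M. (\<lambda>k. \<integral>\<^sup>+\<omega>. ennreal ((X \<omega> - S k \<omega>)\<^sup>2) \<partial>M) \<longlonglongrightarrow> 0"
proof -
  have step: "(\<integral>\<^sup>+\<omega>. ennreal \<bar>S (Suc k) \<omega> - S k \<omega>\<bar> \<partial>M) \<le> ennreal (5 * (1 / 2) ^ k)" for k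
  proof -
    define c :: real where "c = (1 / 2) ^ k"
    have c: "0 < c" by (simp add: c_def)
    have "4 / 4 ^ k = 4 * (1 / 4 :: real) ^ k" by (simp add: power_divide)
    also have "(1 / 4 :: real) ^ k = c\<^sup>2" unfolding c_def by (subst power_even_eq[symmetric]) (simp add: power_mult power2_eq_square)
    finally have c2: "4 / 4 ^ k = 4 * c\<^sup>2" .
    \<comment> \<open>Passes from second to first moments. With \<open>c = (1 / 2) ^ k\<close> and
      second moment at most \<open>4 * c\<^sup>2\<close> the bound becomes
      \<open>c + 4 * c = 5 * c\<close>.\<close>
    have le: "\<bar>y\<bar> \<le> c + y\<^sup>2 / c" for y :: real
    proof (cases "\<bar>y\<bar> \<le> c")
      case True
      moreover have "0 \<le> y\<^sup>2 / c" using c by simp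
      ultimately show ?thesis by linarith
    next
      case False
      then have "\<bar>y\<bar> * c \<le> \<bar>y\<bar> * \<bar>y\<bar>" by (intro mult_left_mono) auto
      then have "\<bar>y\<bar> \<le> y\<^sup>2 / c" using c by (simp add: field_simps power2_eq_square)
      then show ?thesis using c by linarith
    qed
    have "(\<integral>\<^sup>+\<omega>. ennreal \<bar>S (Suc k) \<omega> - S k \<omega>\<bar> \<partial>M)
        \<le> (\<integral>\<^sup>+\<omega>. ennreal c + ennreal (1 / c) * ennreal ((S (Suc k) \<omega> - S k \<omega>)\<^sup>2) \<partial>M)"
    proof (intro nn_integral_mono)
      fix \<omega>
      show "ennreal \<bar>S (Suc k) \<omega> - S k \<omega>\<bar> \<le> ennreal c + ennreal (1 / c) * ennreal ((S (Suc k) \<omega> - S k \<omega>)\<^sup>2)"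
        using c ennreal_leI[OF le[of "S (Suc k) \<omega> - S k \<omega>"]]
        by (simp add: ennreal_mult[symmetric])
    qed
    also have "\<dots> = ennreal c + ennreal (1 / c) * (\<integral>\<^sup>+\<omega>. ennreal ((S (Suc k) \<omega> - S k \<omega>)\<^sup>2) \<partial>M)"
      by (subst nn_integral_add) (auto simp: nn_integral_cmult emeasure_space_1)
    also have "\<dots> \<le> ennreal c + ennreal (1 / c) * ennreal (4 * c\<^sup>2)"
      using cauchy[of k "Suc k"] unfolding c2 by (intro add_mono mult_left_mono) auto
    also have "\<dots> = ennreal (c + 1 / c * (4 * c\<^sup>2))" using c by (simp add: ennreal_mult[symmetric])
    also have "c + 1 / c * (4 * c\<^sup>2) = 5 * c" using c by (simp add: power2_eq_square)
    finally show ?thesis unfolding c_def .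
  qed
  have sum2: "summable (\<lambda>k. 5 * (1 / 2 :: real) ^ k)" by (intro summable_mult summable_geometric) simp
  have "(\<integral>\<^sup>+\<omega>. (\<Sum>k. ennreal \<bar>S (Suc k) \<omega> - S k \<omega>\<bar>) \<partial>M) = (\<Sum>k. \<integral>\<^sup>+\<omega>. ennreal \<bar>S (Suc k) \<omega> - S k \<omega>\<bar> \<partial>M)"
    by (rule nn_integral_suminf) simp
  also have "\<dots> \<le> (\<Sum>k. ennreal (5 * (1 / 2) ^ k))" by (intro suminf_le step) auto
  also have "\<dots> = ennreal (\<Sum>k. 5 * (1 / 2) ^ k)" by (rule suminf_ennreal2[OF _ sum2]) simp
  also have "\<dots> < \<infinity>" by simp
  finally have "(\<integral>\<^sup>+\<omega>. (\<Sum>k. ennreal \<bar>S (Suc k) \<omega> - S k \<omega>\<bar>) \<partial>M) \<noteq> \<infinity>" by simp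
  then have "AE \<omega> in M. (\<Sum>k. ennreal \<bar>S (Suc k) \<omega> - S k \<omega>\<bar>) \<noteq> \<infinity>"
    by (intro nn_integral_noteq_infinite) auto
  then have conv: "AE \<omega> in M. (\<lambda>k. S k \<omega>) \<longlonglongrightarrow> lim (\<lambda>k. S k \<omega>)"
  proof (rule eventually_mono)
    fix \<omega> assume "(\<Sum>k. ennreal \<bar>S (Suc k) \<omega> - S k \<omega>\<bar>) \<noteq> \<infinity>"
    then have "summable (\<lambda>k. \<bar>S (Suc k) \<omega> - S k \<omega>\<bar>)" by (intro summable_suminf_not_top) auto
    then have "summable (\<lambda>k. S (Suc k) \<omega> - S k \<omega>)" by (rule summable_rabs_cancel)
    then have "convergent (\<lambda>n. (\<Sum>k<n. S (Suc k) \<omega> - S k \<omega>))" by (simp add: summable_iff_convergent)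
    then have "convergent (\<lambda>n. S n \<omega> - S 0 \<omega>)" unfolding sum_lessThan_telescope[of "\<lambda>k. S k \<omega>"] .
    then have "convergent (\<lambda>n. S n \<omega>)" by (simp add: convergent_diff_const_right_iff)
    then show "(\<lambda>k. S k \<omega>) \<longlonglongrightarrow> lim (\<lambda>k. S k \<omega>)" by (simp add: convergent_LIMSEQ_iff)
  qed
  \<comment> \<open>Where the sequence diverges, \<open>lim\<close> is an arbitrary value;
    \<open>X\<close> is measurable all the same and divergence is confined to a null set.\<close>
  define X where "X \<omega> = lim (\<lambda>k. S k \<omega>)" for \<omega>
  have X[measurable]: "X \<in> borel_measurable M"
    unfolding X_def[abs_def] by (rule borel_measurable_lim_metric) simp
  have bd: "(\<integral>\<^sup>+\<omega>. ennreal ((X \<omega> - S k \<omega>)\<^sup>2) \<partial>M) \<le> ennreal (4 / 4 ^ k)" for k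
  proof -
    have "(\<integral>\<^sup>+\<omega>. ennreal ((X \<omega> - S k \<omega>)\<^sup>2) \<partial>M)
        = (\<integral>\<^sup>+\<omega>. liminf (\<lambda>l. ennreal ((S l \<omega> - S k \<omega>)\<^sup>2)) \<partial>M)"
    proof (rule nn_integral_cong_AE, rule eventually_mono[OF conv])
      fix \<omega> assume "(\<lambda>k. S k \<omega>) \<longlonglongrightarrow> lim (\<lambda>k. S k \<omega>)"
      then have "(\<lambda>l. ennreal ((S l \<omega> - S k \<omega>)\<^sup>2)) \<longlonglongrightarrow> ennreal ((X \<omega> - S k \<omega>)\<^sup>2)"
        unfolding X_def by (intro tendsto_intros)
      then show "ennreal ((X \<omega> - S k \<omega>)\<^sup>2) = liminf (\<lambda>l. ennreal ((S l \<omega> - S k \<omega>)\<^sup>2))"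
        by (rule lim_imp_Liminf[OF sequentially_bot, symmetric])
    qed
    also have "\<dots> \<le> liminf (\<lambda>l. \<integral>\<^sup>+\<omega>. ennreal ((S l \<omega> - S k \<omega>)\<^sup>2) \<partial>M)"
      by (rule nn_integral_liminf) simp
    also have "\<dots> \<le> liminf (\<lambda>l::nat. ennreal (4 / 4 ^ k))"
      by (intro Liminf_mono eventually_mono[OF eventually_ge_at_top[of k]] cauchy)
    also have "\<dots> = ennreal (4 / 4 ^ k)" by (simp add: Liminf_const)
    finally show ?thesis .
  qed
  have "(\<lambda>k. 4 * (1 / 4 :: real) ^ k) \<longlonglongrightarrow> 4 * 0" by (intro tendsto_mult tendsto_const LIMSEQ_power_zero) simp
  then have "(\<lambda>k. 4 / 4 ^ k :: real) \<longlonglongrightarrow> 0" by (simp add: power_divide)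
  then have lim': "(\<lambda>k. ennreal (4 / 4 ^ k)) \<longlonglongrightarrow> 0"
    using tendsto_ennrealI by fastforce
  have "(\<lambda>k. \<integral>\<^sup>+\<omega>. ennreal ((X \<omega> - S k \<omega>)\<^sup>2) \<partial>M) \<longlonglongrightarrow> 0"
    by (rule tendsto_sandwich[OF always_eventually always_eventually tendsto_const lim'])
      (intro allI zero_le bd)+
  then show ?thesis using X by blast
qed

section \<open>The Wiener isometry and existence of the integral\<close>

locale brownian_motion =
  fixes M :: "'a measure" and T :: real and B :: "real \<Rightarrow> 'a \<Rightarrow> real"
  assumes horizon: "0 < T" and standard: "standard_brownian_motion M T B"

sublocale brownian_motion \<subseteq> prob_space M
  using standard by (simp add: standard_brownian_motion_def)

context brownian_motion
begin

text \<open>The isometry on step functions: variances of independent increments add up, and the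
  increment over a cell has the cell's length as its variance.\<close>

lemma centered_gaussian_step_integral:
  assumes g: "time_grid T n p"
  shows "centered_gaussian M (\<integral>s. (step_fun n p c s)\<^sup>2 \<partial>lborel) (step_integral B n p c)"
proof -
  let ?X = "\<lambda>i \<omega>. B (p (Suc i)) \<omega> - B (p i) \<omega>"
  have "indep_vars (\<lambda>_. borel) ?X {..<n}"
    using g standard by (simp add: standard_brownian_motion_def)
  then have "indep_vars (\<lambda>_. borel) (\<lambda>i \<omega>. c i * ?X i \<omega>) {..<n}"
    by (rule indep_vars_compose2) simp
  moreover have "centered_gaussian M ((c i)\<^sup>2 * (p (Suc i) - p i)) (\<lambda>\<omega>. c i * ?X i \<omega>)" if "i < n" for i
  proof (rule centered_gaussian_cmult)
    have "p i < p (Suc i)" using g that by (auto simp: time_grid_def)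
    moreover have "0 \<le> p i" "p (Suc i) \<le> T"
      using time_grid_bounds[OF g, of i] time_grid_bounds[OF g, of "Suc i"] that by auto
    ultimately have "distributed M lborel (?X i) (\<lambda>x. ennreal (normal_density 0 (sqrt (p (Suc i) - p i)) x))"
      using standard by (simp add: standard_brownian_motion_def)
    then show "centered_gaussian M (p (Suc i) - p i) (?X i)"
      using centered_gaussian_normal[of "?X i" "sqrt (p (Suc i) - p i)"] \<open>p i < p (Suc i)\<close> by simp
  qed
  ultimately have "centered_gaussian M (\<Sum>i<n. (c i)\<^sup>2 * (p (Suc i) - p i)) (\<lambda>\<omega>. \<Sum>i<n. c i * ?X i \<omega>)"
    by (intro centered_gaussian_indep_sum) auto
  moreover have "(\<integral>s. (step_fun n p c s)\<^sup>2 \<partial>lborel) = (\<Sum>i<n. (c i)\<^sup>2 * (p (Suc i) - p i))"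
    by (rule has_bochner_integral_integral_eq[OF has_bochner_integral_step_fun_square[OF g]])
  ultimately show ?thesis by (simp add: step_integral_def[abs_def])
qed

lemma integrable_step_fun_power2: "time_grid t n p \<Longrightarrow> integrable lborel (\<lambda>s. (step_fun n p c s)\<^sup>2)"
  using has_bochner_integral_step_fun_square has_bochner_integral_iff by blast

lemma borel_measurable_step_integral:
  "time_grid T n p \<Longrightarrow> step_integral B n p c \<in> borel_measurable M"
  using centered_gaussian_step_integral centered_gaussian_def by blast

lemma wiener_limit_step:
  "time_grid T n p \<Longrightarrow> wiener_limit M B T (step_fun n p c) (step_integral B n p c)"
  unfolding wiener_limit_def
  by (intro conjI borel_measurable_step_integral integrable_step_fun_power2 borel_measurable_step_fun,
      assumption+, rule exI[of _ "\<lambda>_. n"], rule exI[of _ "\<lambda>_. p"], rule exI[of _ "\<lambda>_. c"], simp)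

lemma wiener_limit_centered_gaussian:
  assumes "wiener_limit M B T f Z"
  shows "centered_gaussian M (\<integral>s. (f s)\<^sup>2 \<partial>lborel) Z"
proof -
  obtain N p c where *: "\<And>k::nat. time_grid T (N k) (p k)"
    "(\<lambda>k. \<integral>\<^sup>+s. ennreal ((f s - step_fun (N k) (p k) (c k) s)\<^sup>2) \<partial>lborel) \<longlonglongrightarrow> 0"
    "(\<lambda>k. \<integral>\<^sup>+\<omega>. ennreal ((Z \<omega> - step_integral B (N k) (p k) (c k) \<omega>)\<^sup>2) \<partial>M) \<longlonglongrightarrow> 0"
    using assms unfolding wiener_limit_def by blast
  have m: "f \<in> borel_measurable borel" "integrable lborel (\<lambda>s. (f s)\<^sup>2)" "Z \<in> borel_measurable M"
    using assms unfolding wiener_limit_def by auto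
  have "(\<lambda>k. \<integral>s. (step_fun (N k) (p k) (c k) s)\<^sup>2 \<partial>lborel) \<longlonglongrightarrow> (\<integral>s. (f s)\<^sup>2 \<partial>lborel)"
    using m integrable_step_fun_power2[OF *(1)] *(2) by (intro tendsto_integral_power2) auto
  from centered_gaussian_L2_limit[OF centered_gaussian_step_integral[OF *(1)] this m(3) *(3)]
  show ?thesis .
qed

text \<open>The approximating grids for different \<open>j\<close> are unrelated, but for each
  \<open>k\<close> the combination of the \<open>k\<close>-th approximants is again a step function
  on a single grid, and its integral is the same combination of integrals. Joint Gaussianity and the
  law of increments both rest on this.\<close>

lemma wiener_limit_lincomb:
  assumes J: "finite J" and wl: "\<And>j. j \<in> J \<Longrightarrow> wiener_limit M B T (f j) (Z j)"
  shows "wiener_limit M B T (\<lambda>s. \<Sum>j\<in>J. a j * f j s) (\<lambda>\<omega>. \<Sum>j\<in>J. a j * Z j \<omega>)"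
proof -
  define Q where "Q j N p c \<longleftrightarrow> (\<forall>k::nat. time_grid T (N k) (p k)) \<and>
        (\<lambda>k. \<integral>\<^sup>+s. ennreal ((f j s - step_fun (N k) (p k) (c k) s)\<^sup>2) \<partial>lborel) \<longlonglongrightarrow> 0 \<and>
        (\<lambda>k. \<integral>\<^sup>+\<omega>. ennreal ((Z j \<omega> - step_integral B (N k) (p k) (c k) \<omega>)\<^sup>2) \<partial>M) \<longlonglongrightarrow> 0" for j N p c
  have "\<exists>N p c. Q j N p c" if "j \<in> J" for j
    using wl[OF that] unfolding wiener_limit_def Q_def by blast
  then obtain N p c where "\<And>j. j \<in> J \<Longrightarrow> Q j (N j) (p j) (c j)" by metis
  then have *: "\<And>j k. j \<in> J \<Longrightarrow> time_grid T (N j k) (p j k)"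
    "\<And>j. j \<in> J \<Longrightarrow> (\<lambda>k. \<integral>\<^sup>+s. ennreal ((f j s - step_fun (N j k) (p j k) (c j k) s)\<^sup>2) \<partial>lborel) \<longlonglongrightarrow> 0"
    "\<And>j. j \<in> J \<Longrightarrow> (\<lambda>k. \<integral>\<^sup>+\<omega>. ennreal ((Z j \<omega> - step_integral B (N j k) (p j k) (c j k) \<omega>)\<^sup>2) \<partial>M) \<longlonglongrightarrow> 0"
    unfolding Q_def by blast+
  have m: "f j \<in> borel_measurable borel" "integrable lborel (\<lambda>s. (f j s)\<^sup>2)" "Z j \<in> borel_measurable M"
    if "j \<in> J" for j using wl[OF that] unfolding wiener_limit_def by auto
  have "\<exists>m q d. time_grid T m q \<and>
      (\<forall>\<phi>. step_form m q d \<phi> = (\<Sum>j\<in>J. a j * step_form (N j k) (p j k) (c j k) \<phi>))" for k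
    using J *(1) horizon by (intro step_form_linear_combination) auto
  then obtain N' p' c' where g: "\<And>k. time_grid T (N' k) (p' k)"
    and eq: "\<And>k \<phi>. step_form (N' k) (p' k) (c' k) \<phi> = (\<Sum>j\<in>J. a j * step_form (N j k) (p j k) (c j k) \<phi>)"
    by metis
  have sf: "step_fun (N' k) (p' k) (c' k) s = (\<Sum>j\<in>J. a j * step_fun (N j k) (p j k) (c j k) s)" for k s
    using step_fun_eq_step_form[OF g] step_fun_eq_step_form[OF *(1)] by (simp add: eq)
  have si: "step_integral B (N' k) (p' k) (c' k) \<omega> = (\<Sum>j\<in>J. a j * step_integral B (N j k) (p j k) (c j k) \<omega>)" for k \<omega>
    by (simp add: step_integral_eq_step_form eq)
  have "(\<lambda>k. \<integral>\<^sup>+s. ennreal (((\<Sum>j\<in>J. a j * f j s) - step_fun (N' k) (p' k) (c' k) s)\<^sup>2) \<partial>lborel) \<longlonglongrightarrow> 0"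
    using nn_integral_power2_lincomb_tendsto[OF J _ *(2), of "\<lambda>j. j" a] m(1)
    by (simp add: sf right_diff_distrib sum_subtractf)
  moreover have "(\<lambda>k. \<integral>\<^sup>+\<omega>. ennreal (((\<Sum>j\<in>J. a j * Z j \<omega>) - step_integral B (N' k) (p' k) (c' k) \<omega>)\<^sup>2) \<partial>M) \<longlonglongrightarrow> 0"
    using nn_integral_power2_lincomb_tendsto[OF J _ *(3), of "\<lambda>j. j" a] m(3) borel_measurable_step_integral[OF *(1)]
    by (simp add: si right_diff_distrib sum_subtractf)
  moreover have "(\<lambda>s. \<Sum>j\<in>J. a j * f j s) \<in> borel_measurable borel" using m by measurable
  moreover have "(\<lambda>\<omega>. \<Sum>j\<in>J. a j * Z j \<omega>) \<in> borel_measurable M" using m by measurable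
  moreover have "integrable lborel (\<lambda>s. (\<Sum>j\<in>J. a j * f j s)\<^sup>2)"
    using m by (intro integrable_power2_sum J) auto
  ultimately show ?thesis unfolding wiener_limit_def using g by blast
qed

lemma wiener_limit_diff:
  assumes "wiener_limit M B T f X" "wiener_limit M B T g Y"
  shows "wiener_limit M B T (\<lambda>s. f s - g s) (\<lambda>\<omega>. X \<omega> - Y \<omega>)"
  \<comment> \<open>The two-element type \<open>bool\<close> serves as index set for a combination
    of two terms.\<close>
  using wiener_limit_lincomb[of "UNIV :: bool set" "\<lambda>b. if b then f else g" "\<lambda>b. if b then X else Y"
      "\<lambda>b. if b then 1 else - 1"] assms
  by (simp add: UNIV_bool)

lemma wiener_limit_isometry:
  assumes "wiener_limit M B T f Z"
  shows "(\<integral>\<^sup>+\<omega>. ennreal ((Z \<omega>)\<^sup>2) \<partial>M) = (\<integral>\<^sup>+s. ennreal ((f s)\<^sup>2) \<partial>lborel)"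
proof -
  have "integrable lborel (\<lambda>s. (f s)\<^sup>2)" using assms by (simp add: wiener_limit_def)
  then show ?thesis
    using centered_gaussian_nn_integral_power2[OF wiener_limit_centered_gaussian[OF assms]]
    by (simp add: nn_integral_eq_integral)
qed

text \<open>A convergent sequence of step functions is Cauchy, the isometry makes the elementary
  integrals Cauchy, and completeness yields \<open>X\<close>. Approximability of \<open>f\<close> is
  a premise here; for the kernel it comes from \<open>step_fun_approximation_mono\<close>.\<close>

lemma has_wiener_integral_exists:
  assumes f: "square_integrable_upto t f" and t: "t \<le> T"
    and g: "\<And>k::nat. time_grid t (N k) (p k)"
    and lim: "(\<lambda>k. \<integral>\<^sup>+s\<in>{0..t}. ennreal ((f s - step_fun (N k) (p k) (c k) s)\<^sup>2) \<partial>lborel) \<longlonglongrightarrow> 0"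
  shows "\<exists>X. has_wiener_integral M B t f X"
proof -
  define d where "d k = (\<integral>\<^sup>+s\<in>{0..t}. ennreal ((f s - step_fun (N k) (p k) (c k) s)\<^sup>2) \<partial>lborel)" for k
  \<comment> \<open>Selecting squared errors below \<open>1 / 4 ^ k\<close> gives
    \<open>2 / 4 ^ l + 2 / 4 ^ k\<close>, hence at most \<open>4 / 4 ^ k\<close> for
    \<open>k \<le> l\<close>: the rate required by \<open>L2_complete\<close>.\<close>
  have "\<exists>i. d i \<le> ennreal (1 / 4 ^ k)" for k
  proof -
    have "eventually (\<lambda>i. d i < ennreal (1 / 4 ^ k)) sequentially"
      using lim unfolding d_def[symmetric] by (rule order_tendstoD) simp
    then show ?thesis by (auto simp: eventually_sequentially intro: less_imp_le)
  qed
  then obtain r where r: "\<And>k. d (r k) \<le> ennreal (1 / 4 ^ k)" by metis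
  let ?s = "\<lambda>k. step_fun (N (r k)) (p (r k)) (c (r k))"
  let ?S = "\<lambda>k. step_integral B (N (r k)) (p (r k)) (c (r k))"
  have gT: "time_grid T (N k) (p k)" for k using time_grid_mono_horizon[OF g t] .
  have fm[measurable]: "(\<lambda>s. indicator {0..t} s * f s) \<in> borel_measurable borel"
    using f by (simp add: square_integrable_upto_def set_borel_measurable_def)
  have dr: "d (r k) = (\<integral>\<^sup>+s. ennreal ((indicator {0..t} s * f s - ?s k s)\<^sup>2) \<partial>lborel)" for k
    unfolding d_def using step_fun_outside[OF g]
    by (intro nn_integral_cong) (auto simp: indicator_def)
  have "(\<integral>\<^sup>+\<omega>. ennreal ((?S l \<omega> - ?S k \<omega>)\<^sup>2) \<partial>M) \<le> ennreal (4 / 4 ^ k)" if "k \<le> l" for k l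
  proof -
    have "(\<integral>\<^sup>+\<omega>. ennreal ((?S l \<omega> - ?S k \<omega>)\<^sup>2) \<partial>M) = (\<integral>\<^sup>+s. ennreal ((?s l s - ?s k s)\<^sup>2) \<partial>lborel)"
      by (intro wiener_limit_isometry wiener_limit_diff wiener_limit_step gT)
    also have "\<dots> \<le> (\<integral>\<^sup>+s. 2 * ennreal ((indicator {0..t} s * f s - ?s l s)\<^sup>2)
        + 2 * ennreal ((indicator {0..t} s * f s - ?s k s)\<^sup>2) \<partial>lborel)"
    proof (intro nn_integral_mono)
      fix s
      have "(b - a)\<^sup>2 \<le> 2 * (x - b)\<^sup>2 + 2 * (x - a)\<^sup>2" for a b x :: real
        using zero_le_power2[of "2 * x - a - b"] by (simp add: power2_eq_square algebra_simps)
      then have "ennreal ((?s l s - ?s k s)\<^sup>2) \<le> ennreal (2 * (indicator {0..t} s * f s - ?s l s)\<^sup>2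
          + 2 * (indicator {0..t} s * f s - ?s k s)\<^sup>2)" by (rule ennreal_leI)
      then show "ennreal ((?s l s - ?s k s)\<^sup>2) \<le> 2 * ennreal ((indicator {0..t} s * f s - ?s l s)\<^sup>2)
          + 2 * ennreal ((indicator {0..t} s * f s - ?s k s)\<^sup>2)"
        by (simp add: ennreal_mult)
    qed
    also have "\<dots> = 2 * d (r l) + 2 * d (r k)"
      unfolding dr by (subst nn_integral_add) (auto simp: nn_integral_cmult)
    also have "\<dots> \<le> 2 * ennreal (1 / 4 ^ l) + 2 * ennreal (1 / 4 ^ k)"
      by (intro add_mono mult_left_mono r) auto
    also have "\<dots> \<le> 2 * ennreal (1 / 4 ^ k) + 2 * ennreal (1 / 4 ^ k)"
      using that by (intro add_mono mult_left_mono ennreal_leI divide_left_mono power_increasing) auto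
    also have "\<dots> = ennreal (2 * (1 / 4 ^ k) + 2 * (1 / 4 ^ k))"
      by (simp only: ennreal_plus ennreal_mult ennreal_numeral zero_le_numeral
          zero_le_divide_1_iff zero_le_power mult_nonneg_nonneg)
    finally show ?thesis by simp
  qed
  from L2_complete[OF borel_measurable_step_integral[OF gT] this]
  obtain X where X: "X \<in> borel_measurable M"
    "(\<lambda>k. \<integral>\<^sup>+\<omega>. ennreal ((X \<omega> - ?S k \<omega>)\<^sup>2) \<partial>M) \<longlonglongrightarrow> 0" by blast
  have "(\<lambda>k. (1 / 4 :: real) ^ k) \<longlonglongrightarrow> 0" by (intro LIMSEQ_power_zero) simp
  then have "(\<lambda>k. 1 / 4 ^ k :: real) \<longlonglongrightarrow> 0" by (simp add: power_divide)
  then have lim': "(\<lambda>k. ennreal (1 / 4 ^ k)) \<longlonglongrightarrow> 0" using tendsto_ennrealI by fastforce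
  have "(\<lambda>k. d (r k)) \<longlonglongrightarrow> 0"
    by (rule tendsto_sandwich[OF always_eventually always_eventually tendsto_const lim'])
      (intro allI zero_le r)+
  moreover have "\<forall>k. time_grid t (N (r k)) (p (r k))" using g by blast
  ultimately have "\<exists>N p c. (\<forall>k::nat. time_grid t (N k) (p k)) \<and>
      (\<lambda>k. \<integral>\<^sup>+s\<in>{0..t}. ennreal ((f s - step_fun (N k) (p k) (c k) s)\<^sup>2) \<partial>lborel) \<longlonglongrightarrow> 0 \<and>
      (\<lambda>k. \<integral>\<^sup>+\<omega>. ennreal ((X \<omega> - step_integral B (N k) (p k) (c k) \<omega>)\<^sup>2) \<partial>M) \<longlonglongrightarrow> 0"
    using X(2) unfolding d_def
    by - (rule exI[of _ "\<lambda>k. N (r k)"], rule exI[of _ "\<lambda>k. p (r k)"], rule exI[of _ "\<lambda>k. c (r k)"], blast)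
  then show ?thesis unfolding has_wiener_integral_def using f X(1) by blast
qed

end

section \<open>The kernel of a modulus of continuity\<close>

text \<open>The function may be unbounded near \<open>t\<close>. Sampling an increasing nonnegative
  function at left endpoints keeps the approximants between 0 and \<open>f\<close>, so
  \<open>f\<^sup>2\<close> dominates the squared error; continuity gives pointwise
  convergence.\<close>

lemma step_fun_approximation_mono:
  fixes f :: "real \<Rightarrow> real"
  assumes t: "0 < t" and f: "square_integrable_upto t f"
    and mono: "\<And>x y. 0 < x \<Longrightarrow> x \<le> y \<Longrightarrow> y < t \<Longrightarrow> f x \<le> f y"
    and nonneg: "\<And>x. 0 < x \<Longrightarrow> x < t \<Longrightarrow> 0 \<le> f x"
    and cont: "continuous_on {0<..<t} f"
  shows "\<exists>N p c. (\<forall>k::nat. time_grid t (N k) (p k)) \<and>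
    (\<lambda>k. \<integral>\<^sup>+s\<in>{0..t}. ennreal ((f s - step_fun (N k) (p k) (c k) s)\<^sup>2) \<partial>lborel) \<longlonglongrightarrow> 0"
proof -
  define p where "p k i = t * real i / real (Suc k)" for k i :: nat
  \<comment> \<open>The left endpoint of the first cell is 0, where no sign or monotonicity of
    \<open>f\<close> is assumed, so that cell gets the value 0.\<close>
  define c where "c k i = (if i = 0 then 0 else f (p k i))" for k i :: nat
  let ?s = "\<lambda>k. step_fun (Suc k) (p k) (c k)"
  have grid: "time_grid t (Suc k) (p k)" for k
    using t by (auto simp: time_grid_def p_def divide_strict_right_mono)
  have cell: "\<exists>j\<le>k. p k j < s \<and> s \<le> p k (Suc j) \<and> ?s k s = c k j" if "0 < s" "s < t" for s k
  proof -
    \<comment> \<open>Ceiling minus one, not floor, because cells are open on the left and closed on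
      the right.\<close>
    define j where "j = nat (\<lceil>s * real (Suc k) / t\<rceil> - 1)"
    have pos: "0 < s * real (Suc k) / t" using that t by simp
    have j: "real j = of_int \<lceil>s * real (Suc k) / t\<rceil> - 1"
      using pos unfolding j_def by (subst of_nat_nat) auto
    have "real j < s * real (Suc k) / t" "s * real (Suc k) / t \<le> real j + 1"
      unfolding j by linarith+
    then have "t * real j < s * real (Suc k)" "s * real (Suc k) \<le> t * (real j + 1)"
      using t by (auto simp: field_simps)
    then have pj: "p k j < s" "s \<le> p k (Suc j)"
      unfolding p_def by (auto simp: field_simps)
    have "t * real j < t * real (Suc k)"
      using \<open>t * real j < s * real (Suc k)\<close> that
      by (smt (verit) mult_right_mono of_nat_0_le_iff)
    then have "j < Suc k" using t by simp
    then show ?thesis using pj step_fun_eq[OF grid, of j k s "c k"] by (intro exI[of _ j]) auto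
  qed
  have bounds: "0 \<le> ?s k s \<and> ?s k s \<le> f s" if s: "0 < s" "s < t" for s k
  proof -
    obtain j where j: "j \<le> k" "p k j < s" "s \<le> p k (Suc j)" "?s k s = c k j" using cell[OF s] by blast
    show ?thesis
    proof (cases "j = 0")
      case True
      then show ?thesis using j nonneg[OF s] by (simp add: c_def)
    next
      case False
      then have "0 < p k j" using t by (simp add: p_def)
      then show ?thesis using j False mono[of "p k j" s] nonneg[of "p k j"] s by (auto simp: c_def)
    qed
  qed
  have conv: "(\<lambda>k. ?s k s) \<longlonglongrightarrow> f s" if s: "0 < s" "s < t" for s
  proof -
    obtain j where j: "\<And>k. j k \<le> k \<and> p k (j k) < s \<and> s \<le> p k (Suc (j k)) \<and> ?s k s = c k (j k)"
      using cell[OF s] by metis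
    define m where "m k = p k (j k)" for k
    have lo: "s - t / real (Suc k) \<le> m k" for k
    proof -
      have "p k (Suc (j k)) = m k + t / real (Suc k)" by (simp add: p_def m_def distrib_left add_divide_distrib[symmetric] add.commute)
      then show ?thesis using j[of k] by linarith
    qed
    have "(\<lambda>k. s - t * inverse (real (Suc k))) \<longlonglongrightarrow> s - t * 0"
      by (intro tendsto_intros LIMSEQ_inverse_real_of_nat)
    then have "(\<lambda>k. s - t / real (Suc k)) \<longlonglongrightarrow> s" by (simp add: divide_inverse)
    then have m: "m \<longlonglongrightarrow> s"
      by (rule tendsto_sandwich[OF always_eventually always_eventually _ tendsto_const, rotated 2])
        (use lo j in \<open>auto simp: m_def intro: less_imp_le\<close>)
    have "isCont f s" using cont s by (simp add: continuous_on_eq_continuous_at)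
    then have "(\<lambda>k. f (m k)) \<longlonglongrightarrow> f s" using m by (rule isCont_tendsto_compose)
    \<comment> \<open>For fixed \<open>s > 0\<close> the sample point is eventually positive, so the
      first cell with its artificial value is left behind.\<close>
    moreover have "eventually (\<lambda>k. f (m k) = ?s k s) sequentially"
    proof (rule eventually_mono[OF order_tendstoD(1)[OF m s(1)]])
      fix k assume "0 < m k"
      then have "j k \<noteq> 0" by (intro notI) (simp add: m_def p_def)
      then show "f (m k) = ?s k s" using j[of k] by (simp add: c_def m_def)
    qed
    ultimately show ?thesis by (rule Lim_transform_eventually)
  qed
  let ?F = "\<lambda>s. indicator {0..t} s * f s"
  have fm[measurable]: "?F \<in> borel_measurable borel"
    using f by (simp add: square_integrable_upto_def set_borel_measurable_def)
  have AE: "AE s in lborel. s \<noteq> 0 \<and> s \<noteq> t"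
    using AE_lborel_singleton[of 0] AE_lborel_singleton[of t] by eventually_elim auto
  have "(\<lambda>k. \<integral>\<^sup>+s. ennreal ((?F s - ?s k s)\<^sup>2) \<partial>lborel) \<longlonglongrightarrow> (\<integral>\<^sup>+s. 0 \<partial>(lborel :: real measure))"
  proof (rule nn_integral_dominated_convergence[where w="\<lambda>s. ennreal ((?F s)\<^sup>2)"])
    fix k
    show "AE s in lborel. ennreal ((?F s - ?s k s)\<^sup>2) \<le> ennreal ((?F s)\<^sup>2)"
      using AE
    proof eventually_elim
      fix s assume "s \<noteq> 0 \<and> s \<noteq> t"
      then consider "0 < s" "s < t" | "s \<notin> {0..t}" by fastforce
      then show "ennreal ((?F s - ?s k s)\<^sup>2) \<le> ennreal ((?F s)\<^sup>2)"
      proof cases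
        case 1
        then show ?thesis using bounds[OF 1, of k] by (auto intro!: ennreal_leI power_mono)
      next
        case 2
        then show ?thesis using step_fun_outside[OF grid 2] by simp
      qed
    qed
  next
    have "(\<lambda>s. (?F s)\<^sup>2) = (\<lambda>s. indicator {0..t} s * (f s)\<^sup>2)" by (auto simp: indicator_def)
    then have "integrable lborel (\<lambda>s. (?F s)\<^sup>2)"
      using f by (simp add: square_integrable_upto_def set_integrable_def)
    then show "(\<integral>\<^sup>+s. ennreal ((?F s)\<^sup>2) \<partial>lborel) < \<infinity>"
      by (simp add: nn_integral_eq_integral)
  next
    show "AE s in lborel. (\<lambda>k. ennreal ((?F s - ?s k s)\<^sup>2)) \<longlonglongrightarrow> 0"
      using AE
    proof eventually_elim
      fix s assume "s \<noteq> 0 \<and> s \<noteq> t"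
      then consider "0 < s" "s < t" | "s \<notin> {0..t}" by fastforce
      then show "(\<lambda>k. ennreal ((?F s - ?s k s)\<^sup>2)) \<longlonglongrightarrow> 0"
      proof cases
        case 1
        have "(\<lambda>k. ennreal ((f s - ?s k s)\<^sup>2)) \<longlonglongrightarrow> ennreal ((f s - f s)\<^sup>2)"
          by (intro tendsto_intros conv 1)
        then show ?thesis using 1 by simp
      next
        case 2
        then show ?thesis using step_fun_outside[OF grid 2] by simp
      qed
    qed
  qed measurable
  moreover have "(\<integral>\<^sup>+s. ennreal ((?F s - ?s k s)\<^sup>2) \<partial>lborel)
      = (\<integral>\<^sup>+s\<in>{0..t}. ennreal ((f s - ?s k s)\<^sup>2) \<partial>lborel)" for k
    using step_fun_outside[OF grid] by (intro nn_integral_cong) (auto simp: indicator_def)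
  ultimately have "(\<lambda>k. \<integral>\<^sup>+s\<in>{0..t}. ennreal ((f s - ?s k s)\<^sup>2) \<partial>lborel) \<longlonglongrightarrow> 0" by simp
  then show ?thesis
    using grid by - (rule exI[of _ Suc], rule exI[of _ p], rule exI[of _ c], blast)
qed

lemma has_wiener_integral_cong_AE:
  assumes "AE s in lborel. s \<in> {0..t} \<longrightarrow> f s = g s" "square_integrable_upto t g"
    "has_wiener_integral M B t f X"
  shows "has_wiener_integral M B t g X"
proof -
  have "(\<integral>\<^sup>+s\<in>{0..t}. ennreal ((f s - step_fun n p c s)\<^sup>2) \<partial>lborel)
      = (\<integral>\<^sup>+s\<in>{0..t}. ennreal ((g s - step_fun n p c s)\<^sup>2) \<partial>lborel)" for n p c
    by (rule nn_integral_cong_AE, rule eventually_mono[OF assms(1)]) (auto simp: indicator_def)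
  then show ?thesis using assms unfolding has_wiener_integral_def by simp
qed

section \<open>Positivity and monotonicity of \<eta> and of the truncated kernel\<close>

locale concave_modulus =
  fixes T :: real and \<eta> :: "real \<Rightarrow> real"
  assumes T_pos: "0 < T"
    and modulus: "modulus_of_continuity T \<eta>"
    and C2: "C2_on {0<..<T} \<eta>"
    and deriv_pos: "\<forall>x\<in>{0<..<T}. 0 < deriv (\<lambda>y. (\<eta> y)\<^sup>2) x"
    and deriv_antimono: "antimono_on {0<..<T} (deriv (\<lambda>y. (\<eta> y)\<^sup>2))"
begin

abbreviation sq_deriv where "sq_deriv \<equiv> deriv (\<lambda>y. (\<eta> y)\<^sup>2)"

text \<open>\<^const>\<open>tau\<close> has arbitrary values outside \<open>(0, T)\<close>; they are replaced by \<open>0\<close>.\<close>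
definition trunc_tau :: "real \<Rightarrow> real" where
  "trunc_tau x = (if 0 < x \<and> x < T then tau \<eta> x else 0)"

lemma eta_nonneg: "0 \<le> x \<Longrightarrow> x \<le> T \<Longrightarrow> 0 \<le> \<eta> x"
  using modulus by (simp add: modulus_of_continuity_def)

lemma eta_differentiable: "0 < x \<Longrightarrow> x < T \<Longrightarrow> (\<eta> has_real_derivative deriv \<eta> x) (at x)"
proof -
  assume x: "0 < x" "x < T"
  then have "\<eta> differentiable at x within {0<..<T}"
    using C2 unfolding C2_on_def differentiable_on_def by simp
  then have "\<eta> differentiable at x" using at_within_open[of x "{0<..<T}"] x by simp
  then show ?thesis by (simp add: DERIV_deriv_iff_real_differentiable)
qed

lemma eta_power2_deriv: "0 < x \<Longrightarrow> x < T \<Longrightarrow> sq_deriv x = 2 * \<eta> x * deriv \<eta> x"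
  using DERIV_power[OF eta_differentiable, of x 2] by (intro DERIV_imp_deriv) (simp add: mult_ac)

lemma eta_power2_has_deriv: "0 < x \<Longrightarrow> x < T \<Longrightarrow> ((\<lambda>y. (\<eta> y)\<^sup>2) has_real_derivative sq_deriv x) (at x)"
  using DERIV_power[OF eta_differentiable, of x 2] by (simp add: eta_power2_deriv mult_ac)

lemma continuous_on_sq_deriv: "continuous_on {0<..<T} sq_deriv"
proof -
  have "continuous_on {0<..<T} \<eta>" "continuous_on {0<..<T} (deriv \<eta>)"
    using C2 by (auto simp: C2_on_def intro: differentiable_imp_continuous_on)
  then have "continuous_on {0<..<T} (\<lambda>x. 2 * \<eta> x * deriv \<eta> x)" by (intro continuous_intros)
  then show ?thesis by (rule continuous_on_eq) (auto simp: eta_power2_deriv)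
qed

lemma eta_power2_strict_mono:
  assumes "0 < x" "x < y" "y < T"
  shows "(\<eta> x)\<^sup>2 < (\<eta> y)\<^sup>2"
proof (rule DERIV_pos_imp_increasing[OF assms(2)])
  fix u assume "x \<le> u" "u \<le> y"
  then have "0 < u" "u < T" using assms by auto
  then show "\<exists>d. ((\<lambda>y. (\<eta> y)\<^sup>2) has_real_derivative d) (at u) \<and> 0 < d"
    using eta_power2_has_deriv[of u] deriv_pos by (intro exI[of _ "sq_deriv u"] conjI) simp_all
qed

lemma eta_mono:
  assumes "0 < x" "x \<le> y" "y < T"
  shows "\<eta> x \<le> \<eta> y"
proof (cases "x = y")
  case False
  then have "(\<eta> x)\<^sup>2 < (\<eta> y)\<^sup>2" using assms by (intro eta_power2_strict_mono) auto
  then show ?thesis using eta_nonneg[of y] assms by (simp add: power_less_imp_less_base less_imp_le)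
qed simp

lemma eta_pos:
  assumes "0 < x" "x < T"
  shows "0 < \<eta> x"
proof -
  have "(\<eta> (x / 2))\<^sup>2 < (\<eta> x)\<^sup>2" using assms by (intro eta_power2_strict_mono) auto
  then have "\<eta> x \<noteq> 0" by (metis not_less zero_le_power2 power_zero_numeral)
  then show ?thesis using eta_nonneg[of x] assms by simp
qed

lemma eta_tendsto_0: "(\<eta> \<longlongrightarrow> 0) (at_right 0)"
proof -
  have "(\<eta> \<longlongrightarrow> 0) (at 0 within {0..T})"
    using modulus unfolding modulus_of_continuity_def by simp
  then show ?thesis using at_within_Icc_at_right[OF T_pos] by simp
qed

lemma trunc_tau_nonneg: "0 \<le> trunc_tau x"
  using deriv_pos by (simp add: trunc_tau_def tau_def less_imp_le)

lemma trunc_tau_pos: "0 < x \<Longrightarrow> x < T \<Longrightarrow> 0 < trunc_tau x"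
  using deriv_pos by (simp add: trunc_tau_def tau_def)

lemma trunc_tau_power2: "0 < x \<Longrightarrow> x < T \<Longrightarrow> (trunc_tau x)\<^sup>2 = sq_deriv x"
  using deriv_pos by (simp add: trunc_tau_def tau_def less_imp_le)

lemma trunc_tau_eq_0: "x \<le> 0 \<Longrightarrow> trunc_tau x = 0"
  by (simp add: trunc_tau_def)

lemma trunc_tau_antimono:
  assumes "0 < x" "x \<le> y"
  shows "trunc_tau y \<le> trunc_tau x"
proof (cases "y < T")
  case True
  then have "sq_deriv y \<le> sq_deriv x" using deriv_antimono assms by (auto simp: monotone_on_def)
  then show ?thesis using True assms by (simp add: trunc_tau_def tau_def)
qed (simp add: trunc_tau_nonneg trunc_tau_def[of y])

lemma continuous_on_trunc_tau: "continuous_on {0<..<T} trunc_tau"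
proof -
  have "continuous_on {0<..<T} (\<lambda>x. sqrt (sq_deriv x))" by (intro continuous_intros continuous_on_sq_deriv)
  then show ?thesis by (rule continuous_on_eq) (auto simp: trunc_tau_def tau_def)
qed

lemma borel_measurable_trunc_tau [measurable]: "trunc_tau \<in> borel_measurable borel"
proof -
  have "(\<lambda>x. indicator {0<..<T} x *\<^sub>R trunc_tau x) \<in> borel_measurable borel"
    by (intro borel_measurable_continuous_on_indicator continuous_on_trunc_tau) simp
  moreover have "(\<lambda>x. indicator {0<..<T} x *\<^sub>R trunc_tau x) = trunc_tau" by (auto simp: trunc_tau_def indicator_def)
  ultimately show ?thesis by simp
qed

section \<open>The variance function and the size of increments\<close>

text \<open>The variance of the process at time \<open>x\<close>. It stands in for
  \<open>(\<eta> x)\<^sup>2\<close>, which may differ from it at \<open>T\<close>, where \<eta> can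
  jump.\<close>

definition energy :: "real \<Rightarrow> real" where
  "energy x = (\<integral>u. indicator {..x} u * (trunc_tau u)\<^sup>2 \<partial>lborel)"

text \<open>An improper integral, as the derivative may be unbounded at 0. The version of the
  fundamental theorem for nonnegative derivatives needs only one-sided limits at the ends and
  delivers integrability as well.\<close>

lemma FTC_eta_power2:
  assumes "0 < x" "x < T"
  shows "set_integrable lborel {0<..<x} sq_deriv" "(LBINT u:{0<..<x}. sq_deriv u) = (\<eta> x)\<^sup>2"
proof -
  have ein: "einterval 0 (ereal x) = {0<..<x}" by (auto simp: einterval_def)
  have lim0: "(((\<lambda>y. (\<eta> y)\<^sup>2) \<circ> real_of_ereal) \<longlongrightarrow> 0) (at_right 0)"
  proof -
    have "((\<lambda>y. (\<eta> y)\<^sup>2) \<longlongrightarrow> 0\<^sup>2) (at_right 0)" by (intro tendsto_intros eta_tendsto_0)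
    then show ?thesis unfolding zero_ereal_def ereal_tendsto_simps by simp
  qed
  have limx: "(((\<lambda>y. (\<eta> y)\<^sup>2) \<circ> real_of_ereal) \<longlongrightarrow> (\<eta> x)\<^sup>2) (at_left (ereal x))"
  proof -
    have "isCont (\<lambda>y. (\<eta> y)\<^sup>2) x" using eta_power2_has_deriv[OF assms] by (rule DERIV_isCont)
    then have "((\<lambda>y. (\<eta> y)\<^sup>2) \<longlongrightarrow> (\<eta> x)\<^sup>2) (at_left x)"
      unfolding isCont_def by (rule tendsto_mono[OF at_le, rotated]) simp
    then show ?thesis unfolding ereal_tendsto_simps .
  qed
  have *: "(0::ereal) < ereal x" using assms by simp
  have F: "((\<lambda>y. (\<eta> y)\<^sup>2) has_real_derivative sq_deriv u) (at u)" if "0 < ereal u" "ereal u < ereal x" for u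
    using that assms by (intro eta_power2_has_deriv) auto
  have c: "isCont sq_deriv u" if "0 < ereal u" "ereal u < ereal x" for u
    using that assms continuous_on_sq_deriv by (auto simp: continuous_on_eq_continuous_at)
  have nn: "AE u in lborel. 0 < ereal u \<longrightarrow> ereal u < ereal x \<longrightarrow> 0 \<le> sq_deriv u"
    using deriv_pos assms by (intro AE_I2) (simp add: less_imp_le)
  show "set_integrable lborel {0<..<x} sq_deriv"
    using interval_integral_FTC_nonneg(1)[OF * F c nn lim0 limx] unfolding ein .
  show "(LBINT u:{0<..<x}. sq_deriv u) = (\<eta> x)\<^sup>2"
    using interval_integral_FTC_nonneg(2)[OF * F c nn lim0 limx] *
    by (simp add: interval_lebesgue_integral_def ein)
qed

text \<open>Split at \<open>T / 2\<close>. Near 0 integrability comes from the fundamental theorem;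
  on the rest of the interval, where \<eta> has no known limit at \<open>T\<close>, the kernel is
  bounded by its value at \<open>T / 2\<close>.\<close>

lemma integrable_trunc_tau_power2: "integrable lborel (\<lambda>u. (trunc_tau u)\<^sup>2)"
proof -
  have T2: "0 < T / 2" "T / 2 < T" using T_pos by auto
  have "integrable lborel (\<lambda>u. indicator {0<..<T / 2} u * (trunc_tau u)\<^sup>2)"
  proof -
    have "(\<lambda>u. indicator {0<..<T / 2} u * (trunc_tau u)\<^sup>2) = (\<lambda>u. indicator {0<..<T / 2} u *\<^sub>R sq_deriv u)"
      using T2 by (auto simp: indicator_def trunc_tau_power2)
    then show ?thesis using FTC_eta_power2(1)[OF T2] by (simp add: set_integrable_def)
  qed
  moreover have "integrable lborel (\<lambda>u. indicator {T / 2..T} u * (trunc_tau u)\<^sup>2)"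
  proof (rule Bochner_Integration.integrable_bound)
    have "integrable lborel (indicator {T / 2..T} :: real \<Rightarrow> real)"
      by (rule integrable_real_indicator) (simp_all add: emeasure_lborel_Icc_eq)
    then show "integrable lborel (\<lambda>u. indicator {T / 2..T} u * (trunc_tau (T / 2))\<^sup>2)" by simp
    show "AE u in lborel. norm (indicator {T / 2..T} u * (trunc_tau u)\<^sup>2) \<le> norm (indicator {T / 2..T} u * (trunc_tau (T / 2))\<^sup>2)"
      using T2 trunc_tau_antimono[of "T / 2"] trunc_tau_nonneg
      by (intro AE_I2) (auto simp: indicator_def power_mono)
  qed simp
  ultimately have "integrable lborel (\<lambda>u. indicator {0<..<T / 2} u * (trunc_tau u)\<^sup>2 + indicator {T / 2..T} u * (trunc_tau u)\<^sup>2)"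
    by (rule Bochner_Integration.integrable_add)
  moreover have "(\<lambda>u. indicator {0<..<T / 2} u * (trunc_tau u)\<^sup>2 + indicator {T / 2..T} u * (trunc_tau u)\<^sup>2) = (\<lambda>u. (trunc_tau u)\<^sup>2)"
    using T2 by (auto simp: indicator_def trunc_tau_def)
  ultimately show ?thesis by simp
qed

lemma integrable_energy: "integrable lborel (\<lambda>u. indicator {..x} u * (trunc_tau u)\<^sup>2)"
  using integrable_real_mult_indicator[OF _ integrable_trunc_tau_power2, of "{..x}"] by (simp add: mult.commute)

lemma energy_eq:
  assumes "0 < x" "x < T"
  shows "energy x = (\<eta> x)\<^sup>2"
proof -
  have "energy x = (\<integral>u. indicator {0<..<x} u *\<^sub>R sq_deriv u \<partial>lborel)"
    unfolding energy_def
  proof (rule integral_cong_AE)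
    show "(\<lambda>u. indicator {0<..<x} u *\<^sub>R sq_deriv u) \<in> borel_measurable lborel"
      using FTC_eta_power2(1)[OF assms] by (simp add: set_integrable_def)
    show "AE u in lborel. indicator {..x} u * (trunc_tau u)\<^sup>2 = indicator {0<..<x} u *\<^sub>R sq_deriv u"
      using AE_lborel_singleton[of x]
      by eventually_elim (use assms in \<open>auto simp: indicator_def trunc_tau_power2 trunc_tau_eq_0\<close>)
  qed simp
  then show ?thesis using FTC_eta_power2(2)[OF assms] by (simp add: set_lebesgue_integral_def)
qed

lemma energy_0: "energy 0 = 0"
proof -
  have "(\<lambda>u. indicator {..0} u * (trunc_tau u)\<^sup>2) = (\<lambda>u. 0)" by (auto simp: indicator_def trunc_tau_eq_0)
  then show ?thesis by (simp add: energy_def)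
qed

lemma energy_mono: "x \<le> y \<Longrightarrow> energy x \<le> energy y"
  unfolding energy_def by (intro integral_mono integrable_energy) (auto simp: indicator_def)

text \<open>The kernel at time \<open>t\<close>, extended by zero to the whole line: the indicator
  cuts at 0, and \<open>trunc_tau\<close> vanishes for \<open>s \<ge> t\<close> on its own.\<close>

definition slice :: "real \<Rightarrow> real \<Rightarrow> real" where
  "slice t s = indicator {0..} s * trunc_tau (t - s)"

lemma borel_measurable_slice [measurable]: "slice t \<in> borel_measurable borel"
  unfolding slice_def[abs_def] by measurable

lemma has_integral_slice_power2:
  "integrable lborel (\<lambda>s. (slice t s)\<^sup>2)" "(\<integral>s. (slice t s)\<^sup>2 \<partial>lborel) = energy t"
proof -
  have eq: "(\<lambda>s. (slice t s)\<^sup>2) = (\<lambda>s. indicator {..t} (t + (-1) * s) * (trunc_tau (t + (-1) * s))\<^sup>2)"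
    by (auto simp: slice_def indicator_def)
  show "integrable lborel (\<lambda>s. (slice t s)\<^sup>2)"
    unfolding eq by (rule lborel_integrable_real_affine[OF integrable_energy]) simp
  show "(\<integral>s. (slice t s)\<^sup>2 \<partial>lborel) = energy t"
    unfolding eq energy_def by (subst lborel_integral_real_affine[where c="-1" and t=t]) simp_all
qed

lemma integral_tail_slice_power2:
  assumes "0 \<le> s" "s \<le> t"
  shows "integrable lborel (\<lambda>u. indicator {s..} u * (slice t u)\<^sup>2)"
    "(\<integral>u. indicator {s..} u * (slice t u)\<^sup>2 \<partial>lborel) = energy (t - s)"
proof -
  have eq: "(\<lambda>u. indicator {s..} u * (slice t u)\<^sup>2)
      = (\<lambda>u. indicator {..t - s} (t + (-1) * u) * (trunc_tau (t + (-1) * u))\<^sup>2)"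
    using assms by (auto simp: slice_def indicator_def)
  show "integrable lborel (\<lambda>u. indicator {s..} u * (slice t u)\<^sup>2)"
    unfolding eq by (rule lborel_integrable_real_affine[OF integrable_energy]) simp
  show "(\<integral>u. indicator {s..} u * (slice t u)\<^sup>2 \<partial>lborel) = energy (t - s)"
    unfolding eq energy_def by (subst lborel_integral_real_affine[where c="-1" and t=t]) simp_all
qed

lemma integral_slice_diff_le:
  assumes "0 \<le> s" "s \<le> t"
  shows "(\<integral>u. (slice t u - slice s u)\<^sup>2 \<partial>lborel) \<le> 2 * energy (t - s)"
proof -
  have int: "integrable lborel (\<lambda>u. (slice t u - slice s u)\<^sup>2)"
    by (intro integrable_power2_diff has_integral_slice_power2) auto
  \<comment> \<open>One inequality for the whole line. Before \<open>s\<close> the last term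
    vanishes and monotonicity of the kernel is used; from \<open>s\<close> on,
    \<open>slice s\<close> is zero and the last term repairs the negative sign, giving equality. The
    first two terms integrate to \<open>energy s - energy t\<close>, which is not positive.\<close>
  have "(slice t u - slice s u)\<^sup>2 \<le> (slice s u)\<^sup>2 - (slice t u)\<^sup>2 + 2 * (indicator {s..} u * (slice t u)\<^sup>2)" for u
  proof (cases "s \<le> u")
    case True
    then show ?thesis by (simp add: slice_def trunc_tau_eq_0)
  next
    case False
    then have le: "slice t u \<le> slice s u" "0 \<le> slice t u"
      using assms trunc_tau_antimono[of "s - u" "t - u"] trunc_tau_nonneg by (auto simp: slice_def indicator_def)
    have "0 \<le> 2 * slice t u * (slice s u - slice t u)" using le by simp
    then show ?thesis using False by (simp add: power2_eq_square algebra_simps)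
  qed
  then have "(\<integral>u. (slice t u - slice s u)\<^sup>2 \<partial>lborel)
      \<le> (\<integral>u. (slice s u)\<^sup>2 - (slice t u)\<^sup>2 + 2 * (indicator {s..} u * (slice t u)\<^sup>2) \<partial>lborel)"
    using integral_tail_slice_power2(1)[OF assms] has_integral_slice_power2
    by (intro integral_mono int) auto
  also have "\<dots> = energy s - energy t + 2 * energy (t - s)"
    using integral_tail_slice_power2[OF assms] has_integral_slice_power2 by simp
  also have "\<dots> \<le> 2 * energy (t - s)" using energy_mono[OF assms(2)] by simp
  finally show ?thesis .
qed

end

section \<open>The convolution process\<close>

context concave_modulus
begin

text \<open>The excluded case is the corner \<open>t = T\<close>, \<open>s = 0\<close>, where the
  kernel takes the uncontrolled value \<open>tau \<eta> T\<close>.\<close>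

lemma conv_kernel_eq_slice:
  assumes "t \<le> T" "0 \<le> s" "s \<noteq> 0 \<or> t < T"
  shows "conv_kernel (tau \<eta>) t s = slice t s"
  using assms by (auto simp: conv_kernel_def slice_def trunc_tau_def)

lemma conv_kernel_pos:
  assumes "0 < s" "s < t" "t \<le> T"
  shows "0 < conv_kernel (tau \<eta>) t s"
  using assms trunc_tau_pos[of "t - s"] by (simp add: conv_kernel_eq_slice slice_def)

text \<open>Freedom at the two points \<open>0\<close> and \<open>t\<close> covers both forms of the
  integrand: \<open>tau \<eta> (t - s)\<close> is uncontrolled at \<open>s = t\<close>, and for
  \<open>t = T\<close> either form is uncontrolled at \<open>s = 0\<close>.\<close>

lemma square_integrable_upto_slice:
  assumes eq: "\<And>s. s \<in> {0..u} \<Longrightarrow> s \<notin> {0, t} \<Longrightarrow> h s = slice t s"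
  shows "square_integrable_upto u h"
  unfolding square_integrable_upto_def set_borel_measurable_def set_integrable_def
proof
  show "(\<lambda>s. indicator {0..u} s *\<^sub>R h s) \<in> borel_measurable lborel"
    by (rule measurable_discrete_difference[where X="{0, t}" and f="\<lambda>s. indicator {0..u} s *\<^sub>R slice t s"])
      (auto simp: indicator_def eq)
  have "integrable lborel (\<lambda>s. indicator {0..u} s *\<^sub>R (slice t s)\<^sup>2)"
    using integrable_real_mult_indicator[OF _ has_integral_slice_power2(1)[of t], of "{0..u}"]
    by (simp add: mult.commute)
  then show "integrable lborel (\<lambda>s. indicator {0..u} s *\<^sub>R (h s)\<^sup>2)"
    by (rule iffD1[OF integrable_discrete_difference[where X="{0, t}"], rotated 4])
      (auto simp: indicator_def eq)
qed

lemma square_integrable_upto_tau: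
  assumes "0 \<le> t" "t \<le> T"
  shows "square_integrable_upto t (\<lambda>s. tau \<eta> (t - s))"
  by (rule square_integrable_upto_slice[where t=t]) (use assms in \<open>auto simp: slice_def trunc_tau_def\<close>)

lemma square_integrable_upto_conv_kernel:
  assumes "0 \<le> t" "t \<le> T"
  shows "square_integrable_upto u (conv_kernel (tau \<eta>) t)"
  by (rule square_integrable_upto_slice[where t=t]) (use assms conv_kernel_eq_slice in auto)

lemma nn_integral_trunc_tau_reflect:
  "(\<integral>\<^sup>+s. ennreal ((trunc_tau (t - s))\<^sup>2) \<partial>lborel) = (\<integral>\<^sup>+u. ennreal ((trunc_tau u)\<^sup>2) \<partial>lborel)"
  by (subst nn_integral_real_affine[where c="-1" and t=t and f="\<lambda>u. ennreal ((trunc_tau u)\<^sup>2)"]) simp_all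

lemma admissible_conv_kernel: "admissible_volterra_kernel T (conv_kernel (tau \<eta>))"
proof -
  let ?S = "{0..T} \<times> {0..T}" and ?K = "conv_kernel (tau \<eta>)"
  let ?X = "{(T, 0)} :: (real \<times> real) set"
  let ?g = "\<lambda>x. trunc_tau (fst x - snd x)"
  have S: "?S \<in> sets borel" by (intro borel_closed closed_Times) auto
  have eq: "(case x of (t, s) \<Rightarrow> ?K t s) = ?g x" if "x \<in> ?S" "x \<notin> ?X" for x
  proof -
    obtain t s where x: "x = (t, s)" by (cases x)
    show ?thesis using that conv_kernel_eq_slice[of t s] unfolding x by (auto simp: slice_def)
  qed
  have gm: "?g \<in> borel_measurable borel"
    by (rule measurable_compose[OF _ borel_measurable_trunc_tau])
      (intro borel_measurable_continuous_onI continuous_intros)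
  have "(\<lambda>x. indicator ?S x *\<^sub>R ?g x) \<in> borel_measurable lborel"
    using gm S by simp
  then have 1: "set_borel_measurable lborel ?S (\<lambda>(t, s). ?K t s)"
    unfolding set_borel_measurable_def
    by (rule measurable_discrete_difference[where X="?X"]) (auto simp: indicator_def eq)
  have int: "integrable lborel (\<lambda>x. indicator ?S x *\<^sub>R (?g x)\<^sup>2)"
  proof (rule integrableI_nonneg)
    show m: "(\<lambda>x. indicator ?S x *\<^sub>R (?g x)\<^sup>2) \<in> borel_measurable lborel" using gm S by simp
    \<comment> \<open>Tonelli: by reflection and translation each inner integral is at most
      \<open>?C\<close>, whatever \<open>t\<close> is, so the double integral is at most
      \<open>?C * T\<close>.\<close>
    let ?C = "\<integral>\<^sup>+u. ennreal ((trunc_tau u)\<^sup>2) \<partial>lborel"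
    have "(\<integral>\<^sup>+x. ennreal (indicator ?S x *\<^sub>R (?g x)\<^sup>2) \<partial>lborel)
        = (\<integral>\<^sup>+t. \<integral>\<^sup>+s. ennreal (indicator ?S (t, s) *\<^sub>R (?g (t, s))\<^sup>2) \<partial>lborel \<partial>lborel)"
      unfolding lborel_prod[symmetric]
      by (rule lborel.nn_integral_fst[symmetric]) (use m in \<open>simp add: lborel_prod\<close>)
    also have "\<dots> \<le> (\<integral>\<^sup>+t. ?C * indicator {0..T} t \<partial>lborel)"
    proof (intro nn_integral_mono)
      fix t
      have "(\<integral>\<^sup>+s. ennreal (indicator ?S (t, s) *\<^sub>R (?g (t, s))\<^sup>2) \<partial>lborel)
          \<le> (\<integral>\<^sup>+s. ennreal ((trunc_tau (t - s))\<^sup>2) * indicator {0..T} t \<partial>lborel)"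
        by (intro nn_integral_mono) (auto simp: indicator_def)
      also have "\<dots> = ?C * indicator {0..T} t"
        by (subst nn_integral_multc) (auto simp: nn_integral_trunc_tau_reflect)
      finally show "(\<integral>\<^sup>+s. ennreal (indicator ?S (t, s) *\<^sub>R (?g (t, s))\<^sup>2) \<partial>lborel) \<le> ?C * indicator {0..T} t" .
    qed
    also have "\<dots> = ?C * ennreal T"
      using T_pos by (subst nn_integral_cmult_indicator) auto
    also have "\<dots> < \<infinity>"
      using integrable_trunc_tau_power2 by (simp add: nn_integral_eq_integral ennreal_mult_less_top)
    finally show "(\<integral>\<^sup>+x. ennreal (indicator ?S x *\<^sub>R (?g x)\<^sup>2) \<partial>lborel) < \<infinity>" .
  qed auto
  have 2: "set_integrable lborel ?S (\<lambda>(t, s). (?K t s)\<^sup>2)"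
    unfolding set_integrable_def
    using int by (rule iffD1[OF integrable_discrete_difference[where X="?X"], rotated 4])
      (auto simp: indicator_def eq[symmetric])
  have 3: "\<not> (AE s in lborel. s \<in> {0..T} \<longrightarrow> ?K t s = 0)" if "t \<in> {0<..T}" for t
  proof
    assume "AE s in lborel. s \<in> {0..T} \<longrightarrow> ?K t s = 0"
    then have "AE s in lborel. s \<notin> {0<..<t}"
    proof (rule eventually_mono)
      fix s assume "s \<in> {0..T} \<longrightarrow> ?K t s = 0"
      then show "s \<notin> {0<..<t}" using conv_kernel_pos[of s t] that by fastforce
    qed
    then have "{0<..<t} \<in> null_sets lborel" by (subst AE_iff_null_sets) auto
    then have "emeasure lborel {0<..<t} = 0" by auto
    then show False using that by simp
  qed
  have 4: "\<forall>t\<in>{0..T}. \<forall>s\<in>{0..T}. t < s \<longrightarrow> ?K t s = 0" by (simp add: conv_kernel_def)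
  show ?thesis
    unfolding admissible_volterra_kernel_def
    by (intro conjI 1 2 4) (use 3 square_integrable_upto_conv_kernel in simp)
qed

end

locale volterra_convolution = brownian_motion M T B + concave_modulus T \<eta>
  for M :: "'a measure" and T B \<eta>
begin

text \<open>Reflecting the non-increasing kernel makes the integrand non-decreasing on
  \<open>(0, t)\<close>, so the left-endpoint approximation applies and the choice made by
  \<open>SOME\<close> is justified.\<close>

lemma has_wiener_integral_B_hat:
  assumes "0 \<le> t" "t \<le> T"
  shows "has_wiener_integral M B t (\<lambda>s. tau \<eta> (t - s)) (B_hat M B \<eta> t)"
proof -
  have sq: "square_integrable_upto t (\<lambda>s. tau \<eta> (t - s))"
    by (rule square_integrable_upto_tau[OF assms])
  have "\<exists>N p c. (\<forall>k::nat. time_grid t (N k) (p k)) \<and>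
    (\<lambda>k. \<integral>\<^sup>+s\<in>{0..t}. ennreal ((tau \<eta> (t - s) - step_fun (N k) (p k) (c k) s)\<^sup>2) \<partial>lborel) \<longlonglongrightarrow> 0"
  proof (cases "t = 0")
    \<comment> \<open>The interval is a single point, hence null, and the grid without cells already
      approximates.\<close>
    case True
    have "time_grid t 0 (\<lambda>_. 0)" using True by (simp add: time_grid_def)
    moreover have "(\<integral>\<^sup>+s\<in>{0..t}. ennreal ((tau \<eta> (t - s) - step_fun 0 (\<lambda>_. 0) (\<lambda>_. 0) s)\<^sup>2) \<partial>lborel) = 0"
    proof -
      have "AE s in lborel. ennreal ((tau \<eta> (t - s) - step_fun 0 (\<lambda>_. 0) (\<lambda>_. 0) s)\<^sup>2) * indicator {0..t} s = 0"
        using AE_lborel_singleton[of "0::real"] by eventually_elim (simp add: True)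
      then have "(\<integral>\<^sup>+s\<in>{0..t}. ennreal ((tau \<eta> (t - s) - step_fun 0 (\<lambda>_. 0) (\<lambda>_. 0) s)\<^sup>2) \<partial>lborel)
          = (\<integral>\<^sup>+s. 0 \<partial>(lborel :: real measure))"
        by (rule nn_integral_cong_AE)
      then show ?thesis by simp
    qed
    ultimately show ?thesis
      by - (rule exI[of _ "\<lambda>_. 0"], rule exI[of _ "\<lambda>_ _. 0"], rule exI[of _ "\<lambda>_ _. 0"], simp)
  next
    case False
    then have t: "0 < t" using assms by simp
    have tau: "tau \<eta> (t - s) = trunc_tau (t - s)" if "0 < s" "s < t" for s
      using that assms by (simp add: trunc_tau_def)
    show ?thesis
    proof (rule step_fun_approximation_mono[OF t sq])
      show "tau \<eta> (t - x) \<le> tau \<eta> (t - y)" if "0 < x" "x \<le> y" "y < t" for x y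
        using that tau[of x] tau[of y] trunc_tau_antimono[of "t - y" "t - x"] by simp
      show "0 \<le> tau \<eta> (t - x)" if "0 < x" "x < t" for x
        using that tau[of x] trunc_tau_nonneg by simp
      have "continuous_on {0<..<t} (\<lambda>s. trunc_tau (t - s))"
        by (rule continuous_on_compose2[OF continuous_on_trunc_tau])
          (use assms in \<open>auto intro!: continuous_intros\<close>)
      then show "continuous_on {0<..<t} (\<lambda>s. tau \<eta> (t - s))"
        by (rule continuous_on_eq) (simp add: tau)
    qed
  qed
  then obtain N p c where "\<And>k::nat. time_grid t (N k) (p k)"
    "(\<lambda>k. \<integral>\<^sup>+s\<in>{0..t}. ennreal ((tau \<eta> (t - s) - step_fun (N k) (p k) (c k) s)\<^sup>2) \<partial>lborel) \<longlonglongrightarrow> 0"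
    by blast
  from has_wiener_integral_exists[OF sq assms(2) this]
  show ?thesis unfolding B_hat_def wiener_integral_def by (rule someI_ex)
qed

lemma has_wiener_integral_conv_kernel:
  assumes "0 \<le> t" "t \<le> T"
  shows "has_wiener_integral M B t (conv_kernel (tau \<eta>) t) (B_hat M B \<eta> t)"
proof (rule has_wiener_integral_cong_AE[OF _ square_integrable_upto_conv_kernel has_wiener_integral_B_hat])
  show "AE s in lborel. s \<in> {0..t} \<longrightarrow> tau \<eta> (t - s) = conv_kernel (tau \<eta>) t s"
    using AE_lborel_singleton[of t] by eventually_elim (auto simp: conv_kernel_def)
qed (use assms in auto)

lemma wiener_limit_B_hat:
  assumes "0 \<le> t" "t \<le> T"
  shows "wiener_limit M B T (slice t) (B_hat M B \<eta> t)"
proof -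
  have sq: "square_integrable_upto t (slice t)" by (rule square_integrable_upto_slice[where t=t]) simp
  have "AE s in lborel. s \<in> {0..t} \<longrightarrow> tau \<eta> (t - s) = slice t s"
    using AE_lborel_singleton[of 0] AE_lborel_singleton[of t]
    by eventually_elim (use assms in \<open>auto simp: slice_def trunc_tau_def\<close>)
  from has_wiener_integral_cong_AE[OF this sq has_wiener_integral_B_hat[OF assms]]
  have "wiener_limit M B T (\<lambda>s. indicator {0..t} s * slice t s) (B_hat M B \<eta> t)"
    using assms(2) by (rule has_wiener_integral_imp_wiener_limit)
  moreover have "(\<lambda>s. indicator {0..t} s * slice t s) = slice t"
    by (rule ext) (auto simp: slice_def indicator_def trunc_tau_eq_0)
  ultimately show ?thesis by simp
qed

lemma centered_gaussian_B_hat: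
  assumes "0 \<le> t" "t \<le> T"
  shows "centered_gaussian M (energy t) (B_hat M B \<eta> t)"
  using wiener_limit_centered_gaussian[OF wiener_limit_B_hat[OF assms]]
  by (simp add: has_integral_slice_power2)

lemma borel_measurable_B_hat:
  "0 \<le> t \<Longrightarrow> t \<le> T \<Longrightarrow> B_hat M B \<eta> t \<in> borel_measurable M"
  using centered_gaussian_B_hat by (simp add: centered_gaussian_def)

lemma centered_gaussian_B_hat_increment:
  assumes "0 \<le> s" "s \<le> t" "t \<le> T"
  shows "\<exists>v \<le> 2 * energy (t - s). centered_gaussian M v (\<lambda>\<omega>. B_hat M B \<eta> t \<omega> - B_hat M B \<eta> s \<omega>)"
proof -
  have "wiener_limit M B T (\<lambda>u. slice t u - slice s u) (\<lambda>\<omega>. B_hat M B \<eta> t \<omega> - B_hat M B \<eta> s \<omega>)"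
    using assms by (intro wiener_limit_diff wiener_limit_B_hat) auto
  from wiener_limit_centered_gaussian[OF this] integral_slice_diff_le[OF assms(1,2)]
  show ?thesis by blast
qed

lemma volterra_gaussian_process_B_hat:
  "volterra_gaussian_process M T B (conv_kernel (tau \<eta>)) (B_hat M B \<eta>)"
proof -
  have "gaussian_rv M (\<lambda>\<omega>. \<Sum>t\<in>J. c t * B_hat M B \<eta> t \<omega>)" if "finite J" "J \<subseteq> {0..T}" for J c
  proof -
    have "wiener_limit M B T (\<lambda>s. \<Sum>t\<in>J. c t * slice t s) (\<lambda>\<omega>. \<Sum>t\<in>J. c t * B_hat M B \<eta> t \<omega>)"
      using that by (intro wiener_limit_lincomb wiener_limit_B_hat) auto
    then show ?thesis
      using wiener_limit_centered_gaussian centered_gaussian_imp_gaussian_rv by blast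
  qed
  then show ?thesis
    unfolding volterra_gaussian_process_def gaussian_process_def
    using admissible_conv_kernel has_wiener_integral_conv_kernel by simp
qed

end

section \<open>Chaining on doubly exponential grids\<close>

text \<open>Squaring the size at each step turns Fernique's integral into a sum over \<open>p\<close>, and makes successive grids nested.\<close>
definition grid_size :: "nat \<Rightarrow> nat" where
  "grid_size p = 2 ^ 2 ^ p"

lemma grid_size_pos: "0 < grid_size p"
  by (simp add: grid_size_def)

lemma grid_size_Suc: "grid_size (Suc p) = grid_size p * grid_size p"
  by (simp add: grid_size_def mult_2 power_add)

lemma grid_size_gt: "p < grid_size p"
  unfolding grid_size_def by (meson less_exp less_trans)

lemma grid_size_dvd: "p \<le> q \<Longrightarrow> grid_size p dvd grid_size q"
  by (simp add: grid_size_def le_imp_power_dvd)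

definition grid_point :: "real \<Rightarrow> nat \<Rightarrow> nat \<Rightarrow> real" where
  "grid_point T p k = T * real k / real (grid_size p)"

lemma grid_point_refine:
  assumes "p \<le> q"
  shows "grid_point T p k = grid_point T q (k * (grid_size q div grid_size p))"
proof -
  obtain m where m: "grid_size q = grid_size p * m" using grid_size_dvd[OF assms] by (auto simp: dvd_def)
  then have "0 < m" using grid_size_pos[of q] by (cases m) auto
  then show ?thesis unfolding grid_point_def m using grid_size_pos[of p] by simp
qed

section \<open>Deterministic chaining\<close>

text \<open>Integer division links an index to the coarser grid point at or below it. Consecutive
  divisions compose to a single one, so a chain through \<open>m\<close> levels ends at the index
  obtained by dividing once.\<close>

lemma chaining_telescope:
  fixes x :: "real \<Rightarrow> real" and a :: "nat \<Rightarrow> real"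
  assumes link: "\<And>p k. p0 \<le> p \<Longrightarrow> k \<le> grid_size (Suc p) \<Longrightarrow>
      \<bar>x (grid_point T (Suc p) k) - x (grid_point T p (k div grid_size p))\<bar> \<le> a p"
    and p: "p0 \<le> p" and k: "k \<le> grid_size (p + m)"
  shows "\<bar>x (grid_point T (p + m) k) - x (grid_point T p (k div (grid_size (p + m) div grid_size p)))\<bar>
    \<le> (\<Sum>i<m. a (i + p))"
  using k
proof (induction m arbitrary: k)
  case 0
  then show ?case using grid_size_pos[of p] by simp
next
  case (Suc m)
  define j where "j = k div grid_size (p + m)"
  have "j \<le> grid_size (Suc (p + m)) div grid_size (p + m)"
    unfolding j_def using Suc.prems by (intro div_le_mono) simp
  then have "j \<le> grid_size (p + m)" using grid_size_pos[of "p + m"] by (simp add: grid_size_Suc)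
  note IH = Suc.IH[OF this]
  have "grid_size (p + m) * (grid_size (p + m) div grid_size p) = grid_size (p + Suc m) div grid_size p"
    using div_mult_swap[OF grid_size_dvd[of p "p + m"], of "grid_size (p + m)"] by (simp add: grid_size_Suc)
  then have j: "j div (grid_size (p + m) div grid_size p) = k div (grid_size (p + Suc m) div grid_size p)"
    unfolding j_def by (simp only: div_mult2_eq[symmetric])
  have "\<bar>x (grid_point T (Suc (p + m)) k) - x (grid_point T (p + m) j)\<bar> \<le> a (m + p)"
    using link[of "p + m" k] p Suc.prems by (simp add: j_def add.commute)
  then show ?case using IH unfolding j by simp
qed

text \<open>Two points closer than the mesh of level \<open>p\<close> chain down to equal or
  adjacent points of that level. Their values differ by at most two tails of the series and one step
  \<open>a p\<close>, three quantities below \<open>e / 3\<close>.\<close>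

lemma chaining_uniformly_continuous:
  fixes x :: "real \<Rightarrow> real" and a :: "nat \<Rightarrow> real"
  assumes T: "0 < T" and a: "summable a" "\<And>p. 0 \<le> a p"
    and link: "\<And>p k. p0 \<le> p \<Longrightarrow> k \<le> grid_size (Suc p) \<Longrightarrow>
      \<bar>x (grid_point T (Suc p) k) - x (grid_point T p (k div grid_size p))\<bar> \<le> a p"
    and step: "\<And>p k. p0 \<le> p \<Longrightarrow> k < grid_size p \<Longrightarrow>
      \<bar>x (grid_point T p (Suc k)) - x (grid_point T p k)\<bar> \<le> a p"
  shows "uniformly_continuous_on {grid_point T p k | p k. k \<le> grid_size p} x"
proof -
  let ?D = "{grid_point T p k | p k. k \<le> grid_size p}"
  have close: "\<bar>x (grid_point T q l) - x (grid_point T q k)\<bar> < e"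
    if p: "p0 \<le> p" "(\<Sum>i. a (i + p)) < e / 3" and q: "p \<le> q" "k \<le> l" "l \<le> grid_size q"
      and d: "grid_point T q l - grid_point T q k < T / real (grid_size p)" for p q k l e
  proof -
    obtain m where m: "q = p + m" using q(1) le_Suc_ex by blast
    define r where "r = grid_size q div grid_size p"
    have r: "grid_size q = grid_size p * r" unfolding r_def using grid_size_dvd[OF q(1)] by simp
    then have r0: "0 < r" using grid_size_pos[of q] by (cases r) auto
    have tail: "(\<Sum>i<m. a (i + p)) \<le> (\<Sum>i. a (i + p))"
      using a by (intro sum_le_suminf summable_ignore_initial_segment) auto
    \<comment> \<open>\<open>a p\<close> is the first term of the tail, so smallness of the tail
      controls the step as well.\<close>
    have "a (0 + p) \<le> (\<Sum>i. a (i + p))"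
      using a sum_le_suminf[of "\<lambda>i. a (i + p)" "{0}"] by (simp add: summable_ignore_initial_segment)
    then have ap: "a p \<le> (\<Sum>i. a (i + p))" by simp
    have chain: "\<bar>x (grid_point T q j) - x (grid_point T p (j div r))\<bar> \<le> (\<Sum>i. a (i + p))"
      if "j \<le> grid_size q" for j
      using chaining_telescope[OF link p(1), of j m] tail that unfolding r_def m by simp
    have "T * (real l - real k) / (real (grid_size p) * real r) < T / real (grid_size p)"
      using d q(2) unfolding grid_point_def r by (simp add: right_diff_distrib diff_divide_distrib)
    then have "T / real (grid_size p) * ((real l - real k) / real r) < T / real (grid_size p) * 1" by simp
    moreover have "0 < T / real (grid_size p)" using T grid_size_pos[of p] by simp
    ultimately have "(real l - real k) / real r < 1" by (simp only: mult_less_cancel_left_pos)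
    then have "real l - real k < real r" using r0 by (simp add: field_simps)
    then have "l \<le> k + r" by linarith
    then have "l div r \<le> (k + r) div r" by (rule div_le_mono)
    also have "\<dots> = Suc (k div r)" using r0 by simp
    finally have le: "l div r \<le> Suc (k div r)" .
    have "k div r \<le> l div r" using q(2) by (rule div_le_mono)
    have "l div r \<le> grid_size q div r" using q(3) by (rule div_le_mono)
    then have "l div r \<le> grid_size p" using r r0 by simp
    have "\<bar>x (grid_point T p (l div r)) - x (grid_point T p (k div r))\<bar> \<le> a p"
    proof (cases "l div r = k div r")
      case True
      then show ?thesis using a by simp
    next
      case False
      then have "l div r = Suc (k div r)" using le \<open>k div r \<le> l div r\<close> by simp
      then show ?thesis using step[OF p(1), of "k div r"] \<open>l div r \<le> grid_size p\<close> by simp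
    qed
    then show ?thesis using chain[of k] chain[of l] q p(2) ap by linarith
  qed
  show ?thesis
    unfolding uniformly_continuous_on_def
  proof (intro allI impI)
    fix e :: real assume e: "0 < e"
    obtain n where n: "\<And>p. n \<le> p \<Longrightarrow> norm (\<Sum>i. a (i + p)) < e / 3"
      using suminf_exist_split[of "e / 3" a] e a by auto
    define p where "p = max n p0"
    have p: "p0 \<le> p" "(\<Sum>i. a (i + p)) < e / 3" using n[of p] by (auto simp: p_def)
    have "dist (x t) (x s) < e" if st: "s \<in> ?D" "t \<in> ?D" "dist t s < T / real (grid_size p)" for s t
    proof -
      obtain p1 k1 where s: "s = grid_point T p1 k1" "k1 \<le> grid_size p1" using st(1) by auto
      obtain p2 k2 where t: "t = grid_point T p2 k2" "k2 \<le> grid_size p2" using st(2) by auto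
      \<comment> \<open>The grids are nested, so both points also lie on the common level
        \<open>q\<close>.\<close>
      define q where "q = max p (max p1 p2)"
      have q: "p \<le> q" "p1 \<le> q" "p2 \<le> q" by (auto simp: q_def)
      define k where "k = k1 * (grid_size q div grid_size p1)"
      define l where "l = k2 * (grid_size q div grid_size p2)"
      have "k \<le> grid_size p1 * (grid_size q div grid_size p1)" unfolding k_def using s by (intro mult_right_mono) auto
      then have k: "k \<le> grid_size q" "s = grid_point T q k"
        using grid_size_dvd[OF q(2)] s grid_point_refine[OF q(2)] by (auto simp: k_def)
      have "l \<le> grid_size p2 * (grid_size q div grid_size p2)" unfolding l_def using t by (intro mult_right_mono) auto
      then have l: "l \<le> grid_size q" "t = grid_point T q l"
        using grid_size_dvd[OF q(3)] t grid_point_refine[OF q(3)] by (auto simp: l_def)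
      have d: "\<bar>grid_point T q l - grid_point T q k\<bar> < T / real (grid_size p)"
        using st(3) k l by (simp add: dist_real_def)
      show ?thesis
      proof (cases "k \<le> l")
        case True
        then show ?thesis using close[OF p q(1) True l(1)] d k l by (simp add: dist_real_def)
      next
        case False
        then have "l \<le> k" by simp
        then show ?thesis using close[OF p q(1) \<open>l \<le> k\<close> k(1)] d k l by (simp add: dist_real_def abs_minus_commute)
      qed
    qed
    moreover have "0 < T / real (grid_size p)" using T grid_size_pos[of p] by simp
    ultimately show "\<exists>d>0. \<forall>s\<in>?D. \<forall>t\<in>?D. dist t s < d \<longrightarrow> dist (x t) (x s) < e" by blast
  qed
qed

section \<open>Approximation of times from below by grid points\<close>

definition grid_floor :: "real \<Rightarrow> nat \<Rightarrow> real \<Rightarrow> real" where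
  "grid_floor T p t = grid_point T p (nat \<lfloor>t * real (grid_size p) / T\<rfloor>)"

lemma grid_floor_bounds:
  assumes "0 < T" "0 \<le> t"
  shows "0 \<le> grid_floor T p t" "grid_floor T p t \<le> t" "t - grid_floor T p t \<le> T / real (grid_size p)"
proof -
  define k where "k = nat \<lfloor>t * real (grid_size p) / T\<rfloor>"
  have N: "0 < real (grid_size p)" using grid_size_pos by simp
  have "0 \<le> t * real (grid_size p) / T" using assms N by simp
  then have k: "real k \<le> t * real (grid_size p) / T" "t * real (grid_size p) / T \<le> real k + 1"
    unfolding k_def by auto
  have eq: "grid_floor T p t = T * real k / real (grid_size p)"
    by (simp add: grid_floor_def grid_point_def k_def)
  show "0 \<le> grid_floor T p t" unfolding eq using assms N by simp
  show "grid_floor T p t \<le> t" unfolding eq using k(1) assms N by (simp add: field_simps)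
  show "t - grid_floor T p t \<le> T / real (grid_size p)"
  proof -
    have "t \<le> (T * real k + T) / real (grid_size p)" using k(2) assms N by (simp add: field_simps)
    then show ?thesis unfolding eq by (simp add: add_divide_distrib)
  qed
qed

lemma grid_floor_in_grid:
  assumes "0 < T" "0 \<le> t" "t \<le> T"
  shows "grid_floor T p t \<in> {grid_point T p k | p k. k \<le> grid_size p}"
proof -
  let ?k = "nat \<lfloor>t * real (grid_size p) / T\<rfloor>"
  have "t * real (grid_size p) \<le> T * real (grid_size p)" using assms by (intro mult_right_mono) auto
  then have "t * real (grid_size p) / T \<le> real (grid_size p)" using assms by (simp add: field_simps)
  then have "?k \<le> grid_size p" by linarith
  then show ?thesis unfolding grid_floor_def by blast
qed

lemma grid_mesh_tendsto_0: "(\<lambda>p. T / real (grid_size p)) \<longlonglongrightarrow> 0"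
proof (rule tendsto_divide_0[OF tendsto_const])
  have "filterlim (\<lambda>p. real (grid_size p)) at_top sequentially"
    by (rule filterlim_at_top_mono[OF filterlim_real_sequentially])
      (intro always_eventually allI, use grid_size_gt less_imp_le in auto)
  then show "filterlim (\<lambda>p. real (grid_size p)) at_infinity sequentially"
    by (rule filterlim_at_top_imp_at_infinity)
qed

lemma grid_floor_tendsto:
  assumes "0 < T" "0 \<le> t"
  shows "(\<lambda>p. grid_floor T p t) \<longlonglongrightarrow> t"
proof (rule tendsto_sandwich)
  have "(\<lambda>p. t - T / real (grid_size p)) \<longlonglongrightarrow> t - 0" by (intro tendsto_intros grid_mesh_tendsto_0)
  then show "(\<lambda>p. t - T / real (grid_size p)) \<longlonglongrightarrow> t" by simp
  show "eventually (\<lambda>p. t - T / real (grid_size p) \<le> grid_floor T p t) sequentially"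
    using grid_floor_bounds(3)[OF assms] by (intro always_eventually allI) (simp add: algebra_simps)
  show "eventually (\<lambda>p. grid_floor T p t \<le> t) sequentially"
    using grid_floor_bounds(2)[OF assms] by simp
qed (rule tendsto_const)

section \<open>Fernique's integral as a series\<close>

context concave_modulus
begin

lemma grid_mesh_bounds: "0 < T / real (grid_size p)" "T / real (grid_size p) < T"
proof -
  have "(1::real) < 2 ^ 2 ^ p" by (rule one_less_power) auto
  then have "1 < real (grid_size p)" by (simp add: grid_size_def)
  then show "0 < T / real (grid_size p)" "T / real (grid_size p) < T"
    using T_pos by (auto simp: field_simps)
qed

text \<open>Between consecutive reciprocal meshes \<open>\<eta> (inverse u)\<close> is at least
  \<eta> at the finer mesh, \<open>ln u\<close> is at most \<open>4 * 2 ^ p\<close>, and the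
  integral of \<open>1 / u\<close> is \<open>2 ^ p * ln 2\<close>. Each block of the integral thus
  dominates a multiple of one term of the series.\<close>

lemma fernique_summable:
  assumes "fernique_condition T \<eta>"
  shows "summable (\<lambda>p. sqrt (2 ^ p) * \<eta> (T / real (grid_size p)))"
proof -
  obtain a where a: "1 < a" "1 / T \<le> a"
    and int: "set_integrable lborel {a..} (\<lambda>u. \<eta> (inverse u) * ln u powr (- 1 / 2) / u)"
    using assms unfolding fernique_condition_def by auto
  define h where "h u = indicator {a..} u *\<^sub>R (\<eta> (inverse u) * ln u powr (- 1 / 2) / u)" for u :: real
  define U where "U p = real (grid_size p) / T" for p
  \<comment> \<open>As a measure, so that countable additivity sums the disjoint blocks.\<close>
  define Q where "Q = density lborel (\<lambda>u. ennreal (h u))"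
  have hint: "integrable lborel h" using int unfolding set_integrable_def h_def[abs_def] .
  have hm[measurable]: "h \<in> borel_measurable borel" using hint by auto
  have Ulim: "filterlim U at_top sequentially"
  proof -
    have "filterlim (\<lambda>p. real p / T) at_top sequentially"
      using filterlim_tendsto_pos_mult_at_top[OF tendsto_const[of "1 / T"] _ filterlim_real_sequentially] T_pos
      by simp
    moreover have "real p / T \<le> U p" for p
      unfolding U_def using T_pos less_imp_le[OF grid_size_gt[of p]] by (intro divide_right_mono) auto
    ultimately show ?thesis by (rule filterlim_at_top_mono[OF _ always_eventually[OF allI]])
  qed
  \<comment> \<open>From \<open>p0\<close> on the blocks lie in the range of integration, and the
    shift \<open>- ln T\<close> in \<open>ln (U p)\<close> is absorbed by powers of 2.\<close>
  have "eventually (\<lambda>p. a \<le> U p \<and> - ln T \<le> real p) sequentially"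
    using Ulim filterlim_real_sequentially unfolding filterlim_at_top by (intro eventually_conj) auto
  then obtain p0 where p0: "\<And>p. p0 \<le> p \<Longrightarrow> a \<le> U p" "\<And>p. p0 \<le> p \<Longrightarrow> - ln T \<le> real p"
    by (auto simp: eventually_sequentially)
  have Umono: "U p \<le> U q" if "p \<le> q" for p q
    using dvd_imp_le[OF grid_size_dvd[OF that] grid_size_pos] T_pos
    by (auto simp: U_def intro!: divide_right_mono)
  have lnU: "ln (U p) = 2 ^ p * ln 2 - ln T" for p
    using T_pos grid_size_pos[of p] by (simp add: U_def grid_size_def ln_div ln_realpow)
  let ?I = "\<lambda>p. {U (p0 + p)<..U (Suc (p0 + p))}"
  \<comment> \<open>The 4 is a factor 2 from the root of \<open>4 * 2 ^ p\<close> times a factor 2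
    from \<open>ln 2 \<ge> 1 / 2\<close>.\<close>
  have lower: "ennreal (\<eta> (T / real (grid_size (Suc p))) * sqrt (2 ^ p) / 4) \<le> emeasure Q {U p<..U (Suc p)}"
    if p: "p0 \<le> p" for p
  proof -
    define c where "c = \<eta> (T / real (grid_size (Suc p))) / (2 * sqrt (2 ^ p))"
    have c0: "0 \<le> c"
      unfolding c_def using grid_mesh_bounds[of "Suc p"] eta_nonneg by (intro divide_nonneg_nonneg) (auto intro: less_imp_le)
    have hlow: "c * (1 / u) \<le> h u" if u: "U p < u" "u \<le> U (Suc p)" for u
    proof -
      have ua: "a \<le> u" using p0(1)[OF p] u by simp
      have u1: "1 < u" "0 < u" using ua a by auto
      have inv: "T / real (grid_size (Suc p)) \<le> inverse u" "inverse u < T"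
      proof -
        have "inverse (U (Suc p)) \<le> inverse u" using u u1 by (intro le_imp_inverse_le) auto
        then show "T / real (grid_size (Suc p)) \<le> inverse u" by (simp add: U_def)
        \<comment> \<open>The strict inequality \<open>U p < u\<close> matters: \<open>a\<close> may
          equal \<open>1 / T\<close>, and \<eta> is known to be monotone only strictly below
          \<open>T\<close>.\<close>
        have "1 / T < u" using a(2) p0(1)[OF p] u by simp
        then show "inverse u < T" using T_pos u1 by (simp add: field_simps)
      qed
      have eta: "\<eta> (T / real (grid_size (Suc p))) \<le> \<eta> (inverse u)"
        using grid_mesh_bounds[of "Suc p"] inv by (intro eta_mono) auto
      have "ln u \<le> ln (U (Suc p))" using u u1 by simp
      also have "\<dots> \<le> 2 ^ Suc p * 1 + 2 ^ Suc p"
      proof -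
        have "(2::real) ^ Suc p * ln 2 \<le> 2 ^ Suc p * 1" using ln2_le_25_over_36 by (intro mult_left_mono) auto
        moreover have "real p \<le> 2 ^ Suc p" using of_nat_le_iff[of p "2 ^ Suc p", where 'a=real] less_exp[of p]
          by (metis le_less_trans less_imp_le lessI of_nat_numeral of_nat_power less_exp less_trans)
        ultimately show ?thesis using p0(2)[OF p] lnU[of "Suc p"] by linarith
      qed
      also have "\<dots> = 4 * 2 ^ p" by simp
      finally have lnu: "ln u \<le> 4 * 2 ^ p" .
      have lnpos: "0 < ln u" using u1 by simp
      have "1 / (2 * sqrt (2 ^ p)) = 1 / sqrt (4 * 2 ^ p)" by (simp add: real_sqrt_mult)
      also have "\<dots> \<le> 1 / sqrt (ln u)" using lnu lnpos by (intro divide_left_mono) auto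
      also have "\<dots> = ln u powr (- 1 / 2)"       proof -
        have "- 1 / 2 = - (1 / 2 :: real)" by simp
        then show ?thesis using powr_minus_divide[of "ln u" "1 / 2"] powr_half_sqrt[of "ln u"] lnpos by simp
      qed
      finally have "1 / (2 * sqrt (2 ^ p)) \<le> ln u powr (- 1 / 2)" .
      then have "\<eta> (T / real (grid_size (Suc p))) * (1 / (2 * sqrt (2 ^ p))) \<le> \<eta> (inverse u) * ln u powr (- 1 / 2)"
        using eta eta_nonneg[of "inverse u"] inv u1 by (intro mult_mono) auto
      then have "c * (1 / u) \<le> \<eta> (inverse u) * ln u powr (- 1 / 2) * (1 / u)"
        unfolding c_def using u1 by (intro mult_right_mono) auto
      then show ?thesis using ua by (simp add: h_def)
    qed
    have U: "0 < U p" "U p \<le> U (Suc p)" using p0(1)[OF p] a Umono[of p "Suc p"] by auto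
    have "ennreal (\<eta> (T / real (grid_size (Suc p))) * sqrt (2 ^ p) / 4) \<le> ennreal (c * (2 ^ p * ln 2))"
    proof (intro ennreal_leI)
      have s: "sqrt (2 ^ p) * sqrt (2 ^ p) = (2 ^ p :: real)" by simp
      have "\<eta> (T / real (grid_size (Suc p))) * sqrt (2 ^ p) / 4 = c * (sqrt (2 ^ p) * sqrt (2 ^ p) * (1 / 2))"
      proof -
        have aux: "E * w / 4 = E / (2 * w) * (w * w * (1 / 2))" if "w \<noteq> 0" for E w :: real
          using that by (simp add: field_simps)
        show ?thesis unfolding c_def by (rule aux) simp
      qed
      also have "\<dots> = c * (2 ^ p * (1 / 2))" unfolding s ..
      also have "\<dots> \<le> c * (2 ^ p * ln 2)"
        using ln2_ge_two_thirds c0 by (intro mult_left_mono) auto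
      finally show "\<eta> (T / real (grid_size (Suc p))) * sqrt (2 ^ p) / 4 \<le> c * (2 ^ p * ln 2)" .
    qed
    also have "c * (2 ^ p * ln 2) = c * ln (U (Suc p)) - c * ln (U p)" by (simp add: lnU algebra_simps)
    also have "ennreal \<dots> = (\<integral>\<^sup>+u. ennreal (c * (1 / u)) * indicator {U p..U (Suc p)} u \<partial>lborel)"
    proof (rule nn_integral_FTC_Icc[where F="\<lambda>u. c * ln u", symmetric])
      fix u assume u: "u \<in> {U p..U (Suc p)}"
      then have "0 < u" using U by auto
      then show "((\<lambda>u. c * ln u) has_real_derivative c * (1 / u)) (at u)"
        by (auto intro!: derivative_eq_intros)
      show "0 \<le> c * (1 / u)" using c0 \<open>0 < u\<close> by simp
    qed (use U in auto)
    also have "\<dots> \<le> (\<integral>\<^sup>+u. ennreal (h u) * indicator {U p<..U (Suc p)} u \<partial>lborel)"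
    proof (rule nn_integral_mono_AE)
      \<comment> \<open>The antiderivative is evaluated on a closed interval, whereas disjoint
        blocks are half-open; the left endpoint is null.\<close>
      show "AE u in lborel. ennreal (c * (1 / u)) * indicator {U p..U (Suc p)} u
          \<le> ennreal (h u) * indicator {U p<..U (Suc p)} u"
        using AE_lborel_singleton[of "U p"]
        by eventually_elim (use hlow in \<open>auto simp: indicator_def intro!: ennreal_leI\<close>)
    qed
    also have "\<dots> = emeasure Q {U p<..U (Suc p)}" unfolding Q_def by (subst emeasure_density) auto
    finally show ?thesis .
  qed
  have disj: "disjoint_family ?I"
    unfolding disjoint_family_on_def
  proof (intro ballI impI)
    fix p q :: nat assume "p \<noteq> q"
    then consider "Suc (p0 + p) \<le> p0 + q" | "Suc (p0 + q) \<le> p0 + p" by linarith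
    then show "?I p \<inter> ?I q = {}"
      by cases (use Umono[of "Suc (p0 + p)" "p0 + q"] Umono[of "Suc (p0 + q)" "p0 + p"] in auto)
  qed
  let ?b = "\<lambda>p. \<eta> (T / real (grid_size (Suc (p0 + p)))) * sqrt (2 ^ (p0 + p)) / 4"
  have "(\<Sum>p. ennreal (?b p)) \<le> (\<Sum>p. emeasure Q (?I p))" by (intro suminf_le lower) auto
  also have "\<dots> = emeasure Q (\<Union>p. ?I p)"
    by (rule suminf_emeasure) (use disj in \<open>auto simp: Q_def\<close>)
  also have "\<dots> \<le> emeasure Q UNIV" by (intro emeasure_mono) (auto simp: Q_def)
  also have "\<dots> = (\<integral>\<^sup>+u. ennreal (h u) \<partial>lborel)" unfolding Q_def by (subst emeasure_density) auto
  also have "\<dots> \<le> (\<integral>\<^sup>+u. ennreal (norm (h u)) \<partial>lborel)" by (intro nn_integral_mono ennreal_leI) auto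
  also have "\<dots> < \<infinity>" using hint by (simp add: integrable_iff_bounded)
  finally have fin: "(\<Sum>p. ennreal (?b p)) \<noteq> \<top>" by simp
  have b0: "0 \<le> ?b p" for p
    using eta_nonneg[of "T / real (grid_size (Suc (p0 + p)))"] grid_mesh_bounds[of "Suc (p0 + p)"] by simp
  have "summable ?b" by (rule summable_suminf_not_top[OF b0 fin])
  \<comment> \<open>The factor \<open>sqrt 2\<close> raises \<open>sqrt (2 ^ p)\<close> to the level
    \<open>Suc p\<close> at which \<eta> was taken.\<close>
  then have "summable (\<lambda>p. 4 * sqrt 2 * ?b p)" by (rule summable_mult)
  moreover have "4 * sqrt 2 * ?b p = sqrt (2 ^ (p + Suc p0)) * \<eta> (T / real (grid_size (p + Suc p0)))" for p
    by (simp add: real_sqrt_mult add.commute mult_ac)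
  ultimately have "summable (\<lambda>p. sqrt (2 ^ (p + Suc p0)) * \<eta> (T / real (grid_size (p + Suc p0))))"
    by (simp only:)
  then show ?thesis by (subst (asm) summable_iff_shift)
qed

end

section \<open>Continuity and roughness of the paths\<close>

text \<open>Fatou's lemma bounds the mean-square distance of the two limits by zero. It will show
  that the pathwise extension is a version of the process.\<close>

lemma (in prob_space) AE_eq_limit_of_L2_limit:
  fixes S :: "nat \<Rightarrow> 'a \<Rightarrow> real"
  assumes [measurable]: "\<And>n. S n \<in> borel_measurable M" "X \<in> borel_measurable M" "Y \<in> borel_measurable M"
    and L2: "(\<lambda>n. \<integral>\<^sup>+\<omega>. ennreal ((S n \<omega> - X \<omega>)\<^sup>2) \<partial>M) \<longlonglongrightarrow> 0"
    and ae: "AE \<omega> in M. (\<lambda>n. S n \<omega>) \<longlonglongrightarrow> Y \<omega>"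
  shows "AE \<omega> in M. Y \<omega> = X \<omega>"
proof -
  have "(\<integral>\<^sup>+\<omega>. ennreal ((Y \<omega> - X \<omega>)\<^sup>2) \<partial>M) = (\<integral>\<^sup>+\<omega>. liminf (\<lambda>n. ennreal ((S n \<omega> - X \<omega>)\<^sup>2)) \<partial>M)"
  proof (rule nn_integral_cong_AE, rule eventually_mono[OF ae])
    fix \<omega> assume "(\<lambda>n. S n \<omega>) \<longlonglongrightarrow> Y \<omega>"
    then have "(\<lambda>n. ennreal ((S n \<omega> - X \<omega>)\<^sup>2)) \<longlonglongrightarrow> ennreal ((Y \<omega> - X \<omega>)\<^sup>2)"
      by (intro tendsto_intros)
    then show "ennreal ((Y \<omega> - X \<omega>)\<^sup>2) = liminf (\<lambda>n. ennreal ((S n \<omega> - X \<omega>)\<^sup>2))"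
      by (rule lim_imp_Liminf[OF sequentially_bot, symmetric])
  qed
  also have "\<dots> \<le> liminf (\<lambda>n. \<integral>\<^sup>+\<omega>. ennreal ((S n \<omega> - X \<omega>)\<^sup>2) \<partial>M)"
    by (rule nn_integral_liminf) simp
  also have "\<dots> = 0" by (rule lim_imp_Liminf[OF sequentially_bot L2])
  finally have "(\<integral>\<^sup>+\<omega>. ennreal ((Y \<omega> - X \<omega>)\<^sup>2) \<partial>M) = 0" by simp
  then have "AE \<omega> in M. ennreal ((Y \<omega> - X \<omega>)\<^sup>2) = 0" by (subst (asm) nn_integral_0_iff_AE) auto
  then show ?thesis by (rule eventually_mono) (simp add: ennreal_eq_0_iff)
qed

context volterra_convolution
begin

abbreviation X :: "real \<Rightarrow> 'a \<Rightarrow> real" where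
  "X \<equiv> B_hat M B \<eta>"

text \<open>The factor \<open>sqrt 2\<close> on \<eta> absorbs the factor 2 in the variance bound
  for increments. At level \<open>4 * sqrt (2 ^ p)\<close> the exponent is
  \<open>16 * 2 ^ p / 4\<close>.\<close>

lemma increment_tail:
  assumes "0 \<le> s" "s \<le> t" "t \<le> T" "t - s \<le> T / real (grid_size p)"
  shows "prob {\<omega> \<in> space M. 4 * sqrt (2 ^ p) * (sqrt 2 * \<eta> (T / real (grid_size p))) \<le> \<bar>X t \<omega> - X s \<omega>\<bar>}
    \<le> 2 * exp (- 4 * 2 ^ p)"
proof -
  obtain v where v: "v \<le> 2 * energy (t - s)" "centered_gaussian M v (\<lambda>\<omega>. X t \<omega> - X s \<omega>)"
    using centered_gaussian_B_hat_increment[OF assms(1-3)] by blast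
  note mesh = grid_mesh_bounds[of p]
  have "energy (t - s) \<le> (\<eta> (T / real (grid_size p)))\<^sup>2"
    using energy_mono[OF assms(4)] energy_eq[OF mesh] by simp
  then have "v \<le> (sqrt 2 * \<eta> (T / real (grid_size p)))\<^sup>2" using v(1) by (simp add: power_mult_distrib)
  from centered_gaussian_tail[OF v(2) this, of "4 * sqrt (2 ^ p)"] eta_pos[OF mesh]
  show ?thesis by (simp add: power_mult_distrib)
qed

section \<open>Borel-Cantelli for the chaining events\<close>

text \<open>The two families cover failure of the premises \<open>link\<close> and
  \<open>step\<close> of \<open>chaining_uniformly_continuous\<close>, with the threshold as
  \<open>a p\<close>.\<close>

definition bad_event :: "nat \<Rightarrow> 'a set" where
  "bad_event p =
    (\<Union>k\<in>{..grid_size (Suc p)}. {\<omega> \<in> space M. 4 * sqrt (2 ^ p) * (sqrt 2 * \<eta> (T / real (grid_size p)))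
        \<le> \<bar>X (grid_point T (Suc p) k) \<omega> - X (grid_point T p (k div grid_size p)) \<omega>\<bar>}) \<union>
    (\<Union>k\<in>{..<grid_size p}. {\<omega> \<in> space M. 4 * sqrt (2 ^ p) * (sqrt 2 * \<eta> (T / real (grid_size p)))
        \<le> \<bar>X (grid_point T p (Suc k)) \<omega> - X (grid_point T p k) \<omega>\<bar>})"

lemma grid_point_bounds:
  assumes "k \<le> grid_size p"
  shows "0 \<le> grid_point T p k" "grid_point T p k \<le> T"
proof -
  show "0 \<le> grid_point T p k" using T_pos by (simp add: grid_point_def)
  have "T * real k \<le> T * real (grid_size p)" using assms T_pos by (intro mult_left_mono) auto
  then show "grid_point T p k \<le> T" using grid_size_pos[of p] by (simp add: grid_point_def field_simps)
qed

lemma grid_point_coarsen: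
  assumes "k \<le> grid_size (Suc p)"
  shows "k div grid_size p \<le> grid_size p"
    "grid_point T p (k div grid_size p) \<le> grid_point T (Suc p) k"
    "grid_point T (Suc p) k - grid_point T p (k div grid_size p) \<le> T / real (grid_size p)"
proof -
  let ?N = "grid_size p"
  have N: "0 < ?N" by (rule grid_size_pos)
  have "k div ?N \<le> (?N * ?N) div ?N" using assms unfolding grid_size_Suc by (rule div_le_mono)
  then show "k div ?N \<le> ?N" using N by simp
  have "real k = real ?N * real (k div ?N) + real (k mod ?N)"
    by (metis mult_div_mod_eq of_nat_add of_nat_mult)
  then have eq: "grid_point T (Suc p) k
      = grid_point T p (k div ?N) + T / real ?N * (real (k mod ?N) / real ?N)"
    using N by (simp add: grid_point_def grid_size_Suc field_simps)
  have "0 \<le> T / real ?N * (real (k mod ?N) / real ?N)" using T_pos by simp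
  then show "grid_point T p (k div ?N) \<le> grid_point T (Suc p) k" unfolding eq by simp
  have "real (k mod ?N) / real ?N \<le> 1" using N by (simp add: less_imp_le)
  then have "T / real ?N * (real (k mod ?N) / real ?N) \<le> T / real ?N * 1"
    using T_pos by (intro mult_left_mono) auto
  then show "grid_point T (Suc p) k - grid_point T p (k div ?N) \<le> T / real ?N" unfolding eq by simp
qed

lemma grid_point_Suc_diff: "grid_point T p (Suc k) - grid_point T p k = T / real (grid_size p)"
  by (simp add: grid_point_def distrib_left add_divide_distrib)

lemma borel_measurable_X_grid:
  "k \<le> grid_size p \<Longrightarrow> X (grid_point T p k) \<in> borel_measurable M"
  using grid_point_bounds by (intro borel_measurable_B_hat)

lemma increment_event_sets:
  assumes "U \<in> borel_measurable M" "V \<in> borel_measurable M"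
  shows "{\<omega> \<in> space M. c \<le> \<bar>U \<omega> - V \<omega> :: real\<bar>} \<in> events"
  using assms by measurable

lemma link_event_sets:
  assumes "k \<le> grid_size (Suc p)"
  shows "{\<omega> \<in> space M. c \<le> \<bar>X (grid_point T (Suc p) k) \<omega> - X (grid_point T p (k div grid_size p)) \<omega>\<bar>} \<in> events"
  using assms grid_point_coarsen(1)[OF assms] by (intro increment_event_sets borel_measurable_X_grid)

lemma step_event_sets:
  assumes "k < grid_size p"
  shows "{\<omega> \<in> space M. c \<le> \<bar>X (grid_point T p (Suc k)) \<omega> - X (grid_point T p k) \<omega>\<bar>} \<in> events"
  using assms by (intro increment_event_sets borel_measurable_X_grid) auto

lemma bad_event_sets: "bad_event p \<in> events"
  unfolding bad_event_def
  by (intro sets.Un sets.finite_UN link_event_sets step_event_sets) auto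

text \<open>With \<open>N = grid_size p\<close> there are \<open>N * N + 1 + N\<close>, hence at
  most \<open>3 * N * N\<close>, increments. As \<open>N\<close> is at most
  \<open>exp (2 ^ p)\<close>, the tail \<open>2 * exp (- 4 * 2 ^ p)\<close> leaves
  \<open>6 * exp (- 2 * 2 ^ p)\<close>, far below a geometric sequence.\<close>

lemma prob_bad_event: "prob (bad_event p) \<le> 6 * (1 / 2) ^ p"
proof -
  let ?N = "grid_size p" and ?c = "4 * sqrt (2 ^ p) * (sqrt 2 * \<eta> (T / real (grid_size p)))"
  let ?A = "\<lambda>k. {\<omega> \<in> space M. ?c \<le> \<bar>X (grid_point T (Suc p) k) \<omega> - X (grid_point T p (k div ?N)) \<omega>\<bar>}"
  let ?B = "\<lambda>k. {\<omega> \<in> space M. ?c \<le> \<bar>X (grid_point T p (Suc k)) \<omega> - X (grid_point T p k) \<omega>\<bar>}"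
  let ?e = "2 * exp (- 4 * 2 ^ p) :: real"
  have A: "prob (?A k) \<le> ?e" if "k \<le> grid_size (Suc p)" for k
    using grid_point_bounds[OF grid_point_coarsen(1)[OF that]] grid_point_bounds[OF that] grid_point_coarsen[OF that]
    by (intro increment_tail)
  have B: "prob (?B k) \<le> ?e" if "k < ?N" for k
  proof (rule increment_tail)
    show "0 \<le> grid_point T p k" using grid_point_bounds[of k p] that by simp
    show "grid_point T p (Suc k) \<le> T" using grid_point_bounds[of "Suc k" p] that by simp
    show "grid_point T p k \<le> grid_point T p (Suc k)"
      using grid_point_Suc_diff[of p k] grid_mesh_bounds(1)[of p] by linarith
  qed (simp add: grid_point_Suc_diff)
  have "prob (bad_event p) \<le> prob (\<Union>k\<in>{..grid_size (Suc p)}. ?A k) + prob (\<Union>k\<in>{..<?N}. ?B k)"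
    unfolding bad_event_def
    by (intro measure_Un_le sets.finite_UN link_event_sets step_event_sets) auto
  also have "\<dots> \<le> (\<Sum>k\<in>{..grid_size (Suc p)}. prob (?A k)) + (\<Sum>k\<in>{..<?N}. prob (?B k))"
  proof (rule add_mono)
    show "prob (\<Union>k\<in>{..grid_size (Suc p)}. ?A k) \<le> (\<Sum>k\<in>{..grid_size (Suc p)}. prob (?A k))"
      by (rule finite_measure_subadditive_finite) (auto intro!: link_event_sets)
    show "prob (\<Union>k\<in>{..<?N}. ?B k) \<le> (\<Sum>k\<in>{..<?N}. prob (?B k))"
      by (rule finite_measure_subadditive_finite) (auto intro!: step_event_sets)
  qed
  also have "\<dots> \<le> (\<Sum>k\<in>{..grid_size (Suc p)}. ?e) + (\<Sum>k\<in>{..<?N}. ?e)"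
    by (intro add_mono sum_mono A B) auto
  also have "\<dots> = (real ?N * real ?N + 1 + real ?N) * ?e"
    by (simp add: grid_size_Suc algebra_simps)
  also have "\<dots> \<le> 3 * (real ?N * real ?N) * ?e"
  proof (rule mult_right_mono)
    have "1 \<le> real ?N" using grid_size_pos[of p] by simp
    then have "1 * real ?N \<le> real ?N * real ?N" by (intro mult_right_mono) auto
    then show "real ?N * real ?N + 1 + real ?N \<le> 3 * (real ?N * real ?N)" using \<open>1 \<le> real ?N\<close> by linarith
  qed simp
  also have "\<dots> \<le> 3 * (exp (2 ^ p) * exp (2 ^ p)) * ?e"
  proof -
    have "(2::real) \<le> exp 1" using exp_ge_add_one_self[of 1] by simp
    then have "(2::real) ^ 2 ^ p \<le> exp 1 ^ 2 ^ p" by (intro power_mono) auto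
    also have "\<dots> = exp (2 ^ p)" using exp_of_nat_mult[of "2 ^ p" "1::real"] by simp
    finally have "real ?N \<le> exp (2 ^ p)" by (simp add: grid_size_def)
    then show ?thesis by (intro mult_right_mono mult_left_mono mult_mono) auto
  qed
  also have "\<dots> = 6 * exp (- (2 * 2 ^ p))"
    by (simp add: exp_add[symmetric])
  also have "\<dots> \<le> 6 * exp (- real p)"
  proof -
    have "real p \<le> 2 ^ p" using less_exp[of p] by (metis less_imp_le of_nat_le_iff of_nat_numeral of_nat_power)
    then have "real p \<le> 2 * 2 ^ p" by (simp add: order_trans[of _ "2 ^ p"])
    then show ?thesis by simp
  qed
  also have "\<dots> \<le> 6 * (1 / 2) ^ p"
  proof -
    have "(2::real) \<le> exp 1" using exp_ge_add_one_self[of 1] by simp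
    then have "exp (- 1) \<le> (1 / 2 :: real)" by (simp add: exp_minus inverse_eq_divide field_simps)
    then have "exp (- 1) ^ p \<le> (1 / 2 :: real) ^ p" by (intro power_mono) auto
    moreover have "exp (- real p) = exp (- 1) ^ p" using exp_of_nat_mult[of p "- 1 :: real"] by simp
    ultimately show ?thesis by simp
  qed
  finally show ?thesis .
qed

lemma AE_eventually_not_bad: "AE \<omega> in M. \<exists>p0. \<forall>p\<ge>p0. \<omega> \<in> space M - bad_event p"
proof -
  have "summable (\<lambda>p. 6 * (1 / 2 :: real) ^ p)" by (intro summable_mult summable_geometric) simp
  then have "summable (\<lambda>p. prob (bad_event p))"
    by (rule summable_comparison_test'[where N=0]) (simp add: prob_bad_event)
  then have "AE \<omega> in M. eventually (\<lambda>p. \<omega> \<in> space M - bad_event p) sequentially"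
    by (intro borel_cantelli_AE1 bad_event_sets) (auto simp: emeasure_eq_measure)
  then show ?thesis by (simp only: eventually_sequentially)
qed

lemma uniformly_continuous_on_grid:
  assumes "fernique_condition T \<eta>" "\<forall>p\<ge>p0. \<omega> \<in> space M - bad_event p"
  shows "uniformly_continuous_on {grid_point T p k | p k. k \<le> grid_size p} (\<lambda>t. X t \<omega>)"
proof (rule chaining_uniformly_continuous[OF T_pos])
  let ?a = "\<lambda>p. 4 * sqrt (2 ^ p) * (sqrt 2 * \<eta> (T / real (grid_size p)))"
  have "summable (\<lambda>p. (4 * sqrt 2) * (sqrt (2 ^ p) * \<eta> (T / real (grid_size p))))"
    by (intro summable_mult fernique_summable assms)
  then show "summable ?a" by (simp add: mult_ac)
  show "0 \<le> ?a p" for p using eta_pos[OF grid_mesh_bounds[of p]] by simp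
  show "\<bar>X (grid_point T (Suc p) k) \<omega> - X (grid_point T p (k div grid_size p)) \<omega>\<bar> \<le> ?a p"
    if "p0 \<le> p" "k \<le> grid_size (Suc p)" for p k
    using assms(2) that unfolding bad_event_def by force
  show "\<bar>X (grid_point T p (Suc k)) \<omega> - X (grid_point T p k) \<omega>\<bar> \<le> ?a p"
    if "p0 \<le> p" "k < grid_size p" for p k
    using assms(2) that unfolding bad_event_def by force
qed

section \<open>The continuous version\<close>

text \<open>The extension to the closure is rewritten as a limit along \<open>grid_floor\<close>, a
  fixed sequence of times for each \<open>t\<close>, so that it is visibly measurable in the sample
  point.\<close>

lemma grid_extension:
  fixes x :: "real \<Rightarrow> real"
  assumes "uniformly_continuous_on {grid_point T p k | p k. k \<le> grid_size p} x"
  shows "continuous_on {0..T} (\<lambda>t. lim (\<lambda>n. x (grid_floor T n t)))"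
    "\<And>t. 0 \<le> t \<Longrightarrow> t \<le> T \<Longrightarrow> convergent (\<lambda>n. x (grid_floor T n t))"
proof -
  let ?D = "{grid_point T p k | p k. k \<le> grid_size p}"
  obtain h where h: "uniformly_continuous_on (closure ?D) h" "\<And>t. t \<in> ?D \<Longrightarrow> x t = h t"
    by (rule uniformly_continuous_on_extension_on_closure[OF assms]) blast
  have cl: "t \<in> closure ?D" if "0 \<le> t" "t \<le> T" for t
    unfolding closure_sequential
    using grid_floor_in_grid[OF T_pos that] grid_floor_tendsto[OF T_pos that(1)]
    by (intro exI[of _ "\<lambda>n. grid_floor T n t"]) blast
  have cont: "continuous_on (closure ?D) h" using h(1) by (rule uniformly_continuous_imp_continuous)
  have lim: "(\<lambda>n. x (grid_floor T n t)) \<longlonglongrightarrow> h t" if t: "0 \<le> t" "t \<le> T" for t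
  proof -
    have "(\<lambda>n. h (grid_floor T n t)) \<longlonglongrightarrow> h t"
      using continuous_on_tendsto_compose[OF cont grid_floor_tendsto[OF T_pos t(1)] cl[OF t]]
        grid_floor_in_grid[OF T_pos t] closure_subset[of ?D] by (auto intro!: always_eventually)
    then show ?thesis using h(2)[OF grid_floor_in_grid[OF T_pos t]] by simp
  qed
  show "convergent (\<lambda>n. x (grid_floor T n t))" if "0 \<le> t" "t \<le> T" for t
    using lim[OF that] by (rule convergentI)
  have "continuous_on {0..T} h" by (rule continuous_on_subset[OF cont]) (use cl in auto)
  then show "continuous_on {0..T} (\<lambda>t. lim (\<lambda>n. x (grid_floor T n t)))"
    by (rule continuous_on_eq) (metis atLeastAtMost_iff lim limI)
qed

lemma continuous_version_exists:
  assumes F: "fernique_condition T \<eta>"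
  shows "\<exists>Y. continuous_version M T X Y"
proof -
  obtain N where N: "{\<omega> \<in> space M. \<not> (\<exists>p0. \<forall>p\<ge>p0. \<omega> \<in> space M - bad_event p)} \<subseteq> N"
    "emeasure M N = 0" "N \<in> events"
    using AE_eventually_not_bad by (rule AE_E)
  \<comment> \<open>A continuous version must have continuous paths at every sample point, so the
    exceptional null set receives the zero path.\<close>
  define Y where "Y t \<omega> = (if \<omega> \<in> N then 0 else lim (\<lambda>n. X (grid_floor T n t) \<omega>))" for t \<omega>
  have uc: "uniformly_continuous_on {grid_point T p k | p k. k \<le> grid_size p} (\<lambda>t. X t \<omega>)"
    if \<omega>: "\<omega> \<in> space M" "\<omega> \<notin> N" for \<omega>
  proof -
    obtain p0 where "\<forall>p\<ge>p0. \<omega> \<in> space M - bad_event p" using N(1) \<omega> by blast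
    then show ?thesis by (rule uniformly_continuous_on_grid[OF F])
  qed
  have cont: "continuous_on {0..T} (\<lambda>t. Y t \<omega>)" if "\<omega> \<in> space M" for \<omega>
    using grid_extension(1)[OF uc[OF that]] by (cases "\<omega> \<in> N") (simp_all add: Y_def)
  have Xm: "X (grid_floor T n t) \<in> borel_measurable M" if "0 \<le> t" "t \<le> T" for n t
    using grid_floor_bounds[OF T_pos that(1), of n] that by (intro borel_measurable_B_hat) auto
  have Ym: "Y t \<in> borel_measurable M" if t: "0 \<le> t" "t \<le> T" for t
  proof -
    have "(\<lambda>\<omega>. lim (\<lambda>n. X (grid_floor T n t) \<omega>)) \<in> borel_measurable M"
      by (rule borel_measurable_lim_metric) (rule Xm[OF t])
    then show ?thesis unfolding Y_def[abs_def] using N(3) by measurable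
  qed
  have ae: "AE \<omega> in M. Y t \<omega> = X t \<omega>" if t: "0 \<le> t" "t \<le> T" for t
  proof (rule AE_eq_limit_of_L2_limit[OF Xm[OF t] borel_measurable_B_hat[OF t] Ym[OF t]])
    have "AE \<omega> in M. \<omega> \<notin> N" using N(2,3) by (intro AE_not_in) auto
    moreover have "AE \<omega> in M. \<omega> \<in> space M" by (rule AE_space)
    ultimately show "AE \<omega> in M. (\<lambda>n. X (grid_floor T n t) \<omega>) \<longlonglongrightarrow> Y t \<omega>"
    proof eventually_elim
      case (elim \<omega>)
      then show ?case
        using grid_extension(2)[OF uc[OF elim(2,1)] t] by (simp add: Y_def convergent_LIMSEQ_iff)
    qed
    \<comment> \<open>Mean-square continuity: the variance of the increment is at most twice \<eta>
      squared at the mesh, and this tends to 0.\<close>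
    have bd: "(\<integral>\<^sup>+\<omega>. ennreal ((X (grid_floor T n t) \<omega> - X t \<omega>)\<^sup>2) \<partial>M)
        \<le> ennreal (2 * (\<eta> (T / real (grid_size n)))\<^sup>2)" for n
    proof -
      note fl = grid_floor_bounds[OF T_pos t(1), of n]
      obtain v where v: "v \<le> 2 * energy (t - grid_floor T n t)"
        "centered_gaussian M v (\<lambda>\<omega>. X t \<omega> - X (grid_floor T n t) \<omega>)"
        using centered_gaussian_B_hat_increment[OF fl(1,2) t(2)] by blast
      have "energy (t - grid_floor T n t) \<le> (\<eta> (T / real (grid_size n)))\<^sup>2"
        using energy_mono[OF fl(3)] energy_eq[OF grid_mesh_bounds[of n]] by simp
      then show ?thesis
        using centered_gaussian_nn_integral_power2[OF v(2)] v(1)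
        by (simp add: power2_commute[of "X t _"] ennreal_leI)
    qed
    have mesh: "filterlim (\<lambda>n. T / real (grid_size n)) (at_right 0) sequentially"
      using grid_mesh_tendsto_0 grid_mesh_bounds(1) by (intro tendsto_imp_filterlim_at_right) auto
    have "(\<lambda>n. 2 * (\<eta> (T / real (grid_size n)))\<^sup>2) \<longlonglongrightarrow> 2 * 0\<^sup>2"
      by (intro tendsto_intros filterlim_compose[OF eta_tendsto_0 mesh])
    then have "(\<lambda>n. ennreal (2 * (\<eta> (T / real (grid_size n)))\<^sup>2)) \<longlonglongrightarrow> ennreal (2 * 0\<^sup>2)"
      by (rule tendsto_ennrealI)
    then have lim': "(\<lambda>n. ennreal (2 * (\<eta> (T / real (grid_size n)))\<^sup>2)) \<longlonglongrightarrow> 0" by simp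
    show "(\<lambda>n. \<integral>\<^sup>+\<omega>. ennreal ((X (grid_floor T n t) \<omega> - X t \<omega>)\<^sup>2) \<partial>M) \<longlonglongrightarrow> 0"
      by (rule tendsto_sandwich[OF always_eventually always_eventually tendsto_const lim'])
        (intro allI zero_le bd)+
  qed
  show ?thesis unfolding continuous_version_def using cont Ym ae by (intro exI[of _ Y]) auto
qed

section \<open>Roughness at time 0\<close>

text \<open>If the power bound held at all times, it would hold at each \<open>u n\<close>; by the
  small-ball estimate that has probability at most \<open>C * (u n powr a / \<eta> (u n))\<close>,
  which tends to 0. No independence between the times is involved.\<close>

lemma AE_not_power_bounded_at_0:
  assumes grow: "((\<lambda>x. x powr a / \<eta> x) \<longlongrightarrow> 0) (at_right 0)" and C: "0 \<le> C"
    and Y: "continuous_version M T X Y"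
  shows "AE \<omega> in M. \<exists>t. 0 < t \<and> t \<le> T \<and> C * t powr a < \<bar>Y t \<omega> - Y 0 \<omega>\<bar>"
proof -
  define u where "u n = T / real (grid_size n)" for n
  have u: "0 < u n" "u n < T" for n unfolding u_def by (rule grid_mesh_bounds)+
  have ulim: "filterlim u (at_right 0) sequentially"
    unfolding u_def[abs_def] using grid_mesh_tendsto_0 grid_mesh_bounds(1)
    by (intro tendsto_imp_filterlim_at_right) auto
  have Ym[measurable]: "Y 0 \<in> borel_measurable M" "\<And>n. Y (u n) \<in> borel_measurable M"
    using Y u T_pos by (auto simp: continuous_version_def less_imp_le)
  have "AE \<omega> in M. Y 0 \<omega> = X 0 \<omega>" using Y T_pos by (simp add: continuous_version_def)
  moreover have "AE \<omega> in M. X 0 \<omega> = 0"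
    using centered_gaussian_B_hat[of 0] T_pos by (intro centered_gaussian_AE_zero) (simp add: energy_0)
  ultimately have Y0: "AE \<omega> in M. Y 0 \<omega> = 0" by eventually_elim simp
  let ?E = "\<lambda>n. {\<omega> \<in> space M. \<bar>Y (u n) \<omega> - Y 0 \<omega>\<bar> \<le> C * u n powr a}"
  \<comment> \<open>Restricting to a sequence of times makes the event a countable intersection,
    hence measurable.\<close>
  define E where "E = (\<Inter>n. ?E n)"
  have "E = {\<omega> \<in> space M. \<forall>n. \<bar>Y (u n) \<omega> - Y 0 \<omega>\<bar> \<le> C * u n powr a}" unfolding E_def by auto
  then have Em: "E \<in> events" by simp
  have small: "prob (?E n) \<le> C * (u n powr a / \<eta> (u n))" for n
  proof -
    have [measurable]: "X (u n) \<in> borel_measurable M" using u[of n] by (intro borel_measurable_B_hat) auto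
    have "AE \<omega> in M. Y (u n) \<omega> = X (u n) \<omega>" using Y u[of n] by (simp add: continuous_version_def)
    then have "AE \<omega> in M. (\<omega> \<in> ?E n) = (\<omega> \<in> {\<omega> \<in> space M. \<bar>X (u n) \<omega>\<bar> \<le> C * u n powr a})"
      using Y0 by eventually_elim simp
    then have "prob (?E n) = prob {\<omega> \<in> space M. \<bar>X (u n) \<omega>\<bar> \<le> C * u n powr a}"
      by (rule finite_measure_eq_AE) measurable
    also have "\<dots> \<le> C * u n powr a / sqrt ((\<eta> (u n))\<^sup>2)"
      using u[of n] eta_pos[OF u[of n]] C centered_gaussian_B_hat[of "u n"]
      by (intro centered_gaussian_small_ball) (simp_all add: energy_eq)
    also have "\<dots> = C * (u n powr a / \<eta> (u n))" using eta_pos[OF u[of n]] by simp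
    finally show ?thesis .
  qed
  have "prob E \<le> C * (u n powr a / \<eta> (u n))" for n
  proof -
    have "prob E \<le> prob (?E n)" unfolding E_def by (intro finite_measure_mono) auto
    then show ?thesis using small[of n] by linarith
  qed
  moreover have "(\<lambda>n. C * (u n powr a / \<eta> (u n))) \<longlonglongrightarrow> C * 0"
    by (intro tendsto_intros filterlim_compose[OF grow ulim])
  ultimately have "prob E \<le> C * 0" by (intro LIMSEQ_le_const) auto
  then have "prob E \<le> 0" by simp
  then have "prob E = 0" by (simp add: measure_le_0_iff)
  then have "AE \<omega> in M. \<omega> \<notin> E" using Em by (simp add: prob_eq_0)
  moreover have "AE \<omega> in M. \<omega> \<in> space M" by (rule AE_space)
  ultimately show ?thesis
  proof eventually_elim
    case (elim \<omega>)
    then obtain n where "C * u n powr a < \<bar>Y (u n) \<omega> - Y 0 \<omega>\<bar>" by (auto simp: E_def not_le)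
    then show ?case using u[of n] by (intro exI[of _ "u n"]) auto
  qed
qed

text \<open>Natural constants and exponents \<open>1 / real (Suc m)\<close> form a countable family,
  so one null set serves all. A Hoelder bound with exponent \<open>r > 1 / real (Suc m)\<close>
  implies one with the smaller exponent.\<close>

lemma super_rough_version:
  assumes grow: "\<forall>a>0. ((\<lambda>x. x powr a / \<eta> x) \<longlongrightarrow> 0) (at_right 0)"
    and Y: "continuous_version M T X Y"
  shows "super_rough M T Y"
proof -
  have "AE \<omega> in M. \<forall>C::nat. \<forall>m::nat. \<exists>t. 0 < t \<and> t \<le> T \<and> real C * t powr (1 / real (Suc m)) < \<bar>Y t \<omega> - Y 0 \<omega>\<bar>"
    unfolding AE_all_countable using grow by (intro allI AE_not_power_bounded_at_0[OF _ _ Y]) auto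
  then show ?thesis
    unfolding super_rough_def
  proof (rule eventually_mono, intro ballI notI)
    fix \<omega> and r :: real
    assume rough: "\<forall>C::nat. \<forall>m::nat. \<exists>t. 0 < t \<and> t \<le> T \<and> real C * t powr (1 / real (Suc m)) < \<bar>Y t \<omega> - Y 0 \<omega>\<bar>"
      and r: "r \<in> {0<..<1}" and holder: "(\<lambda>t. Y t \<omega>) \<in> holder_class T r"
    obtain K where K: "\<And>s t. 0 \<le> s \<Longrightarrow> s < t \<Longrightarrow> t \<le> T \<Longrightarrow> \<bar>Y t \<omega> - Y s \<omega>\<bar> / (t - s) powr r \<le> K"
      using holder unfolding holder_class_def bdd_above_def by blast
    obtain m where m: "1 / real (Suc m) < r" using r nat_approx_posE[of r] by auto
    \<comment> \<open>Absorbs the Hoelder constant and the factor lost on \<open>[0, T]\<close> when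
      the exponent is lowered.\<close>
    obtain C :: nat where C: "\<bar>K\<bar> * T powr (r - 1 / real (Suc m)) \<le> real C" using real_arch_simple by blast
    obtain t where t: "0 < t" "t \<le> T" "real C * t powr (1 / real (Suc m)) < \<bar>Y t \<omega> - Y 0 \<omega>\<bar>"
      using rough by blast
    have "\<bar>Y t \<omega> - Y 0 \<omega>\<bar> \<le> K * t powr r" using K[of 0 t] t by (simp add: field_simps)
    also have "\<dots> \<le> \<bar>K\<bar> * t powr r" by (intro mult_right_mono) auto
    also have "t powr r = t powr (r - 1 / real (Suc m)) * t powr (1 / real (Suc m))"
      by (simp add: powr_add[symmetric])
    also have "\<bar>K\<bar> * \<dots> \<le> \<bar>K\<bar> * (T powr (r - 1 / real (Suc m)) * t powr (1 / real (Suc m)))"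
      using t m by (intro mult_left_mono mult_right_mono powr_mono2) auto
    also have "\<dots> \<le> real C * t powr (1 / real (Suc m))"
      using mult_right_mono[OF C, of "t powr (1 / real (Suc m))"] by (simp add: mult_ac)
    finally show False using t(3) by simp
  qed
qed

end

theorem lemma3p6:
  fixes T :: real and \<eta> :: "real \<Rightarrow> real"
    and M :: "'a measure" and B :: "real \<Rightarrow> 'a \<Rightarrow> real"
  assumes "0 < T"
    and "modulus_of_continuity T \<eta>"
    and "C2_on {0<..<T} \<eta>"
    and "\<forall>x\<in>{0<..<T}. 0 < deriv (\<lambda>y. (\<eta> y)\<^sup>2) x"
    and "antimono_on {0<..<T} (deriv (\<lambda>y. (\<eta> y)\<^sup>2))"
    and "\<forall>a>0. ((\<lambda>x. x powr a / \<eta> x) \<longlongrightarrow> 0) (at_right 0)"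
    and "fernique_condition T \<eta>"
    and "standard_brownian_motion M T B"
  shows "volterra_gaussian_process M T B (conv_kernel (tau \<eta>)) (B_hat M B \<eta>) \<and>
         (\<exists>Y. continuous_version M T (B_hat M B \<eta>) Y) \<and>
         (\<forall>Y. continuous_version M T (B_hat M B \<eta>) Y \<longrightarrow> super_rough M T Y)"
proof -
  interpret volterra_convolution M T B \<eta>
    using assms by unfold_locales
  show ?thesis
    using volterra_gaussian_process_B_hat continuous_version_exists super_rough_version assms by blast
qed

end
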